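(* Fix $\epsilon\in(0,1)$. In the dynamic fractional hypergraph $b$-matching problem (defined in the context), there is an algorithm that, after every update, maintains an $(f+1+\epsilon f)$-maximal solution of the LP for the current hypergraph, with amortized update time $O(f\cdot\log(m+n)/\epsilon^2)$.
   Context: Fractional hypergraph $b$-matching: a hypergraph $G=(V,E)$ with $|V|=n$ nodes and at most $m\ge|E|$ edges. For $v\in V$, $\mathcal{E}_v\subseteq E$ is the set of edges incident upon $v$; for $e\in E$, $\mathcal{V}_e=\{v\in V:e\in\mathcal{E}_v\}$. Each node $v$ has a capacity $c_v>0$, and $\mu\ge1$ is the edge multiplicity; $\mu$ and the $c_v$ are polynomially bounded in $n$. The LP is: maximize $\sum_{e\in E}x(e)$ subject to $\sum_{e\in\mathcal{E}_v}x(e)\le c_v$ for all $v\in V$ and $0\le x(e)\le\mu$ for all $e\in E$. A feasible solution $x$ is $\lambda$-maximal ($\lambda\ge1$) if for every edge $e$ with $x(e)<\mu$ there is a node $v\in\mathcal{V}_e$ with $\sum_{e'\in\mathcal{E}_v}x(e')\ge c_v/\lambda$. Dynamic version: the node set $V$, capacities $c_v$, multiplicity $\mu$, the upper bound $f$ on $\max_{e\in E}|\mathcal{V}_e|$, and the upper bound $m$ on the number of edges are fixed; initially $E=\emptyset$, and at each time step one edge is inserted into or deleted from $E$. Amortized update time $T$ means that the total running time over any sequence of $t$ updates starting from the empty edge set is $O(t\cdot T)$. *)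

theory Defs
  imports Complex_Main "HOL-Computational_Algebra.Polynomial"
begin

section \<open>Fractional hypergraph b-matching\<close>

text \<open>
  Edges are abstract names; a hypergraph maps each edge that is present to its set of endpoints,
  so that two different edges may have the same endpoints.
\<close>

type_synonym ('v, 'e) hypergraph = "'e \<rightharpoonup> 'v set"

definition edges_at :: "('v, 'e) hypergraph \<Rightarrow> 'v \<Rightarrow> 'e set" where
  "edges_at G v = {e \<in> dom G. v \<in> the (G e)}"

definition nodes_of :: "'v set \<Rightarrow> ('v, 'e) hypergraph \<Rightarrow> 'e \<Rightarrow> 'v set" where
  "nodes_of V G e = {v \<in> V. e \<in> edges_at G v}"

definition feasible ::
  "'v set \<Rightarrow> ('v \<Rightarrow> real) \<Rightarrow> real \<Rightarrow> ('v, 'e) hypergraph \<Rightarrow> ('e \<Rightarrow> real) \<Rightarrow> bool" where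
  "feasible V c \<mu> G x \<longleftrightarrow>
     (\<forall>v\<in>V. (\<Sum>e\<in>edges_at G v. x e) \<le> c v) \<and> (\<forall>e\<in>dom G. 0 \<le> x e \<and> x e \<le> \<mu>)"

definition maximal_solution ::
  "'v set \<Rightarrow> ('v \<Rightarrow> real) \<Rightarrow> real \<Rightarrow> real \<Rightarrow> ('v, 'e) hypergraph \<Rightarrow> ('e \<Rightarrow> real) \<Rightarrow> bool" where
  "maximal_solution V c \<mu> lam G x \<longleftrightarrow>
     feasible V c \<mu> G x \<and>
     (\<forall>e\<in>dom G. x e < \<mu> \<longrightarrow>
        (\<exists>v\<in>nodes_of V G e. (\<Sum>e'\<in>edges_at G v. x e') \<ge> c v / lam))"


section \<open>The dynamic problem\<close>

text \<open>
  The data fixed throughout a sequence of updates.  The nodes are the numbers below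
  \<open>num_nodes\<close>; edge names are arbitrary natural numbers.
\<close>

record params =
  num_nodes :: nat
  max_edges :: nat
  max_rank :: nat
  capacity :: "nat \<Rightarrow> real"
  edge_multiplicity :: real

abbreviation nodes :: "params \<Rightarrow> nat set" where
  "nodes I \<equiv> {..<num_nodes I}"

text \<open>
  The polynomial \<open>p\<close> is the one witnessing that the multiplicity and the capacities are polynomially
  bounded in the number of nodes.  For \<open>num_nodes I = 0\<close> or \<open>max_rank I = 0\<close> (no edge has an
  endpoint) the time bound could degenerate to 0.
\<close>

definition valid_params :: "real poly \<Rightarrow> params \<Rightarrow> bool" where
  "valid_params p I \<longleftrightarrow>
     num_nodes I \<ge> 1 \<and> max_rank I \<ge> 1 \<and>
     1 \<le> edge_multiplicity I \<and> edge_multiplicity I \<le> poly p (real (num_nodes I)) \<and>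
     (\<forall>v\<in>nodes I. 0 < capacity I v \<and> capacity I v \<le> poly p (real (num_nodes I)))"

text \<open>The endpoints of a new edge arrive as a list, in an order that carries no meaning.\<close>

datatype update = Insert nat "nat list" | Delete nat

fun apply_update :: "update \<Rightarrow> (nat, nat) hypergraph \<Rightarrow> (nat, nat) hypergraph" where
  "apply_update (Insert e vs) G = G(e \<mapsto> set vs)"
| "apply_update (Delete e) G = G(e := None)"

fun valid_update :: "params \<Rightarrow> (nat, nat) hypergraph \<Rightarrow> update \<Rightarrow> bool" where
  "valid_update I G (Insert e vs) \<longleftrightarrow>
     e \<notin> dom G \<and> card (dom G) + 1 \<le> max_edges I \<and>
     distinct vs \<and> set vs \<subseteq> nodes I \<and> length vs \<le> max_rank I"
| "valid_update I G (Delete e) \<longleftrightarrow> e \<in> dom G"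

fun valid_updates :: "params \<Rightarrow> (nat, nat) hypergraph \<Rightarrow> update list \<Rightarrow> bool" where
  "valid_updates I G [] \<longleftrightarrow> True"
| "valid_updates I G (u # us) \<longleftrightarrow> valid_update I G u \<and> valid_updates I (apply_update u G) us"

definition current_graph :: "update list \<Rightarrow> (nat, nat) hypergraph" where
  "current_graph us = fold apply_update us Map.empty"


section \<open>Model of computation\<close>

text \<open>
  A unit-cost real RAM, programmed in a structured language.  Memory consists of named arrays with
  two indices, holding natural numbers (with addition and truncated subtraction) or exact real
  numbers (with the four field operations).  Natural numbers can be compared, used as indices and
  converted to reals.  Reals can only be compared: there is no rounding and no conversion back to
  natural numbers.  A scalar variable is an array cell with both indices 0.  Running time counts
  one unit for each command executed and for each operator, constant or memory access in an
  expression evaluated.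
\<close>

record memory =
  nat_mem :: "string \<Rightarrow> nat \<Rightarrow> nat \<Rightarrow> nat"
  real_mem :: "string \<Rightarrow> nat \<Rightarrow> nat \<Rightarrow> real"

datatype nexp =
    NConst nat
  | NCell string nexp nexp
  | NAdd nexp nexp
  | NSub nexp nexp

datatype rexp =
    ROfNat nexp
  | RCell string nexp nexp
  | RAdd rexp rexp
  | RSub rexp rexp
  | RMul rexp rexp
  | RDiv rexp rexp

datatype bexp =
    NLess nexp nexp
  | RLess rexp rexp
  | Neg bexp
  | Conj bexp bexp

datatype com =
    Skip
  | NAssign string nexp nexp nexp
  | RAssign string nexp nexp rexp
  | Seq com com
  | Cond bexp com com
  | While bexp com

fun nval :: "nexp \<Rightarrow> memory \<Rightarrow> nat" where
  "nval (NConst k) s = k"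
| "nval (NCell a i j) s = nat_mem s a (nval i s) (nval j s)"
| "nval (NAdd a b) s = nval a s + nval b s"
| "nval (NSub a b) s = nval a s - nval b s"

fun rval :: "rexp \<Rightarrow> memory \<Rightarrow> real" where
  "rval (ROfNat a) s = real (nval a s)"
| "rval (RCell a i j) s = real_mem s a (nval i s) (nval j s)"
| "rval (RAdd a b) s = rval a s + rval b s"
| "rval (RSub a b) s = rval a s - rval b s"
| "rval (RMul a b) s = rval a s * rval b s"
| "rval (RDiv a b) s = rval a s / rval b s"

fun bval :: "bexp \<Rightarrow> memory \<Rightarrow> bool" where
  "bval (NLess a b) s \<longleftrightarrow> nval a s < nval b s"
| "bval (RLess a b) s \<longleftrightarrow> rval a s < rval b s"
| "bval (Neg b) s \<longleftrightarrow> \<not> bval b s"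
| "bval (Conj a b) s \<longleftrightarrow> bval a s \<and> bval b s"

fun ncost :: "nexp \<Rightarrow> nat" where
  "ncost (NConst k) = 1"
| "ncost (NCell a i j) = 1 + ncost i + ncost j"
| "ncost (NAdd a b) = 1 + ncost a + ncost b"
| "ncost (NSub a b) = 1 + ncost a + ncost b"

fun rcost :: "rexp \<Rightarrow> nat" where
  "rcost (ROfNat a) = 1 + ncost a"
| "rcost (RCell a i j) = 1 + ncost i + ncost j"
| "rcost (RAdd a b) = 1 + rcost a + rcost b"
| "rcost (RSub a b) = 1 + rcost a + rcost b"
| "rcost (RMul a b) = 1 + rcost a + rcost b"
| "rcost (RDiv a b) = 1 + rcost a + rcost b"

fun bcost :: "bexp \<Rightarrow> nat" where
  "bcost (NLess a b) = 1 + ncost a + ncost b"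
| "bcost (RLess a b) = 1 + rcost a + rcost b"
| "bcost (Neg b) = 1 + bcost b"
| "bcost (Conj a b) = 1 + bcost a + bcost b"

definition write_cell ::
  "string \<Rightarrow> nat \<Rightarrow> nat \<Rightarrow> 'a \<Rightarrow> (string \<Rightarrow> nat \<Rightarrow> nat \<Rightarrow> 'a) \<Rightarrow> (string \<Rightarrow> nat \<Rightarrow> nat \<Rightarrow> 'a)" where
  "write_cell a i j y M = M(a := (M a)(i := (M a i)(j := y)))"

text \<open>\<open>exec P s t s'\<close>: started in \<open>s\<close>, the program \<open>P\<close> halts in \<open>s'\<close> after time \<open>t\<close>.\<close>

inductive exec :: "com \<Rightarrow> memory \<Rightarrow> nat \<Rightarrow> memory \<Rightarrow> bool" where
  Skip: "exec Skip s 1 s"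
| NAssign:
    "exec (NAssign a i j b) s (1 + ncost i + ncost j + ncost b)
       (s\<lparr>nat_mem := write_cell a (nval i s) (nval j s) (nval b s) (nat_mem s)\<rparr>)"
| RAssign:
    "exec (RAssign a i j r) s (1 + ncost i + ncost j + rcost r)
       (s\<lparr>real_mem := write_cell a (nval i s) (nval j s) (rval r s) (real_mem s)\<rparr>)"
| Seq: "exec P s t s' \<Longrightarrow> exec Q s' t' s'' \<Longrightarrow> exec (Seq P Q) s (1 + t + t') s''"
| CondTrue: "bval b s \<Longrightarrow> exec P s t s' \<Longrightarrow> exec (Cond b P Q) s (1 + bcost b + t) s'"
| CondFalse: "\<not> bval b s \<Longrightarrow> exec Q s t s' \<Longrightarrow> exec (Cond b P Q) s (1 + bcost b + t) s'"
| WhileFalse: "\<not> bval b s \<Longrightarrow> exec (While b P) s (1 + bcost b) s"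
| WhileTrue:
    "bval b s \<Longrightarrow> exec P s t s' \<Longrightarrow> exec (While b P) s' t' s'' \<Longrightarrow>
     exec (While b P) s (1 + bcost b + t + t') s''"

inductive_cases exec_elims:
  "exec Skip s t s'"
  "exec (NAssign a i j b) s t s'"
  "exec (RAssign a i j r) s t s'"
  "exec (Seq P Q) s t s'"
  "exec (Cond b P Q) s t s'"
  "exec (While b P) s t s'"

lemma exec_deterministic: "exec P s t s1 \<Longrightarrow> exec P s t' s2 \<Longrightarrow> t' = t \<and> s2 = s1"
proof (induction arbitrary: t' s2 rule: exec.induct)
  case (WhileTrue b s P t1 s' t2 s'')
  from WhileTrue.prems obtain r r' q where
    "exec P s r q" "exec (While b P) q r' s2" "t' = Suc (bcost b + r + r')"
    by (rule exec_elims(6)) (use WhileTrue.hyps(1) in blast)+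
  with WhileTrue.IH show ?case by simp
next
  case (Seq P s t1 s' Q t2 s'')
  from Seq.prems obtain r r' q where "exec P s r q" "exec Q q r' s2" "t' = Suc (r + r')"
    by (rule exec_elims(4))
  with Seq.IH show ?case by simp
next
  case (CondTrue b s P t1 s' Q)
  from CondTrue.prems show ?case by (rule exec_elims(5)) (use CondTrue.hyps(1) CondTrue.IH in simp_all)
next
  case (CondFalse b s Q t1 s' P)
  from CondFalse.prems show ?case by (rule exec_elims(5)) (use CondFalse.hyps(1) CondFalse.IH in simp_all)
next
  case (WhileFalse b s P)
  from WhileFalse.prems show ?case by (rule exec_elims(6)) (use WhileFalse.hyps in simp_all)
qed (auto elim: exec_elims(1-3))


section \<open>Dynamic algorithms\<close>

text \<open>
  Before the first update the memory is zero except for the parameters of the instance.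
  There is no preprocessing phase that would be exempt from the time bound.
\<close>

definition initial_memory :: "params \<Rightarrow> real \<Rightarrow> memory" where
  "initial_memory I \<epsilon> =
     \<lparr>nat_mem = (\<lambda>_ _ _. 0)
        (''n'' := (\<lambda>_ _. num_nodes I), ''m'' := (\<lambda>_ _. max_edges I), ''f'' := (\<lambda>_ _. max_rank I)),
      real_mem = (\<lambda>_ _ _. 0)
        (''eps'' := (\<lambda>_ _. \<epsilon>), ''mu'' := (\<lambda>_ _. edge_multiplicity I),
         ''c'' := (\<lambda>v _. if v < num_nodes I then capacity I v else 0))\<rparr>"

text \<open>
  The program is run once per update, in the memory left by the previous run, with the update
  written to the arrays below.  A deletion names the edge but does not repeat its endpoints.
\<close>

fun load_update :: "update \<Rightarrow> memory \<Rightarrow> memory" where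
  "load_update (Insert e vs) s = s\<lparr>nat_mem := (nat_mem s)
     (''op'' := (\<lambda>_ _. 0), ''edge'' := (\<lambda>_ _. e), ''deg'' := (\<lambda>_ _. length vs),
      ''ends'' := (\<lambda>i _. if i < length vs then vs ! i else 0))\<rparr>"
| "load_update (Delete e) s = s\<lparr>nat_mem := (nat_mem s)
     (''op'' := (\<lambda>_ _. 1), ''edge'' := (\<lambda>_ _. e), ''deg'' := (\<lambda>_ _. 0),
      ''ends'' := (\<lambda>_ _. 0))\<rparr>"

inductive process :: "com \<Rightarrow> memory \<Rightarrow> update list \<Rightarrow> nat \<Rightarrow> memory \<Rightarrow> bool" for P where
  Nil: "process P s [] 0 s"
| Cons: "exec P (load_update u s) t s' \<Longrightarrow> process P s' us t' s'' \<Longrightarrow>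
         process P s (u # us) (t + t') s''"

inductive_cases process_elims:
  "process P s [] t s'"
  "process P s (u # us) t s'"

text \<open>
  By determinism, processing a sequence passes through the results of processing its prefixes;
  hence a property of the result for every valid sequence is one that holds after every update.
\<close>

lemma process_deterministic: "process P s us t s1 \<Longrightarrow> process P s us t' s2 \<Longrightarrow> t' = t \<and> s2 = s1"
proof (induction arbitrary: t' s2 rule: process.induct)
  case (Cons u s t s' us t1 s'')
  from Cons.prems obtain r r' q where
    "exec P (load_update u s) r q" "process P q us r' s2" "t' = r + r'"
    by (rule process_elims(2))
  moreover from this(1) Cons.hyps(1) have "r = t \<and> q = s'"
    by (intro exec_deterministic)
  ultimately show ?case using Cons.IH by simp
qed (auto elim: process_elims(1))

lemma process_append:
  "process P s (us @ vs) t s'' \<longleftrightarrow>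
     (\<exists>t1 t2 s'. process P s us t1 s' \<and> process P s' vs t2 s'' \<and> t = t1 + t2)"
proof (induction us arbitrary: s t)
  case Nil
  have "process P s [] t1 s' \<longleftrightarrow> t1 = 0 \<and> s' = s" for t1 s'
    by (auto intro: process.Nil elim: process_elims(1))
  then show ?case by simp
next
  case (Cons u us)
  show ?case
  proof
    assume "process P s ((u # us) @ vs) t s''"
    then obtain r r' q where "exec P (load_update u s) r q" "process P q (us @ vs) r' s''"
      "t = r + r'" unfolding append_Cons by (rule process_elims(2))
    with Cons.IH show "\<exists>t1 t2 s'. process P s (u # us) t1 s' \<and> process P s' vs t2 s'' \<and> t = t1 + t2"
      by (metis process.Cons add.assoc)
  next
    assume "\<exists>t1 t2 s'. process P s (u # us) t1 s' \<and> process P s' vs t2 s'' \<and> t = t1 + t2"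
    then obtain t1 t2 s' where *: "process P s (u # us) t1 s'" "process P s' vs t2 s''"
      "t = t1 + t2" by blast
    from *(1) obtain r r' q where "exec P (load_update u s) r q" "process P q us r' s'"
      "t1 = r + r'" by (rule process_elims(2))
    with * Cons.IH show "process P s ((u # us) @ vs) t s''"
      by (metis process.Cons add.assoc append_Cons)
  qed
qed

text \<open>The maintained solution is stored explicitly, indexed by edge names.\<close>

definition solution_of :: "memory \<Rightarrow> nat \<Rightarrow> real" where
  "solution_of s e = real_mem s ''x'' e 0"

end

theory Submission
  imports Defs
begin

text \<open>
  Every node \<open>v\<close> has a level \<open>i v\<close> and every edge \<open>e\<close> a level \<open>k e\<close>, and \<open>e\<close> carries the weight
  \<open>base e / beta ^ k e\<close>, where \<open>base e\<close> is the smallest of the multiplicity and the capacities of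
  its endpoints.  The capacities may be arbitrarily small, so levels are not measured on one global
  scale: a node counts its levels from \<open>min (c v) mu\<close>, and the offset \<open>d e u\<close>, the logarithm to base
  \<open>beta\<close> of \<open>min (c u) mu / base e\<close> rounded down, translates between the scales of \<open>u\<close> and \<open>e\<close>.  The
  level \<open>k e\<close> is the least one with \<open>i u \<le> k e + d e u\<close> for all endpoints \<open>u\<close>.  Hence levels never
  exceed the least \<open>L\<close> with \<open>m \<le> beta ^ L\<close>.

  A node whose load exceeds its capacity moves up one level, which divides the weight of the edges
  that are tight at it by \<open>beta\<close>; a node of positive level whose load is below \<open>c v / lam\<close> moves down.
  When no node wants to move, the solution is \<open>lam\<close>-maximal: an edge of weight below the
  multiplicity is tight at a node of positive level, or its weight is the capacity of an endpoint.

  The moves are paid for by a potential.  An edge pays for moving up by its distance to the top.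
  A node moves down only after its load has fallen from \<open>c v / beta\<close> to \<open>c v / lam\<close>; the missing
  load, in units of the weight of a tight edge, pays for all tight edges at the node.  An edge moving
  up takes load from at most \<open>f - 1\<close> further nodes, and \<open>lam = f + 1 + eps * f\<close> leaves a margin
  proportional to \<open>eps * f\<close> between the two.
\<close>

section \<open>Levels and their potential\<close>

text \<open>The value of \<open>lam\<close> comes from the break-even point of one move down. A node
  leaving its level at load \<open>W = c v / lam\<close>, where \<open>w = unit_at i v\<close>, has
  at most \<open>beta * W / w\<close> tight edges, because rounded offsets leave a tight weight
  uncertain by a factor \<open>beta\<close>. Each edge must regain its level price, essentially
  \<open>(real f - 1) * drop_price\<close>, and the debt released is
  \<open>drop_price * (c v / beta - W) / w\<close>. The two agree for
  \<open>lam = beta + beta * beta * (real f - 1)\<close>. With \<open>beta = 1 + eps / 4\<close> the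
  actual \<open>lam\<close> is larger by at least \<open>7/16 * eps * real f\<close>, so a
  \<open>drop_price\<close> of order \<open>1 / (eps * real f)\<close> turns the surplus into a
  constant per tight edge, which pays for the work. Deletions destroy load without any move, at
  \<open>loss_price\<close> for each endpoint; the division by \<open>beta - 1\<close> in it
  produces the second power of \<open>1 / eps\<close>. Since no preprocessing is free, what remains
  in the potential at rest must be charged to edges: a term \<open>n * L\<close> could not be
  charged to the updates.\<close>

type_synonym graph = "(nat, nat) hypergraph"

locale level_scheme =
  fixes n m f L :: nat and c :: "nat \<Rightarrow> real" and mu eps :: real
  assumes rank_pos: "1 \<le> f" and mu_pos: "0 < mu" and cap_pos: "\<And>v. v < n \<Longrightarrow> 0 < c v"
    and eps: "0 < eps" "eps < 1"
    and edges_le_top: "real m \<le> (1 + eps / 4) ^ L"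
begin

definition beta :: real where "beta = 1 + eps / 4"
definition lam :: real where "lam = real f + 1 + eps * real f"
definition cap :: "nat \<Rightarrow> real" where "cap v = min (c v) mu"
definition base :: "graph \<Rightarrow> nat \<Rightarrow> real" where
  "base G e = Min (insert mu (c ` the (G e)))"
definition xval :: "graph \<Rightarrow> (nat \<Rightarrow> nat) \<Rightarrow> nat \<Rightarrow> real" where
  "xval G k e = base G e / beta ^ k e"
definition load :: "graph \<Rightarrow> (nat \<Rightarrow> nat) \<Rightarrow> nat \<Rightarrow> real" where
  "load G k v = (\<Sum>e\<in>edges_at G v. xval G k e)"
text \<open>The upper bound for the weight of any edge at \<open>v\<close>, reached up to the factor
  \<open>beta\<close> by the tight edges. Debts are measured in this unit.\<close>

definition unit_at :: "(nat \<Rightarrow> nat) \<Rightarrow> nat \<Rightarrow> real" where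
  "unit_at i v = cap v / beta ^ i v"

definition graph_ok :: "graph \<Rightarrow> bool" where
  "graph_ok G \<longleftrightarrow> finite (dom G) \<and> card (dom G) \<le> m \<and>
     (\<forall>e\<in>dom G. the (G e) \<subseteq> {..<n} \<and> card (the (G e)) \<le> f)"

text \<open>The upper estimate is asked for only up to \<open>L\<close>: node levels are at most
  \<open>L\<close>, so an edge with a larger offset at \<open>u\<close> is never tight there. The
  search for an offset may therefore stop at \<open>L + 1\<close>, however far apart the capacities
  are.\<close>

definition offset_ok :: "graph \<Rightarrow> nat \<Rightarrow> nat \<Rightarrow> nat \<Rightarrow> bool" where
  "offset_ok G e u d \<longleftrightarrow> base G e * beta ^ d \<le> cap u \<and>
     (d \<le> L \<longrightarrow> cap u < base G e * beta ^ (d + 1))"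

definition edge_level_ok ::
  "graph \<Rightarrow> (nat \<Rightarrow> nat \<Rightarrow> nat) \<Rightarrow> (nat \<Rightarrow> nat) \<Rightarrow> (nat \<Rightarrow> nat) \<Rightarrow> nat \<Rightarrow> bool" where
  "edge_level_ok G d k i e \<longleftrightarrow> (\<forall>u\<in>the (G e). offset_ok G e u (d e u) \<and> i u \<le> k e + d e u) \<and>
     (0 < k e \<longrightarrow> (\<exists>u\<in>the (G e). i u = k e + d e u))"

definition levels_ok ::
  "graph \<Rightarrow> (nat \<Rightarrow> nat \<Rightarrow> nat) \<Rightarrow> (nat \<Rightarrow> nat) \<Rightarrow> (nat \<Rightarrow> nat) \<Rightarrow> bool" where
  "levels_ok G d k i \<longleftrightarrow> graph_ok G \<and> (\<forall>v<n. i v \<le> L) \<and> (\<forall>e\<in>dom G. edge_level_ok G d k i e)"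

definition tight ::
  "graph \<Rightarrow> (nat \<Rightarrow> nat \<Rightarrow> nat) \<Rightarrow> (nat \<Rightarrow> nat) \<Rightarrow> (nat \<Rightarrow> nat) \<Rightarrow> nat \<Rightarrow> nat set" where
  "tight G d k i v = {e \<in> edges_at G v. k e + d e v = i v}"

text \<open>The debt that an edge moving up may create at each of its other endpoints. That 16 is
  large enough is checked in \<open>price_balance\<close>.\<close>

definition drop_price :: real where "drop_price = 16 / (eps * real f)"
text \<open>The debt for one \<open>unit_at\<close> of lost load. A move up costs an edge the
  fraction \<open>1 - 1 / beta\<close> of its weight, which at this rate amounts to
  \<open>drop_price\<close>.\<close>

definition loss_price :: real where "loss_price = drop_price * beta / (beta - 1)"
text \<open>The debts at the up to \<open>f - 1\<close> other endpoints, and 1 for the work on the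
  edge itself.\<close>

definition level_price :: real where "level_price = 1 + (real f - 1) * drop_price"

text \<open>The shortfall is measured against \<open>c v / beta\<close>, the load that an overloaded
  node is sure to keep when it moves up, so it arrives at its new level free of debt. A node at
  level 0 has no move down to save for.\<close>

definition debt :: "graph \<Rightarrow> (nat \<Rightarrow> nat) \<Rightarrow> (nat \<Rightarrow> nat) \<Rightarrow> nat \<Rightarrow> real" where
  "debt G k i v =
     (if i v = 0 then 0 else loss_price * max 0 (c v / beta - load G k v) / unit_at i v)"

abbreviation room :: "graph \<Rightarrow> (nat \<Rightarrow> nat) \<Rightarrow> real" where
  "room G k \<equiv> (\<Sum>e\<in>dom G. level_price * (real L - real (k e)))"
abbreviation total_debt :: "graph \<Rightarrow> (nat \<Rightarrow> nat) \<Rightarrow> (nat \<Rightarrow> nat) \<Rightarrow> real" where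
  "total_debt G k i \<equiv> (\<Sum>v<n. debt G k i v)"

text \<open>The subtracted sum pays for moving up a node at which no edge is tight.\<close>

definition potential :: "graph \<Rightarrow> (nat \<Rightarrow> nat) \<Rightarrow> (nat \<Rightarrow> nat) \<Rightarrow> real" where
  "potential G k i = 4 * real f * (room G k + total_debt G k i) - (\<Sum>v<n. real (i v))"

section \<open>Bounds on weights, loads and debts\<close>

lemma beta_gt1: "1 < beta" and beta_pos: "0 < beta" and beta_le: "beta \<le> 5/4"
  using eps by (auto simp: beta_def)

lemma beta_power_pos: "0 < beta ^ j"
  using beta_pos by simp

lemma drop_price_pos: "0 < drop_price"
  using eps rank_pos by (simp add: drop_price_def)

lemma loss_price_pos: "0 < loss_price"
  using drop_price_pos beta_gt1 by (simp add: loss_price_def)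

lemma loss_price_drop: "loss_price * (1 - 1 / beta) = drop_price"
  using beta_gt1 by (simp add: loss_price_def field_simps)

lemma level_price_pos: "1 \<le> level_price"
  using drop_price_pos rank_pos by (simp add: level_price_def)

lemma cap_gt0: "v < n \<Longrightarrow> 0 < cap v"
  using mu_pos cap_pos by (simp add: cap_def)

lemma unit_pos: "v < n \<Longrightarrow> 0 < unit_at i v"
  using cap_gt0 beta_pos by (simp add: unit_at_def)

lemma unit_le_capacity: "v < n \<Longrightarrow> unit_at i v \<le> c v"
proof -
  assume v: "v < n"
  have "cap v / beta ^ i v \<le> cap v / 1"
    using cap_gt0[OF v] beta_gt1 by (intro divide_left_mono) auto
  then show ?thesis by (simp add: unit_at_def cap_def)
qed

lemma graph_okD:
  assumes "graph_ok G" "e \<in> dom G"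
  shows "finite (the (G e))" "the (G e) \<subseteq> {..<n}" "card (the (G e)) \<le> f"
  using assms finite_subset[of "the (G e)" "{..<n}"] by (auto simp: graph_ok_def)

lemma edges_at_subset: "edges_at G v \<subseteq> dom G"
  by (auto simp: edges_at_def)

lemma finite_edges_at: "graph_ok G \<Longrightarrow> finite (edges_at G v)"
  using finite_subset[OF edges_at_subset] by (auto simp: graph_ok_def)

lemma base_pos: "graph_ok G \<Longrightarrow> e \<in> dom G \<Longrightarrow> 0 < base G e"
  using graph_okD[of G e] mu_pos cap_pos by (auto simp: base_def)

lemma base_le_mu: "graph_ok G \<Longrightarrow> e \<in> dom G \<Longrightarrow> base G e \<le> mu"
  using graph_okD[of G e] by (auto simp: base_def)

lemma base_cases:
  assumes "graph_ok G" "e \<in> dom G"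
  shows "base G e = mu \<or> (\<exists>u\<in>the (G e). base G e = c u)"
proof -
  have "base G e \<in> insert mu (c ` the (G e))"
    unfolding base_def using graph_okD[OF assms] by (intro Min_in) auto
  then show ?thesis by auto
qed

lemma xval_pos: "graph_ok G \<Longrightarrow> e \<in> dom G \<Longrightarrow> 0 < xval G k e"
  using base_pos beta_pos by (simp add: xval_def)

lemma xval_le_mu: "graph_ok G \<Longrightarrow> e \<in> dom G \<Longrightarrow> xval G k e \<le> mu"
proof -
  assume *: "graph_ok G" "e \<in> dom G"
  have "base G e / beta ^ k e \<le> base G e / 1"
    using base_pos[OF *] beta_gt1 by (intro divide_left_mono) auto
  then show ?thesis using base_le_mu[OF *] by (simp add: xval_def)
qed

lemma xval_le_unit:
  assumes "levels_ok G d k i" "e \<in> dom G" "u \<in> the (G e)"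
  shows "xval G k e \<le> unit_at i u"
proof -
  have G: "graph_ok G" and "edge_level_ok G d k i e"
    using assms by (auto simp: levels_ok_def)
  then have off: "base G e * beta ^ d e u \<le> cap u" and "i u \<le> k e + d e u"
    using assms by (auto simp: edge_level_ok_def offset_ok_def)
  have "base G e * beta ^ i u \<le> base G e * beta ^ (k e + d e u)"
    using base_pos[OF G assms(2)] beta_gt1 \<open>i u \<le> k e + d e u\<close>
    by (intro mult_left_mono power_increasing) auto
  also have "\<dots> = base G e * beta ^ d e u * beta ^ k e" by (simp add: power_add)
  also have "\<dots> \<le> cap u * beta ^ k e"
    using off beta_power_pos[of "k e"] by (intro mult_right_mono) auto
  finally show ?thesis
    using beta_pos by (simp add: xval_def unit_at_def field_simps)
qed

text \<open>Tightness gives \<open>d e v \<le> i v \<le> L\<close>, the range in which the offset is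
  the exact rounded logarithm; the factor \<open>beta\<close> is its rounding error.\<close>

lemma unit_less_tight:
  assumes "levels_ok G d k i" "v < n" "e \<in> tight G d k i v"
  shows "unit_at i v / beta < xval G k e"
proof -
  have G: "graph_ok G" and e: "e \<in> dom G" "v \<in> the (G e)" and key: "k e + d e v = i v"
    using assms by (auto simp: levels_ok_def tight_def edges_at_def)
  have "i v \<le> L" using assms by (auto simp: levels_ok_def)
  then have "d e v \<le> L" using key by simp
  then have "cap v < base G e * beta ^ (d e v + 1)"
    using assms(1) e by (auto simp: levels_ok_def edge_level_ok_def offset_ok_def)
  then have "cap v * beta ^ k e < base G e * beta ^ (d e v + 1) * beta ^ k e"
    using beta_pos by simp
  also have "\<dots> = base G e * (beta ^ i v * beta)"
    by (simp add: key[symmetric] power_add mult_ac)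
  finally show ?thesis
    using beta_pos by (simp add: xval_def unit_at_def field_simps)
qed

text \<open>At level \<open>L\<close> each of the at most \<open>m \<le> beta ^ L\<close> edges
  weighs at most \<open>cap v / beta ^ L\<close>, so the capacity cannot be exceeded. This is what
  keeps all levels at most \<open>L\<close>.\<close>

lemma overloaded_below_top:
  assumes ok: "levels_ok G d k i" and v: "v < n" and over: "c v < load G k v"
  shows "i v < L"
proof (rule ccontr)
  assume "\<not> i v < L"
  then have iv: "i v = L" using ok v by (auto simp: levels_ok_def intro: antisym)
  have G: "graph_ok G" using ok by (simp add: levels_ok_def)
  have "load G k v \<le> (\<Sum>e\<in>edges_at G v. unit_at i v)"
    unfolding load_def using xval_le_unit[OF ok] by (intro sum_mono) (auto simp: edges_at_def)
  also have "\<dots> = real (card (edges_at G v)) * unit_at i v" by simp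
  also have "\<dots> \<le> real m * unit_at i v"
  proof (intro mult_right_mono)
    have "card (edges_at G v) \<le> card (dom G)"
      using G edges_at_subset[of G v] by (intro card_mono) (auto simp: graph_ok_def)
    then show "real (card (edges_at G v)) \<le> real m" using G by (simp add: graph_ok_def)
  qed (use unit_pos[OF v] in \<open>simp add: less_imp_le\<close>)
  also have "\<dots> \<le> beta ^ L * unit_at i v"
    using edges_le_top unit_pos[OF v, of i] by (intro mult_right_mono) (auto simp: beta_def)
  also have "\<dots> = cap v" using beta_pos by (simp add: unit_at_def iv)
  also have "\<dots> \<le> c v" by (simp add: cap_def)
  finally show False using over by simp
qed

lemma edge_level_le_top:
  assumes "levels_ok G d k i" "e \<in> dom G"
  shows "k e \<le> L"
proof (cases "k e = 0")
  case False
  then obtain u where u: "u \<in> the (G e)" "i u = k e + d e u"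
    using assms unfolding levels_ok_def edge_level_ok_def by (metis gr0I)
  then have "u < n" using graph_okD[of G e] assms by (auto simp: levels_ok_def)
  then have "i u \<le> L" using assms by (simp add: levels_ok_def)
  then show ?thesis using u by simp
qed simp

lemma debt_nonneg: "v < n \<Longrightarrow> 0 \<le> debt G k i v"
  using loss_price_pos unit_pos[of v i] by (simp add: debt_def)

text \<open>Serves both causes of lost load at a node that keeps its level: a neighbour moving up
  and the deletion of an edge.\<close>

lemma debt_Lipschitz:
  assumes v: "v < n" and less: "load G k v - y \<le> load G' k' v" and y: "0 \<le> y" and same: "i' v = i v"
  shows "debt G' k' i' v \<le> debt G k i v + loss_price * y / unit_at i v"
proof -
  have "max 0 (c v / beta - load G' k' v) \<le> max 0 (c v / beta - load G k v) + y"
    using less y by auto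
  then have "loss_price * max 0 (c v / beta - load G' k' v) / unit_at i v \<le>
      loss_price * (max 0 (c v / beta - load G k v) + y) / unit_at i v"
    using loss_price_pos unit_pos[OF v, of i] by (intro divide_right_mono mult_left_mono) auto
  moreover have "unit_at i' v = unit_at i v" using same by (simp add: unit_at_def)
  moreover have "0 \<le> loss_price * y / unit_at i v"
    using loss_price_pos unit_pos[OF v, of i] y by simp
  ultimately show ?thesis
    using same by (auto simp: debt_def distrib_left add_divide_distrib)
qed

lemma debt_antimono:
  assumes "v < n" "load G k v \<le> load G' k' v" "i' v = i v"
  shows "debt G' k' i' v \<le> debt G k i v"
  using debt_Lipschitz[of v G k 0 G' k' i' i] assms by simp

text \<open>Double counting: every edge of \<open>T\<close> contains \<open>v\<close>, which leaves
  it at most \<open>f - 1\<close> other endpoints.\<close>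

lemma sum_card_incident:
  assumes G: "graph_ok G" and T: "T \<subseteq> edges_at G v" and v: "v < n"
  shows "(\<Sum>u\<in>{..<n} - {v}. real (card (T \<inter> edges_at G u))) \<le> (real f - 1) * real (card T)"
proof -
  have fin: "finite T" using T finite_edges_at[OF G] finite_subset by auto
  have TG: "T \<subseteq> dom G" using T by (auto simp: edges_at_def)
  have "(\<Sum>u\<in>{..<n} - {v}. real (card (T \<inter> edges_at G u))) =
      (\<Sum>u\<in>{..<n} - {v}. \<Sum>e\<in>T. if u \<in> the (G e) then 1 else 0)"
  proof (intro sum.cong refl)
    fix u
    have "T \<inter> edges_at G u = {e \<in> T. u \<in> the (G e)}"
      using TG by (auto simp: edges_at_def)
    then show "real (card (T \<inter> edges_at G u)) = (\<Sum>e\<in>T. if u \<in> the (G e) then 1 else 0)"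
      using fin by (simp add: sum.If_cases Int_def)
  qed
  also have "\<dots> = (\<Sum>e\<in>T. \<Sum>u\<in>{..<n} - {v}. if u \<in> the (G e) then 1 else 0)"
    by (rule sum.swap)
  also have "\<dots> \<le> (\<Sum>e\<in>T. real f - 1)"
  proof (intro sum_mono)
    fix e assume e: "e \<in> T"
    then have ve: "v \<in> the (G e)" and eG: "e \<in> dom G" using T by (auto simp: edges_at_def)
    note [simp] = graph_okD(1)[OF G eG]
    have eq: "({..<n} - {v}) \<inter> {u. u \<in> the (G e)} = the (G e) - {v}"
      using graph_okD(2)[OF G eG] by auto
    have "(\<Sum>u\<in>{..<n} - {v}. if u \<in> the (G e) then 1 else 0) = real (card (the (G e) - {v}))"
      by (subst sum.If_cases) (simp_all only: eq finite_Diff finite_lessThan, simp)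
    also have "\<dots> = real (card (the (G e))) - 1"
    proof -
      have "0 < card (the (G e))" using ve by (auto simp: card_gt_0_iff)
      then show ?thesis using ve by (simp add: card_Diff_singleton of_nat_diff Suc_le_eq)
    qed
    finally show "(\<Sum>u\<in>{..<n} - {v}. if u \<in> the (G e) then 1 else 0) \<le> real f - 1"
      using graph_okD(3)[OF G eG] by simp
  qed
  finally show ?thesis by (simp add: mult.commute)
qed

section \<open>Moving a node up or down by one level\<close>

lemma tight_subset: "tight G d k i v \<subseteq> edges_at G v"
  by (auto simp: tight_def)

text \<open>A tight edge follows \<open>v\<close>, which becomes the node attaining its level. For
  any other edge at \<open>v\<close> the inequality \<open>i v < k e + d e v\<close> is strict and
  leaves room for the increment, and its level, if positive, is attained at another
  endpoint.\<close>

lemma levels_ok_raise: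
  assumes ok: "levels_ok G d k i" and v: "v < n" and below: "i v < L"
    and k': "\<And>e. e \<in> dom G \<Longrightarrow> k' e = (if e \<in> tight G d k i v then k e + 1 else k e)"
  shows "levels_ok G d k' (i(v := i v + 1))"
proof -
  have "edge_level_ok G d k' (i(v := i v + 1)) e" if e: "e \<in> dom G" for e
  proof -
    have ek: "edge_level_ok G d k i e" using ok e by (simp add: levels_ok_def)
    show ?thesis
    proof (cases "e \<in> tight G d k i v")
      case True
      then have "k e + d e v = i v" "v \<in> the (G e)" by (auto simp: tight_def edges_at_def)
      then show ?thesis using ek True k'[OF e] by (auto simp: edge_level_ok_def intro!: le_SucI)
    next
      case False
      then have nt: "k e + d e v \<noteq> i v" if "v \<in> the (G e)"
        using e that by (auto simp: tight_def edges_at_def)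
      have "(i(v := i v + 1)) u \<le> k e + d e u" if u: "u \<in> the (G e)" for u
      proof -
        have "i u \<le> k e + d e u" using ek u by (simp add: edge_level_ok_def)
        then show ?thesis using nt u by (cases "u = v") auto
      qed
      moreover have "\<exists>u\<in>the (G e). (i(v := i v + 1)) u = k e + d e u" if "0 < k e"
      proof -
        obtain u where "u \<in> the (G e)" "i u = k e + d e u" using ek \<open>0 < k e\<close> by (auto simp: edge_level_ok_def)
        then show ?thesis using nt by (intro bexI[of _ u]) auto
      qed
      ultimately show ?thesis using ek False k'[OF e] by (simp add: edge_level_ok_def)
    qed
  qed
  then show ?thesis using ok below by (auto simp: levels_ok_def)
qed

text \<open>The level price of the tight edges covers the debts created at their other endpoints and
  leaves 1 per edge, which the factor \<open>4 * real f\<close> multiplies. The additional 1 comes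
  from the subtracted sum of levels.\<close>

lemma potential_raise:
  assumes ok: "levels_ok G d k i" and v: "v < n" and over: "c v < load G k v"
    and k': "\<And>e. e \<in> dom G \<Longrightarrow> k' e = (if e \<in> tight G d k i v then k e + 1 else k e)"
  defines "i' \<equiv> i(v := i v + 1)"
  shows "potential G k' i' + 1 + 4 * real f * real (card (tight G d k i v)) \<le> potential G k i"
proof -
  let ?T = "tight G d k i v"
  have G: "graph_ok G" using ok by (simp add: levels_ok_def)
  have finG: "finite (dom G)" using G by (simp add: graph_ok_def)
  have TG: "?T \<subseteq> dom G" by (auto simp: tight_def edges_at_def)
  have finT: "finite ?T" using TG finG finite_subset by blast
  have x': "xval G k' e = (if e \<in> ?T then xval G k e / beta else xval G k e)" if "e \<in> dom G" for e
    using k'[OF that] by (simp add: xval_def)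
  have edges: "room G k' =
      room G k - level_price * real (card ?T)"
  proof -
    have "room G k' =
      (\<Sum>e\<in>dom G. level_price * (real L - real (k e)) - (if e \<in> ?T then level_price else 0))"
      using k' by (intro sum.cong) (auto simp: algebra_simps)
    also have "\<dots> = room G k - level_price * real (card ?T)"
      using finG TG by (simp add: sum_subtractf sum.If_cases Int_absorb1)
    finally show ?thesis .
  qed
  have other: "debt G k' i' u \<le> debt G k i u + drop_price * real (card (?T \<inter> edges_at G u))"
    if u: "u \<in> {..<n} - {v}" for u
  proof -
    have un: "u < n" using u by simp
    note up = unit_pos[OF un, of i]
    define y where "y = (\<Sum>e\<in>?T \<inter> edges_at G u. xval G k e * (1 - 1 / beta))"
    have "load G k' u = (\<Sum>e\<in>edges_at G u. xval G k e - (if e \<in> ?T then xval G k e * (1 - 1 / beta) else 0))"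
      unfolding load_def using x'[OF subsetD[OF edges_at_subset]]
      by (intro sum.cong refl) (auto simp: algebra_simps)
    also have "\<dots> = load G k u - y"
      unfolding y_def load_def sum_subtractf Int_commute[of ?T]
      by (simp only: sum.inter_restrict[OF finite_edges_at[OF G]])
    finally have ld: "load G k' u = load G k u - y" .
    \<comment> \<open>In units of \<open>u\<close>, each edge loses at most
      \<open>1 - 1 / beta\<close>, whatever the scale of \<open>v\<close>; this bound makes the
      debts of nodes with different capacities comparable.\<close>
    have "y \<le> (\<Sum>e\<in>?T \<inter> edges_at G u. unit_at i u * (1 - 1 / beta))"
      unfolding y_def using xval_le_unit[OF ok] beta_gt1
      by (intro sum_mono mult_right_mono) (auto simp: edges_at_def)
    then have yu: "y \<le> real (card (?T \<inter> edges_at G u)) * (unit_at i u * (1 - 1 / beta))" by simp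
    have y0: "0 \<le> y" unfolding y_def
      using xval_pos[OF G, THEN less_imp_le] beta_gt1 by (intro sum_nonneg mult_nonneg_nonneg) (auto simp: edges_at_def)
    have "debt G k' i' u \<le> debt G k i u + loss_price * y / unit_at i u"
      using un u y0 ld by (intro debt_Lipschitz) (auto simp: i'_def)
    also have "loss_price * y / unit_at i u \<le>
        loss_price * (real (card (?T \<inter> edges_at G u)) * (unit_at i u * (1 - 1 / beta))) / unit_at i u"
      using yu up loss_price_pos by (intro divide_right_mono mult_left_mono) auto
    also have "\<dots> = real (card (?T \<inter> edges_at G u)) * drop_price"
      using up by (simp add: loss_price_drop[symmetric])
    finally show ?thesis by (simp add: mult.commute)
  qed
  \<comment> \<open>Every weight at \<open>v\<close> is divided by at most \<open>beta\<close>, and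
    the load was above \<open>c v\<close>.\<close>
  have self: "debt G k' i' v = 0"
  proof -
    have "c v / beta \<le> load G k v / beta" using over beta_pos by (simp add: divide_right_mono)
    also have "\<dots> \<le> load G k' v"
      unfolding load_def sum_divide_distrib
    proof (intro sum_mono)
      fix e assume "e \<in> edges_at G v"
      then have e: "e \<in> dom G" by (auto simp: edges_at_def)
      have "xval G k e / beta \<le> xval G k e"
        using xval_pos[OF G e, of k] beta_gt1 by (simp add: field_simps)
      then show "xval G k e / beta \<le> xval G k' e" using x'[OF e] by simp
    qed
    finally show ?thesis by (simp add: debt_def)
  qed
  have split: "(\<Sum>u<n. g u) = g v + (\<Sum>u\<in>{..<n} - {v}. g u)" for g :: "nat \<Rightarrow> real"
    using v by (intro sum.remove) auto
  have "(\<Sum>u\<in>{..<n} - {v}. debt G k' i' u) \<le>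
      (\<Sum>u\<in>{..<n} - {v}. debt G k i u + drop_price * real (card (?T \<inter> edges_at G u)))"
    by (intro sum_mono other)
  also have "\<dots> = (\<Sum>u\<in>{..<n} - {v}. debt G k i u) +
      drop_price * (\<Sum>u\<in>{..<n} - {v}. real (card (?T \<inter> edges_at G u)))"
    by (simp add: sum.distrib sum_distrib_left)
  also have "\<dots> \<le> (\<Sum>u\<in>{..<n} - {v}. debt G k i u) + drop_price * ((real f - 1) * real (card ?T))"
    using sum_card_incident[OF G tight_subset v] drop_price_pos by simp
  finally have "total_debt G k' i' \<le>
      total_debt G k i + drop_price * ((real f - 1) * real (card ?T))"
    using self debt_nonneg[OF v, of G k i] unfolding split by linarith
  then have "room G k' + total_debt G k' i' + real (card ?T) \<le>
      room G k + total_debt G k i"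
    unfolding edges by (simp add: level_price_def algebra_simps)
  then have "4 * real f * (room G k' + total_debt G k' i' + real (card ?T)) \<le>
      4 * real f * (room G k + total_debt G k i)"
    by (intro mult_left_mono) auto
  moreover have "(\<Sum>u<n. real (i' u)) = (\<Sum>u<n. real (i u)) + 1"
    unfolding split by (simp add: i'_def)
  ultimately show ?thesis unfolding potential_def by (simp add: algebra_simps)
qed

text \<open>An edge follows \<open>v\<close> down only if \<open>v\<close> alone attains its level
  and that level is positive. Otherwise another endpoint still attains it, or the edge has level 0
  and needs no such endpoint.\<close>

lemma levels_ok_lower:
  assumes ok: "levels_ok G d k i" and v: "v < n" and pos: "0 < i v"
    and k': "\<And>e. e \<in> dom G \<Longrightarrow> k' e =
      (if e \<in> tight G d k i v \<and> 0 < k e \<and> (\<forall>u\<in>the (G e). u \<noteq> v \<longrightarrow> i u < k e + d e u)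
       then k e - 1 else k e)"
  shows "levels_ok G d k' (i(v := i v - 1))"
proof -
  have "edge_level_ok G d k' (i(v := i v - 1)) e" if e: "e \<in> dom G" for e
  proof -
    have ek: "edge_level_ok G d k i e" using ok e by (simp add: levels_ok_def)
    show ?thesis
    proof (cases "e \<in> tight G d k i v \<and> 0 < k e \<and> (\<forall>u\<in>the (G e). u \<noteq> v \<longrightarrow> i u < k e + d e u)")
      case True
      then have t: "i v = k e + d e v" "v \<in> the (G e)" "0 < k e" by (auto simp: tight_def edges_at_def)
      have ke: "k' e = k e - 1" using True k'[OF e] by auto
      have "(i(v := i v - 1)) u \<le> k' e + d e u" if "u \<in> the (G e)" for u
        using True t that ke by (cases "u = v") fastforce+
      moreover have "(i(v := i v - 1)) v = k' e + d e v" using t ke by simp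
      ultimately show ?thesis using ek t(2) unfolding edge_level_ok_def by blast
    next
      case False
      then have ke: "k' e = k e" using k'[OF e] by auto
      have "(i(v := i v - 1)) u \<le> k' e + d e u" if "u \<in> the (G e)" for u
        using ek that ke by (cases "u = v") (auto simp: edge_level_ok_def intro: le_trans[OF diff_le_self])
      moreover have "\<exists>u\<in>the (G e). (i(v := i v - 1)) u = k' e + d e u" if k0: "0 < k' e"
      proof (cases "e \<in> tight G d k i v")
        case True
        then obtain u where "u \<in> the (G e)" "u \<noteq> v" "\<not> i u < k e + d e u" using False k0 ke by auto
        then show ?thesis using ek ke by (intro bexI[of _ u]) (auto simp: edge_level_ok_def le_antisym)
      next
        case nt: False
        obtain u where u: "u \<in> the (G e)" "i u = k e + d e u" using ek k0 ke by (auto simp: edge_level_ok_def)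
        then have "u \<noteq> v" using nt e by (auto simp: tight_def edges_at_def)
        then show ?thesis using u ke by auto
      qed
      ultimately show ?thesis using ek by (auto simp: edge_level_ok_def)
    qed
  qed
  then show ?thesis using ok by (auto simp: levels_ok_def intro: le_trans[OF diff_le_self])
qed

text \<open>The balance of a move down at the extreme load \<open>W = c v / lam\<close>, divided by
  \<open>W / unit_at i v\<close>. There are at most \<open>beta\<close> tight edges per unit of
  load; each needs \<open>1 + level_price\<close>, that is 2 plus
  \<open>drop_price * (real f - 1)\<close>. The term \<open>lam / (2 * real f)\<close> is the fixed
  cost of the move.\<close>

lemma price_balance:
  "2 * beta + lam / (2 * real f) \<le> drop_price * (lam / beta - 1 - beta * (real f - 1))"
proof -
  have f1: "1 \<le> real f" using rank_pos by simp
  have e2: "eps * eps \<le> eps" using eps by (simp add: mult_left_le)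
  have "eps * eps * real f \<le> eps * real f" using e2 f1 by (intro mult_right_mono) auto
  \<comment> \<open>The surplus of \<open>lam\<close> over break-even:
    \<open>eps * real f / 2\<close>, less at most \<open>eps * real f / 16\<close> for the square of
    \<open>beta\<close>.\<close>
  then have "7/16 * (eps * real f) \<le> lam - beta - beta * beta * (real f - 1)"
  proof -
    have "lam - beta - beta * beta * (real f - 1) =
        1 + eps / 4 + (eps * eps) / 16 + (eps * real f) / 2 - (eps * eps * real f) / 16"
      by (simp add: lam_def beta_def field_simps)
    then show ?thesis using \<open>eps * eps * real f \<le> eps * real f\<close> eps zero_le_square[of eps] by linarith
  qed
  moreover have "7/20 * (eps * real f) * beta \<le> 7/16 * (eps * real f)"
    using beta_le mult_left_mono[OF beta_le, of "eps * real f"] eps f1 by simp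
  ultimately have "7/20 * (eps * real f) * beta \<le> lam - beta - beta * beta * (real f - 1)" by linarith
  then have "7/20 * (eps * real f) \<le> (lam - beta - beta * beta * (real f - 1)) / beta"
    using beta_pos by (simp add: field_simps)
  also have "\<dots> = lam / beta - 1 - beta * (real f - 1)"
    using beta_pos by (simp add: field_simps)
  finally have "drop_price * (7/20 * (eps * real f)) \<le> drop_price * (lam / beta - 1 - beta * (real f - 1))"
    using drop_price_pos by (intro mult_left_mono) auto
  \<comment> \<open>The left-hand side is at most \<open>5/2 + 3/2 = 4\<close>, which is below
    \<open>28/5\<close>.\<close>
  moreover have "drop_price * (7/20 * (eps * real f)) = 28/5"
    using eps f1 by (simp add: drop_price_def)
  moreover have "lam / (2 * real f) \<le> 3/2"
  proof -
    have "eps * real f \<le> real f" using eps f1 by (simp add: mult_left_le_one_le)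
    then have "lam \<le> 3/2 * (2 * real f)" using f1 unfolding lam_def by linarith
    then show ?thesis using f1 by (simp add: field_simps)
  qed
  ultimately show ?thesis using beta_le by linarith
qed

lemma lam_gt: "beta < lam" "0 < lam"
proof -
  have "0 \<le> eps * real f" "1 \<le> real f" using eps rank_pos by auto
  then show "beta < lam" "0 < lam" using eps unfolding beta_def lam_def by linarith+
qed

text \<open>Only the debt of \<open>v\<close> pays. No weight falls, so no other debt grows. At the
  lower level the unit of \<open>v\<close> is \<open>beta\<close> times larger, so the same
  shortfall keeps only the part \<open>1 / beta\<close> of its debt; the rest is
  \<open>drop_price\<close> per old unit of shortfall.\<close>

lemma potential_lower:
  assumes ok: "levels_ok G d k i" and v: "v < n" and pos: "0 < i v" and under: "lam * load G k v < c v"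
    and k': "\<And>e. e \<in> dom G \<Longrightarrow> k' e =
      (if e \<in> tight G d k i v \<and> 0 < k e \<and> (\<forall>u\<in>the (G e). u \<noteq> v \<longrightarrow> i u < k e + d e u)
       then k e - 1 else k e)"
  defines "i' \<equiv> i(v := i v - 1)"
  shows "potential G k' i' + 1 + 4 * real f * real (card (tight G d k i v)) \<le> potential G k i"
proof -
  let ?T = "tight G d k i v"
  let ?W = "load G k v" and ?w = "unit_at i v"
  have f1: "1 \<le> real f" using rank_pos by simp
  have G: "graph_ok G" using ok by (simp add: levels_ok_def)
  have finG: "finite (dom G)" using G by (simp add: graph_ok_def)
  have TG: "?T \<subseteq> dom G" by (auto simp: tight_def edges_at_def)
  have finT: "finite ?T" using TG finG finite_subset by blast
  have kk: "k' e = k e \<or> e \<in> ?T \<and> k e = k' e + 1" if "e \<in> dom G" for e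
    using k'[OF that] by auto
  have edges: "room G k' \<le>
      room G k + level_price * real (card ?T)"
  proof -
    have "room G k' \<le>
      (\<Sum>e\<in>dom G. level_price * (real L - real (k e)) + (if e \<in> ?T then level_price else 0))"
      using level_price_pos by (intro sum_mono) (use kk in \<open>force simp: algebra_simps\<close>)
    also have "\<dots> = room G k + level_price * real (card ?T)"
      using finG TG by (simp add: sum.distrib sum.If_cases Int_absorb1)
    finally show ?thesis .
  qed
  have x': "xval G k e \<le> xval G k' e" if e: "e \<in> dom G" for e
    using kk[OF e] base_pos[OF G e] beta_gt1 by (auto simp: xval_def field_simps)
  have ld: "load G k u \<le> load G k' u" for u
    unfolding load_def using edges_at_subset[of G u] by (intro sum_mono x') auto
  have other: "debt G k' i' u \<le> debt G k i u" if "u \<in> {..<n} - {v}" for u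
    using that ld by (intro debt_antimono) (auto simp: i'_def)
  note w0 = unit_pos[OF v, of i]
  have W0: "0 \<le> ?W"
    unfolding load_def using xval_pos[OF G, THEN less_imp_le] by (intro sum_nonneg) (auto simp: edges_at_def)
  have c0: "0 < c v" using cap_pos v by simp
  \<comment> \<open>Tight edges are heavy, so a small load allows only few of them.\<close>
  have few: "real (card ?T) * ?w \<le> beta * ?W"
  proof -
    have "real (card ?T) * (?w / beta) = (\<Sum>e\<in>?T. ?w / beta)" by simp
    also have "\<dots> \<le> (\<Sum>e\<in>?T. xval G k e)"
      using unit_less_tight[OF ok v] by (intro sum_mono) (simp add: less_imp_le)
    also have "\<dots> \<le> ?W"
      unfolding load_def using finite_edges_at[OF G] xval_pos[OF G, THEN less_imp_le] tight_subset
      by (intro sum_mono2) (auto simp: edges_at_def)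
    finally show ?thesis using beta_pos by (simp add: field_simps)
  qed
  have Wc: "?W < c v / lam" using under lam_gt(2) by (simp add: field_simps)
  also have "\<dots> \<le> c v / beta" using lam_gt c0 beta_pos by (intro divide_left_mono) auto
  finally have K: "?W < c v / beta" .
  \<comment> \<open>The shortfall does not grow, and it is now divided by the larger unit. At level
    0 the debt is 0, which satisfies the same bound.\<close>
  have "debt G k' i' v \<le> loss_price * (c v / beta - ?W) / (?w * beta)"
  proof (cases "i' v = 0")
    case True
    then show ?thesis using K loss_price_pos w0 beta_pos by (simp add: debt_def)
  next
    case False
    have "unit_at i' v = ?w * beta"
      using pos beta_pos by (cases "i v") (auto simp: unit_at_def i'_def)
    moreover have "max 0 (c v / beta - load G k' v) \<le> c v / beta - ?W" using K ld[of v] by auto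
    ultimately show ?thesis using False loss_price_pos w0 beta_pos
      by (simp add: debt_def divide_right_mono)
  qed
  moreover have "debt G k i v = loss_price * (c v / beta - ?W) / ?w"
    using K pos by (simp add: debt_def)
  moreover have "loss_price * (c v / beta - ?W) / ?w - loss_price * (c v / beta - ?W) / (?w * beta) =
      (loss_price * (1 - 1 / beta)) * (c v / beta - ?W) / ?w"
    using w0 beta_pos by (simp add: field_simps)
  ultimately have release: "debt G k' i' v + drop_price * (c v / beta - ?W) / ?w \<le> debt G k i v"
    unfolding loss_price_drop by linarith
  have "real (card ?T) * (1 + level_price) + 1 / (2 * real f) \<le> drop_price * (c v / beta - ?W) / ?w"
  proof -
    define g where "g = drop_price"
    have g0: "0 < g" using drop_price_pos by (simp add: g_def)
    let ?q = "g + beta * (1 + level_price)"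
    have q0: "0 \<le> ?q" using g0 beta_pos level_price_pos by simp
    \<comment> \<open>\<open>?q\<close> gathers everything proportional to the load: the part by
      which \<open>?W\<close> reduces the shortfall, and the price of at most
      \<open>beta * ?W / ?w\<close> edges. The worst case is thus \<open>?W = c v / lam\<close>, the
      situation of \<open>price_balance\<close>.\<close>
    have "lam * (g / beta) - ?q - lam / (2 * real f) \<ge> 0"
      using price_balance by (simp add: g_def level_price_def algebra_simps)
    then have "0 \<le> (c v / lam) * (lam * (g / beta) - ?q - lam / (2 * real f))"
      using c0 lam_gt by simp
    also have "\<dots> = g * (c v / beta) - (c v / lam) * ?q - c v * (1 / (2 * real f))"
      using lam_gt by (simp add: algebra_simps)
    finally have 1: "(c v / lam) * ?q + c v * (1 / (2 * real f)) \<le> g * (c v / beta)" by simp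
    have 2: "?W * ?q \<le> (c v / lam) * ?q" using Wc q0 by (intro mult_right_mono) auto
    have 3: "?w * (1 / (2 * real f)) \<le> c v * (1 / (2 * real f))"
      using unit_le_capacity[OF v] by (intro mult_right_mono) auto
    have "real (card ?T) * ?w * (1 + level_price) \<le> beta * ?W * (1 + level_price)"
      using few level_price_pos by (intro mult_right_mono) auto
    then have "(real (card ?T) * (1 + level_price) + 1 / (2 * real f)) * ?w \<le> g * (c v / beta - ?W)"
      using 1 2 3 by (simp add: algebra_simps)
    then show ?thesis using w0 by (simp add: g_def pos_le_divide_eq)
  qed
  with release have self: "debt G k' i' v + real (card ?T) * (1 + level_price) + 1 / (2 * real f) \<le> debt G k i v"
    by linarith
  have split: "(\<Sum>u<n. g u) = g v + (\<Sum>u\<in>{..<n} - {v}. g u)" for g :: "nat \<Rightarrow> real"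
    using v by (intro sum.remove) auto
  have "(\<Sum>u\<in>{..<n} - {v}. debt G k' i' u) \<le> (\<Sum>u\<in>{..<n} - {v}. debt G k i u)"
    by (intro sum_mono other)
  then have "total_debt G k' i' + real (card ?T) * (1 + level_price) + 1 / (2 * real f) \<le> total_debt G k i"
    using self unfolding split by linarith
  then have "room G k' + total_debt G k' i' + real (card ?T) + 1 / (2 * real f) \<le>
      room G k + total_debt G k i"
    using edges by (simp add: algebra_simps)
  then have "4 * real f * (room G k' + total_debt G k' i' + real (card ?T) + 1 / (2 * real f)) \<le>
      4 * real f * (room G k + total_debt G k i)"
    by (intro mult_left_mono) auto
  \<comment> \<open>One of the two is lost again as the subtracted sum of levels falls by 1; the
    other is the required decrease.\<close>
  moreover have "4 * real f * (1 / (2 * real f)) = 2" using f1 by simp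
  moreover have "(\<Sum>u<n. real (i' u)) = (\<Sum>u<n. real (i u)) - 1"
    unfolding split using pos by (simp add: i'_def of_nat_diff)
  ultimately show ?thesis unfolding potential_def by (simp add: distrib_left)
qed

section \<open>Effect of an update on loads and potential\<close>

lemma load_insert:
  assumes "graph_ok G" "e \<notin> dom G" "\<And>e'. e' \<in> dom G \<Longrightarrow> k' e' = k e'"
  shows "load (G(e \<mapsto> U)) k' v = load G k v + (if v \<in> U then xval (G(e \<mapsto> U)) k' e else 0)"
proof -
  have "edges_at (G(e \<mapsto> U)) v = (if v \<in> U then insert e (edges_at G v) else edges_at G v)"
    using assms(2) by (auto simp: edges_at_def)
  moreover have "(\<Sum>e'\<in>edges_at G v. xval (G(e \<mapsto> U)) k' e') = (\<Sum>e'\<in>edges_at G v. xval G k e')"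
  proof (intro sum.cong refl)
    fix e' assume "e' \<in> edges_at G v"
    then have "e' \<in> dom G" using edges_at_subset[of G v] by (rule rev_subsetD)
    then show "xval (G(e \<mapsto> U)) k' e' = xval G k e'"
      using assms(2,3) by (cases "e' = e") (simp_all add: xval_def base_def)
  qed
  moreover have "e \<notin> edges_at G v" using assms(2) by (simp add: edges_at_def)
  ultimately show ?thesis using finite_edges_at[OF assms(1)] by (simp add: load_def)
qed

lemma load_delete:
  assumes "graph_ok G" "e \<in> dom G"
  shows "load (G(e := None)) k v = load G k v - (if v \<in> the (G e) then xval G k e else 0)"
proof -
  have "edges_at (G(e := None)) v = edges_at G v - {e}"
    using assms by (auto simp: edges_at_def)
  moreover have "(\<Sum>e'\<in>edges_at G v - {e}. xval (G(e := None)) k e') = (\<Sum>e'\<in>edges_at G v - {e}. xval G k e')"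
    by (intro sum.cong) (auto simp: xval_def base_def)
  moreover have "e \<in> edges_at G v \<longleftrightarrow> v \<in> the (G e)" using assms by (auto simp: edges_at_def)
  ultimately show ?thesis using finite_edges_at[OF assms(1), of v] by (simp add: load_def sum_diff1)
qed

text \<open>Loads only grow, so no debt does. The new edge brings room for at most \<open>L\<close>
  moves up.\<close>

lemma potential_insert:
  assumes G: "graph_ok G" and G': "graph_ok (G(e \<mapsto> U))" and new: "e \<notin> dom G"
    and k': "\<And>e'. e' \<in> dom G \<Longrightarrow> k' e' = k e'"
  shows "potential (G(e \<mapsto> U)) k' i \<le> potential G k i + 4 * real f * level_price * real L"
proof -
  have "load G k v \<le> load (G(e \<mapsto> U)) k' v" for v
    using load_insert[OF G new k', where v = v and U = U] xval_pos[OF G', of e k'] by simp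
  then have debts: "total_debt (G(e \<mapsto> U)) k' i \<le> total_debt G k i"
    by (intro sum_mono debt_antimono) auto
  have "room (G(e \<mapsto> U)) k' =
      level_price * (real L - real (k' e)) + room G k"
    using G new k' by (simp add: graph_ok_def)
  also have "\<dots> \<le> level_price * real L + room G k"
    using level_price_pos by simp
  finally have "room (G(e \<mapsto> U)) k' + total_debt (G(e \<mapsto> U)) k' i \<le>
    room G k + total_debt G k i + level_price * real L"
    using debts by linarith
  then have "4 * real f * (room (G(e \<mapsto> U)) k' + total_debt (G(e \<mapsto> U)) k' i) \<le>
    4 * real f * (room G k + total_debt G k i + level_price * real L)"
    by (intro mult_left_mono) auto
  then show ?thesis unfolding potential_def by (simp add: algebra_simps)
qed

text \<open>The lost weight is at most one unit at each of at most \<open>f\<close> endpoints,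
  whatever their scales. This is where \<open>loss_price\<close>, of order
  \<open>1 / (eps\<^sup>2 * real f)\<close>, enters the time bound.\<close>

lemma potential_delete:
  assumes ok: "levels_ok G d k i" and e: "e \<in> dom G"
  shows "potential (G(e := None)) k i \<le> potential G k i + 4 * real f * real f * loss_price"
proof -
  have G: "graph_ok G" using ok by (simp add: levels_ok_def)
  have finG: "finite (dom G)" using G by (simp add: graph_ok_def)
  have "debt (G(e := None)) k i v \<le> debt G k i v + (if v \<in> the (G e) then loss_price else 0)"
    if v: "v < n" for v
  proof (cases "v \<in> the (G e)")
    case True
    have "debt (G(e := None)) k i v \<le> debt G k i v + loss_price * xval G k e / unit_at i v"
      using load_delete[OF G e] xval_pos[OF G e, of k] v by (intro debt_Lipschitz) auto
    also have "\<dots> \<le> debt G k i v + loss_price * 1"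
      using xval_le_unit[OF ok e True] unit_pos[OF v, of i] loss_price_pos
      by (simp add: field_simps)
    finally show ?thesis using True by simp
  next
    case False
    then show ?thesis using load_delete[OF G e] v by (auto intro: debt_antimono)
  qed
  then have "total_debt (G(e := None)) k i \<le> (\<Sum>v<n. debt G k i v + (if v \<in> the (G e) then loss_price else 0))"
    by (intro sum_mono) auto
  also have "\<dots> = total_debt G k i + real (card (the (G e))) * loss_price"
    using graph_okD(2)[OF G e] by (simp add: sum.distrib sum.If_cases Int_absorb1)
  also have "\<dots> \<le> total_debt G k i + real f * loss_price"
    using graph_okD(3)[OF G e] loss_price_pos by (simp add: mult_right_mono)
  finally have debts: "total_debt (G(e := None)) k i \<le> total_debt G k i + real f * loss_price" .
  have "room G k =
      level_price * (real L - real (k e)) + (\<Sum>e'\<in>dom G - {e}. level_price * (real L - real (k e')))"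
    using e finG by (intro sum.remove) auto
  moreover have "0 \<le> level_price * (real L - real (k e))"
    using edge_level_le_top[OF ok e] level_price_pos by simp
  ultimately have "room (G(e := None)) k + total_debt (G(e := None)) k i \<le>
    room G k + total_debt G k i + real f * loss_price"
    using debts by simp
  then have "4 * real f * (room (G(e := None)) k + total_debt (G(e := None)) k i) \<le>
    4 * real f * (room G k + total_debt G k i + real f * loss_price)"
    by (intro mult_left_mono) auto
  then show ?thesis unfolding potential_def by (simp add: algebra_simps)
qed

section \<open>Lower bounds on the potential, and settled nodes\<close>

text \<open>The bound by \<open>n * L\<close> serves the termination of the settling loop. The
  amortized time rests on the first bound, combined with \<open>sum_levels_le\<close> at
  rest.\<close>

lemma potential_lower_bound:
  assumes ok: "levels_ok G d k i"
  shows "- (\<Sum>v<n. real (i v)) \<le> potential G k i" "- (real n * real L) \<le> potential G k i"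
proof -
  have "0 \<le> room G k"
    using edge_level_le_top[OF ok] level_price_pos by (intro sum_nonneg) auto
  moreover have "0 \<le> total_debt G k i" using debt_nonneg by (intro sum_nonneg) auto
  ultimately show 1: "- (\<Sum>v<n. real (i v)) \<le> potential G k i"
    by (simp add: potential_def)
  have "(\<Sum>v<n. real (i v)) \<le> (\<Sum>v<n. real L)" using ok by (intro sum_mono) (auto simp: levels_ok_def)
  then show "- (real n * real L) \<le> potential G k i" using 1 by simp
qed

definition settled :: "graph \<Rightarrow> (nat \<Rightarrow> nat) \<Rightarrow> (nat \<Rightarrow> nat) \<Rightarrow> nat \<Rightarrow> bool" where
  "settled G k i v \<longleftrightarrow> load G k v \<le> c v \<and> (0 < i v \<longrightarrow> c v \<le> lam * load G k v)"

text \<open>A node of positive level carries load, so it has an edge to pay for its level.\<close>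

lemma sum_levels_le:
  assumes ok: "levels_ok G d k i" and settled: "\<And>v. v < n \<Longrightarrow> settled G k i v"
  shows "(\<Sum>v<n. real (i v)) \<le> real f * real L * real (card (dom G))"
proof -
  have G: "graph_ok G" using ok by (simp add: levels_ok_def)
  have finG: "finite (dom G)" using G by (simp add: graph_ok_def)
  have "(\<Sum>v<n. real (i v)) \<le> (\<Sum>v<n. \<Sum>e\<in>dom G. if v \<in> the (G e) then real L else 0)"
  proof (intro sum_mono)
    fix v assume "v \<in> {..<n}"
    then have v: "v < n" by simp
    show "real (i v) \<le> (\<Sum>e\<in>dom G. if v \<in> the (G e) then real L else 0)"
    proof (cases "i v = 0")
      case False
      then have "c v \<le> lam * load G k v" using settled[OF v] by (simp add: settled_def)
      then have "load G k v \<noteq> 0" using cap_pos[OF v] by auto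
      then obtain e where e: "e \<in> dom G" "v \<in> the (G e)" unfolding load_def
        by (metis (no_types, lifting) edges_at_def mem_Collect_eq sum.neutral)
      have "real (i v) \<le> (if v \<in> the (G e) then real L else 0)"
        using ok v e by (simp add: levels_ok_def)
      also have "\<dots> \<le> (\<Sum>e\<in>dom G. if v \<in> the (G e) then real L else 0)"
        using e finG by (intro member_le_sum) auto
      finally show ?thesis .
    qed (simp add: sum_nonneg)
  qed
  also have "\<dots> = (\<Sum>e\<in>dom G. \<Sum>v<n. if v \<in> the (G e) then real L else 0)"
    by (rule sum.swap)
  also have "\<dots> \<le> (\<Sum>e\<in>dom G. real f * real L)"
  proof (intro sum_mono)
    fix e assume e: "e \<in> dom G"
    have "(\<Sum>v<n. if v \<in> the (G e) then real L else 0) = real (card (the (G e))) * real L"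
      using graph_okD(2)[OF G e] by (simp add: sum.If_cases Int_absorb1)
    then show "(\<Sum>v<n. if v \<in> the (G e) then real L else 0) \<le> real f * real L"
      using graph_okD(3)[OF G e] by (simp add: mult_right_mono)
  qed
  finally show ?thesis by (simp add: mult.commute)
qed

lemma settled_maximal_solution:
  assumes ok: "levels_ok G d k i" and settled: "\<And>v. v < n \<Longrightarrow> settled G k i v"
    and x: "\<And>e. e \<in> dom G \<Longrightarrow> x e = xval G k e"
  shows "maximal_solution {..<n} c mu lam G x"
proof -
  have G: "graph_ok G" using ok by (simp add: levels_ok_def)
  have ld: "(\<Sum>e\<in>edges_at G v. x e) = load G k v" for v
    unfolding load_def using x[OF subsetD[OF edges_at_subset]] by (intro sum.cong refl)
  have "\<exists>v\<in>nodes_of {..<n} G e. c v / lam \<le> load G k v" if e: "e \<in> dom G" and less: "xval G k e < mu" for e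
  proof -
    have node: "v < n \<and> v \<in> nodes_of {..<n} G e" if "v \<in> the (G e)" for v
      using that e graph_okD(2)[OF G e] by (auto simp: nodes_of_def edges_at_def)
    show ?thesis
    proof (cases "k e = 0")
      case True
      then have "base G e \<noteq> mu" using less by (simp add: xval_def)
      then obtain u where u: "u \<in> the (G e)" "base G e = c u" using base_cases[OF G e] by auto
      have "xval G k e \<le> load G k u"
        unfolding load_def using finite_edges_at[OF G] e u xval_pos[OF G, THEN less_imp_le]
        by (intro member_le_sum) (auto simp: edges_at_def)
      then have "c u \<le> load G k u" using True u by (simp add: xval_def)
      moreover have "c u / lam \<le> c u / 1"
        using cap_pos[of u] node[OF u(1)] lam_gt beta_gt1 by (intro divide_left_mono) auto
      ultimately have "c u / lam \<le> load G k u" by simp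
      then show ?thesis using node[OF u(1)] by blast
    next
      case False
      then obtain u where u: "u \<in> the (G e)" "i u = k e + d e u"
        using ok e unfolding levels_ok_def edge_level_ok_def by (metis gr0I)
      then have "c u \<le> lam * load G k u" using settled[of u] node[OF u(1)] False by (auto simp: settled_def)
      then have "c u / lam \<le> load G k u" using lam_gt by (simp add: field_simps)
      then show ?thesis using node[OF u(1)] by blast
    qed
  qed
  then show ?thesis
    using settled x xval_pos[OF G, THEN less_imp_le] xval_le_mu[OF G]
    unfolding maximal_solution_def feasible_def ld settled_def by (metis lessThan_iff)
qed

end

section \<open>Programs with running time\<close>

abbreviation nat_assigned :: "string \<Rightarrow> nexp \<Rightarrow> nexp \<Rightarrow> nexp \<Rightarrow> memory \<Rightarrow> memory" where
  "nat_assigned a i j b s \<equiv> s\<lparr>nat_mem := write_cell a (nval i s) (nval j s) (nval b s) (nat_mem s)\<rparr>"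

text \<open>A weakest precondition for total correctness in which the running time is an argument of
  the postcondition. As \<open>exec\<close> is deterministic, it speaks about the only run.\<close>

definition wp :: "com \<Rightarrow> (nat \<Rightarrow> memory \<Rightarrow> bool) \<Rightarrow> memory \<Rightarrow> bool" where
  "wp P Q s \<longleftrightarrow> (\<exists>t s'. exec P s t s' \<and> Q t s')"

lemma wp_exec: "exec P s t s' \<Longrightarrow> wp P Q s \<longleftrightarrow> Q t s'"
  unfolding wp_def using exec_deterministic by blast

lemma wp_simps:
  "wp Skip Q s \<longleftrightarrow> Q 1 s"
  "wp (NAssign a i j b) Q s \<longleftrightarrow> Q (1 + ncost i + ncost j + ncost b)
     (nat_assigned a i j b s)"
  "wp (RAssign a i j r) Q s \<longleftrightarrow> Q (1 + ncost i + ncost j + rcost r)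
     (s\<lparr>real_mem := write_cell a (nval i s) (nval j s) (rval r s) (real_mem s)\<rparr>)"
  "wp (Seq P R) Q s \<longleftrightarrow> wp P (\<lambda>t. wp R (\<lambda>t'. Q (1 + t + t'))) s"
  "wp (Cond g P R) Q s \<longleftrightarrow>
     (if bval g s then wp P (\<lambda>t. Q (1 + bcost g + t)) s else wp R (\<lambda>t. Q (1 + bcost g + t)) s)"
  subgoal by (rule wp_exec[OF exec.Skip])
  subgoal by (rule wp_exec[OF exec.NAssign])
  subgoal by (rule wp_exec[OF exec.RAssign])
  subgoal unfolding wp_def by (fastforce intro: exec.Seq[simplified] elim!: exec_elims(4))
  subgoal unfolding wp_def
    by (cases "bval g s") (fastforce intro: exec.CondTrue[simplified] exec.CondFalse[simplified] elim!: exec_elims(5))+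
  done

lemma wp_mono: "wp P Q s \<Longrightarrow> (\<And>t s'. Q t s' \<Longrightarrow> R t s') \<Longrightarrow> wp P R s"
  by (auto simp: wp_def)

text \<open>For loops with a uniform bound \<open>K\<close> on an iteration; \<open>M\<close> bounds
  the number of iterations still to come.\<close>

lemma wp_while:
  fixes M :: "memory \<Rightarrow> nat"
  assumes step: "\<And>s. J s \<Longrightarrow> bval b s \<Longrightarrow> wp P (\<lambda>t s'. t \<le> K \<and> J s' \<and> M s' < M s) s"
    and start: "J s"
    and post: "\<And>t s'. t \<le> M s * (K + 1 + bcost b) + 1 + bcost b \<Longrightarrow> J s' \<Longrightarrow> \<not> bval b s' \<Longrightarrow> Q t s'"
  shows "wp (While b P) Q s"
proof -
  have "\<exists>t s'. exec (While b P) s t s' \<and> t \<le> M s * (K + 1 + bcost b) + 1 + bcost b \<and> J s' \<and> \<not> bval b s'"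
    using start
  proof (induction "M s" arbitrary: s rule: less_induct)
    case less
    show ?case
    proof (cases "bval b s")
      case True
      then obtain t s1 where 1: "exec P s t s1" "t \<le> K" "J s1" "M s1 < M s"
        using step[OF less.prems] by (auto simp: wp_def)
      then obtain t' s' where 2: "exec (While b P) s1 t' s'"
        "t' \<le> M s1 * (K + 1 + bcost b) + 1 + bcost b" "J s'" "\<not> bval b s'"
        using less.hyps[OF 1(4,3)] by blast
      have "Suc (M s1) * (K + 1 + bcost b) \<le> M s * (K + 1 + bcost b)"
        using 1(4) by (intro mult_right_mono) auto
      then have "1 + bcost b + t + t' \<le> M s * (K + 1 + bcost b) + 1 + bcost b"
        using 1(2) 2(2) by simp
      then show ?thesis using exec.WhileTrue[OF True 1(1) 2(1)] 2 by blast
    next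
      case False
      then show ?thesis using exec.WhileFalse[OF False] less.prems by fastforce
    qed
  qed
  then show ?thesis using post by (auto simp: wp_def)
qed

text \<open>The amortized rule: an iteration may take any time that the fall of \<open>F\<close>
  pays for. Each costs at least 1, so the rounded-up distance of \<open>F\<close> from
  \<open>lb\<close> decreases. The final value \<open>F s'\<close> stays in the bound so that the
  costs of successive updates telescope.\<close>

lemma wp_while_potential:
  fixes F :: "memory \<Rightarrow> real"
  assumes step: "\<And>s. J s \<Longrightarrow> bval b s \<Longrightarrow>
      wp P (\<lambda>t s'. J s' \<and> real (t + 1 + bcost b) \<le> F s - F s') s"
    and bound: "\<And>s. J s \<Longrightarrow> lb \<le> F s"
    and start: "J s"
    and post: "\<And>t s'. real t \<le> F s - F s' + 1 + real (bcost b) \<Longrightarrow> J s' \<Longrightarrow> \<not> bval b s' \<Longrightarrow> Q t s'"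
  shows "wp (While b P) Q s"
proof -
  have "\<exists>t s'. exec (While b P) s t s' \<and> real t \<le> F s - F s' + 1 + real (bcost b) \<and> J s' \<and> \<not> bval b s'"
    using start
  proof (induction "nat \<lceil>F s - lb\<rceil>" arbitrary: s rule: less_induct)
    case less
    show ?case
    proof (cases "bval b s")
      case True
      then obtain t s1 where 1: "exec P s t s1" "J s1" "real (t + 1 + bcost b) \<le> F s - F s1"
        using step[OF less.prems] by (auto simp: wp_def)
      have "F s1 + 1 \<le> F s" using 1(3) by simp
      then have "nat \<lceil>F s1 - lb\<rceil> < nat \<lceil>F s - lb\<rceil>" using bound[OF 1(2)] by linarith
      then obtain t' s' where 2: "exec (While b P) s1 t' s'"
        "real t' \<le> F s1 - F s' + 1 + real (bcost b)" "J s'" "\<not> bval b s'"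
        using less.hyps[OF _ 1(2)] by blast
      have "real (1 + bcost b + t + t') \<le> F s - F s' + 1 + real (bcost b)"
        using 1(3) 2(2) by simp
      then show ?thesis using exec.WhileTrue[OF True 1(1) 2(1)] 2 by blast
    next
      case False
      then show ?thesis using exec.WhileFalse[OF False] less.prems by fastforce
    qed
  qed
  then show ?thesis using post by (auto simp: wp_def)
qed

section \<open>Frame conditions by array names\<close>

lemma write_cell_simps:
  "write_cell a i j y M a = (M a)(i := (M a i)(j := y))"
  "b \<noteq> a \<Longrightarrow> write_cell a i j y M b = M b"
  by (auto simp: write_cell_def)

definition eq_off :: "string set \<Rightarrow> (string \<Rightarrow> 'a) \<Rightarrow> (string \<Rightarrow> 'a) \<Rightarrow> bool" where
  "eq_off N M M' \<longleftrightarrow> (\<forall>a. a \<notin> N \<longrightarrow> M' a = M a)"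

definition agree :: "string set \<Rightarrow> string set \<Rightarrow> memory \<Rightarrow> memory \<Rightarrow> bool" where
  "agree N R s s' \<longleftrightarrow> eq_off N (nat_mem s) (nat_mem s') \<and> eq_off R (real_mem s) (real_mem s')"

lemma eq_off_refl: "eq_off N M M"
  by (simp add: eq_off_def)

lemma eq_off_write: "a \<in> N \<Longrightarrow> eq_off N M (write_cell a i j y M') \<longleftrightarrow> eq_off N M M'"
  by (auto simp: eq_off_def write_cell_def)

lemma agree_refl: "agree N R s s"
  by (simp add: agree_def eq_off_def)

lemma agree_trans: "agree N R s s' \<Longrightarrow> agree N R s' s'' \<Longrightarrow> agree N R s s''"
  by (simp add: agree_def eq_off_def)

lemma agree_mono: "agree N R s s' \<Longrightarrow> N \<subseteq> N' \<Longrightarrow> R \<subseteq> R' \<Longrightarrow> agree N' R' s s'"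
  by (auto simp: agree_def eq_off_def)

lemma agreeD:
  "agree N R s s' \<Longrightarrow> a \<notin> N \<Longrightarrow> nat_mem s' a = nat_mem s a"
  "agree N R s s' \<Longrightarrow> a \<notin> R \<Longrightarrow> real_mem s' a = real_mem s a"
  by (auto simp: agree_def eq_off_def)

section \<open>Buckets with insertion and deletion in constant time\<close>

text \<open>\<open>\<kappa> e u\<close> is the key under which \<open>e\<close> is filed at
  \<open>u\<close>, and \<open>p\<close> inverts \<open>A\<close> on the occupied positions. Number
  0 behaves as an empty bucket, so that a key without a bucket can be looked up safely; emptiness
  beyond \<open>q\<close> lets a new number be given out without initialization.\<close>

definition buckets ::
  "nat \<Rightarrow> (nat \<Rightarrow> nat \<Rightarrow> nat) \<Rightarrow> (nat \<Rightarrow> nat \<Rightarrow> nat) \<Rightarrow> (nat \<Rightarrow> nat \<Rightarrow> nat) \<Rightarrow> (nat \<Rightarrow> nat \<Rightarrow> nat) \<Rightarrow>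
   (nat \<Rightarrow> nat \<Rightarrow> nat option) \<Rightarrow> bool" where
  "buckets q B C A p \<kappa> \<longleftrightarrow> C 0 0 = 0 \<and> (\<forall>b>q. C b 0 = 0) \<and> (\<forall>u t. B u t \<le> q) \<and>
     (\<forall>u t u' t'. B u t = B u' t' \<and> B u t \<noteq> 0 \<longrightarrow> u = u' \<and> t = t') \<and>
     (\<forall>e u t. \<kappa> e u = Some t \<longrightarrow> p e u < C (B u t) 0 \<and> A (B u t) (p e u) = e) \<and>
     (\<forall>u t j. j < C (B u t) 0 \<longrightarrow> \<kappa> (A (B u t) j) u = Some t \<and> p (A (B u t) j) u = j)"

lemma bucketsI:
  assumes "C 0 0 = 0" "\<And>b. b > q \<Longrightarrow> C b 0 = 0" "\<And>u t. B u t \<le> q"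
    "\<And>u t u' t'. B u t = B u' t' \<Longrightarrow> B u t \<noteq> 0 \<Longrightarrow> u = u' \<and> t = t'"
    "\<And>e u t. \<kappa> e u = Some t \<Longrightarrow> p e u < C (B u t) 0 \<and> A (B u t) (p e u) = e"
    "\<And>u t j. j < C (B u t) 0 \<Longrightarrow> \<kappa> (A (B u t) j) u = Some t \<and> p (A (B u t) j) u = j"
  shows "buckets q B C A p \<kappa>"
  unfolding buckets_def by (intro conjI; use assms in blast)

lemma bucketsD:
  assumes "buckets q B C A p \<kappa>"
  shows "C 0 0 = 0" "b > q \<Longrightarrow> C b 0 = 0" "B u t \<le> q"
    "B u t = B u' t' \<Longrightarrow> B u t \<noteq> 0 \<Longrightarrow> u = u' \<and> t = t'"
    "\<kappa> e u = Some t \<Longrightarrow> p e u < C (B u t) 0" "\<kappa> e u = Some t \<Longrightarrow> A (B u t) (p e u) = e"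
    "\<kappa> e u = Some t \<Longrightarrow> B u t \<noteq> 0"
    "j < C (B u t) 0 \<Longrightarrow> \<kappa> (A (B u t) j) u = Some t"
    "j < C (B u t) 0 \<Longrightarrow> p (A (B u t) j) u = j"
  using assms unfolding buckets_def by (blast, blast, blast, blast, blast, blast, metis less_nat_zero_code, blast, blast)

text \<open>The last entry \<open>z\<close> moves into the vacated position. It may be
  \<open>e\<close> itself; the write to \<open>A\<close> then hits only the position that is being
  given up.\<close>

lemma buckets_delete:
  assumes bk: "buckets q B C A p \<kappa>" and e: "\<kappa> e u = Some t"
    and b: "b = B u t" and l: "l = C b 0 - 1" and z: "z = A b l"
  shows "buckets q B (C(b := (C b)(0 := l))) (A(b := (A b)(p e u := z))) (p(z := (p z)(u := p e u)))
     (\<kappa>(e := (\<kappa> e)(u := None)))"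
proof -
  note D = bucketsD[OF bk]
  have b0: "b \<noteq> 0" and pe: "p e u < C b 0" "A b (p e u) = e" using D(5-7)[OF e] b by auto
  have l': "l < C b 0" "C b 0 = Suc l" using l pe by auto
  have zk: "\<kappa> z u = Some t" "p z u = l" using D(8,9)[of l u t] l' b z by auto
  let ?C = "C(b := (C b)(0 := l))" and ?A = "A(b := (A b)(p e u := z))"
    and ?p = "p(z := (p z)(u := p e u))" and ?k = "\<kappa>(e := (\<kappa> e)(u := None))"
  have bq: "b \<le> q" using D(3) b by simp
  have 1: "?p e' u' < ?C (B u' t') 0 \<and> ?A (B u' t') (?p e' u') = e'" if k': "?k e' u' = Some t'" for e' u' t'
  proof -
    have k: "\<kappa> e' u' = Some t'" and ne: "\<not> (e' = e \<and> u' = u)" using k' by (auto split: if_splits)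
    note D' = D(5-7)[OF k]
    show ?thesis
    proof (cases "u' = u \<and> t' = t")
      case True
      then have e': "e' \<noteq> e" using ne by simp
      have B': "B u' t' = b" using True b by simp
      show ?thesis
      proof (cases "e' = z")
        case True
        then have "p e u \<noteq> l" using pe z e' by auto
        then show ?thesis using True B' pe l' \<open>u' = u \<and> t' = t\<close> by simp
      next
        case False
        then have "p e' u \<noteq> l" "p e' u \<noteq> p e u" using D' True B' z pe e' by auto
        then show ?thesis using False True B' D' l' by simp
      qed
    next
      case False
      then have "B u' t' \<noteq> b" using D(4)[of u' t' u t] b b0 by auto
      moreover have "\<not> (e' = z \<and> u' = u)" using zk k False by auto
      ultimately show ?thesis using D' by auto
    qed
  qed
  have 2: "?k (?A (B u' t') j) u' = Some t' \<and> ?p (?A (B u' t') j) u' = j" if j: "j < ?C (B u' t') 0" for u' t' j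
  proof (cases "B u' t' = b")
    case True
    then have ut: "u' = u" "t' = t" using D(4)[of u' t' u t] b b0 by auto
    have jl: "j < l" using j True by simp
    then have j': "j < C (B u t) 0" using l' b by simp
    show ?thesis
    proof (cases "j = p e u")
      case True
      then have "z \<noteq> e" using zk jl by auto
      then show ?thesis using True ut b zk by simp
    next
      case False
      have "\<kappa> (A b j) u = Some t" "p (A b j) u = j" using D(8,9)[OF j'] b by auto
      moreover have "A b j \<noteq> z" using calculation zk jl by auto
      moreover have "A b j \<noteq> e" using calculation False by auto
      ultimately show ?thesis using False ut b by simp
    qed
  next
    case False
    then have j': "j < C (B u' t') 0" using j by simp
    have k: "\<kappa> (A (B u' t') j) u' = Some t'" "p (A (B u' t') j) u' = j" using D(8,9)[OF j'] by auto
    have "\<not> (A (B u' t') j = e \<and> u' = u)" "\<not> (A (B u' t') j = z \<and> u' = u)"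
      using k e zk False b by auto
    then show ?thesis using k False by auto
  qed
  show ?thesis
  proof (rule bucketsI)
    show "?C 0 0 = 0" using D(1) b0 by simp
    show "?C b' 0 = 0" if "b' > q" for b' using D(2)[OF that] bq that by auto
  qed (fact D(3) D(4) 1 2)+
qed

lemma buckets_insert:
  assumes bk: "buckets q B C A p \<kappa>" and e: "\<kappa> e u = None"
    and b: "b = B u t" and b0: "b \<noteq> 0" and l: "l = C b 0"
  shows "buckets q B (C(b := (C b)(0 := Suc l))) (A(b := (A b)(l := e))) (p(e := (p e)(u := l)))
     (\<kappa>(e := (\<kappa> e)(u := Some t)))"
proof -
  note D = bucketsD[OF bk]
  let ?C = "C(b := (C b)(0 := Suc l))" and ?A = "A(b := (A b)(l := e))"
    and ?p = "p(e := (p e)(u := l))" and ?k = "\<kappa>(e := (\<kappa> e)(u := Some t))"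
  have bq: "b \<le> q" using D(3) b by simp
  have 1: "?p e' u' < ?C (B u' t') 0 \<and> ?A (B u' t') (?p e' u') = e'" if k': "?k e' u' = Some t'" for e' u' t'
  proof (cases "e' = e \<and> u' = u")
    case True
    then show ?thesis using k' b by auto
  next
    case False
    then have k: "\<kappa> e' u' = Some t'" using k' by (auto split: if_splits)
    note D' = D(5-7)[OF k]
    show ?thesis using False D' l by (cases "B u' t' = b") auto
  qed
  have 2: "?k (?A (B u' t') j) u' = Some t' \<and> ?p (?A (B u' t') j) u' = j" if j: "j < ?C (B u' t') 0" for u' t' j
  proof (cases "B u' t' = b \<and> j = l")
    case True
    then have "u' = u" "t' = t" using D(4)[of u' t' u t] b b0 by auto
    then show ?thesis using True by simp
  next
    case False
    then have j': "j < C (B u' t') 0" using j l by (auto split: if_splits)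
    have k: "\<kappa> (A (B u' t') j) u' = Some t'" "p (A (B u' t') j) u' = j" using D(8,9)[OF j'] by auto
    have "\<not> (A (B u' t') j = e \<and> u' = u)" using k e by auto
    then show ?thesis using k False by auto
  qed
  show ?thesis
  proof (rule bucketsI)
    show "?C 0 0 = 0" using D(1) b0 by simp
    show "?C b' 0 = 0" if "b' > q" for b' using D(2)[OF that] bq that by auto
  qed (fact D(3) D(4) 1 2)+
qed

text \<open>The unassigned key and the number \<open>Suc q\<close> both denote empty buckets, so
  assigning the number does not affect the filed edges.\<close>

lemma buckets_allocate:
  assumes bk: "buckets q B C A p \<kappa>" and u: "B u t = 0"
  shows "buckets (Suc q) (B(u := (B u)(t := Suc q))) C A p \<kappa>"
proof -
  note D = bucketsD[OF bk]
  let ?B = "B(u := (B u)(t := Suc q))"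
  have C: "C (Suc q) 0 = 0" using D(2) by simp
  have ne: "B u' t' \<noteq> Suc q" for u' t' using D(3)[of u' t'] by auto
  have B: "?B u' t' = (if u' = u \<and> t' = t then Suc q else B u' t')" for u' t' by simp
  have "?B u' t' \<le> Suc q" for u' t' using D(3)[of u' t'] unfolding B by simp
  moreover have "u' = u'' \<and> t' = t''" if "?B u' t' = ?B u'' t''" "?B u' t' \<noteq> 0" for u' t' u'' t''
    using that D(4)[of u' t' u'' t''] ne by (auto simp only: B split: if_splits)
  moreover have "p e u' < C (?B u' t') 0 \<and> A (?B u' t') (p e u') = e" if "\<kappa> e u' = Some t'" for e u' t'
    using D(5-7)[OF that] u by (auto simp: B)
  moreover have "\<kappa> (A (?B u' t') j) u' = Some t' \<and> p (A (?B u' t') j) u' = j" if "j < C (?B u' t') 0" for u' t' j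
    using that D(8,9)[of j u' t'] C by (auto simp: B split: if_splits)
  moreover have "C b 0 = 0" if "Suc q < b" for b using D(2)[of b] that by simp
  ultimately show ?thesis using D(1) by (intro bucketsI)
qed

section \<open>Filing an edge under its endpoints\<close>

abbreviation seq (infixr ";;" 60) where "P ;; Q \<equiv> Seq P Q"
abbreviation cell :: "string \<Rightarrow> nexp \<Rightarrow> nexp" where "cell a i \<equiv> NCell a i (NConst 0)"
abbreviation var :: "string \<Rightarrow> nexp" where "var a \<equiv> cell a (NConst 0)"
abbreviation rcell :: "string \<Rightarrow> nexp \<Rightarrow> rexp" where "rcell a i \<equiv> RCell a i (NConst 0)"
abbreviation rvar :: "string \<Rightarrow> rexp" where "rvar a \<equiv> rcell a (NConst 0)"
abbreviation assign (infix "::=" 61) where "a ::= b \<equiv> NAssign a (NConst 0) (NConst 0) b"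
abbreviation rassign (infix ":::=" 61) where "a :::= r \<equiv> RAssign a (NConst 0) (NConst 0) r"
abbreviation incr :: "string \<Rightarrow> nexp \<Rightarrow> com" where
  "incr a i \<equiv> NAssign a i (NConst 0) (NAdd (cell a i) (NConst 1))"
abbreviation decr :: "string \<Rightarrow> nexp \<Rightarrow> com" where
  "decr a i \<equiv> NAssign a i (NConst 0) (NSub (cell a i) (NConst 1))"
abbreviation key :: nexp where
  "key \<equiv> NAdd (cell ''k'' (var ''E'')) (NCell ''d'' (var ''E'') (var ''u''))"
abbreviation push :: com where
  "push \<equiv> NAssign ''S'' (var ''h'') (NConst 0) (var ''u'');; incr ''h'' (NConst 0)"

text \<open>
  Memory layout: \<open>i v\<close>, \<open>W v\<close> level and load of a node; \<open>k e\<close>, \<open>x e\<close>, \<open>g e\<close>, \<open>v e j\<close>, \<open>d e u\<close> level,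
  weight, degree, endpoints and offsets of an edge.  The edges at \<open>u\<close> are kept in buckets by the value
  \<open>k e + d e u\<close>, so that the tight edges at \<open>u\<close> form the bucket \<open>i u\<close>.  As arrays have only two
  indices, buckets get numbers, \<open>B u t\<close>, when first used (0 means none, \<open>q\<close> is the last number given
  out); bucket \<open>b\<close> consists of \<open>A b j\<close> for \<open>j < C b\<close>, and \<open>p e u\<close> is the position of \<open>e\<close>.  The \<open>h\<close> entries
  of the stack \<open>S\<close> include every node that may have to move.
\<close>

definition remove_edge :: com where
  "remove_edge = ''j'' ::= NConst 0;;
   While (NLess (var ''j'') (cell ''g'' (var ''E'')))
    (''u'' ::= NCell ''v'' (var ''E'') (var ''j'');;
     ''b'' ::= NCell ''B'' (var ''u'') key;;
     decr ''C'' (var ''b'');;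
     ''z'' ::= NCell ''A'' (var ''b'') (cell ''C'' (var ''b''));;
     NAssign ''A'' (var ''b'') (NCell ''p'' (var ''E'') (var ''u'')) (var ''z'');;
     NAssign ''p'' (var ''z'') (var ''u'') (NCell ''p'' (var ''E'') (var ''u''));;
     RAssign ''W'' (var ''u'') (NConst 0) (RSub (rcell ''W'' (var ''u'')) (rcell ''x'' (var ''E'')));;
     push;; incr ''j'' (NConst 0))"

definition add_edge :: com where
  "add_edge = ''j'' ::= NConst 0;;
   While (NLess (var ''j'') (cell ''g'' (var ''E'')))
    (''u'' ::= NCell ''v'' (var ''E'') (var ''j'');;
     Cond (NLess (NCell ''B'' (var ''u'') key) (NConst 1))
       (incr ''q'' (NConst 0);; NAssign ''B'' (var ''u'') key (var ''q'')) Skip;;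
     ''b'' ::= NCell ''B'' (var ''u'') key;;
     NAssign ''A'' (var ''b'') (cell ''C'' (var ''b'')) (var ''E'');;
     NAssign ''p'' (var ''E'') (var ''u'') (cell ''C'' (var ''b''));;
     incr ''C'' (var ''b'');;
     RAssign ''W'' (var ''u'') (NConst 0) (RAdd (rcell ''W'' (var ''u'')) (rcell ''x'' (var ''E'')));;
     push;; incr ''j'' (NConst 0))"

definition stack :: "memory \<Rightarrow> nat list" where
  "stack s = map (\<lambda>j. nat_mem s ''S'' j 0) [0..<nat_mem s ''h'' 0 0]"

definition ends :: "memory \<Rightarrow> nat \<Rightarrow> nat list" where
  "ends s e = map (\<lambda>j. nat_mem s ''v'' e j) [0..<nat_mem s ''g'' e 0]"

definition bucketed :: "memory \<Rightarrow> (nat \<Rightarrow> nat \<Rightarrow> nat option) \<Rightarrow> bool" where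
  "bucketed s \<kappa> \<longleftrightarrow>
     buckets (nat_mem s ''q'' 0 0) (nat_mem s ''B'') (nat_mem s ''C'') (nat_mem s ''A'') (nat_mem s ''p'') \<kappa>"

text \<open>Footprints of nested programs, as names of natural-number arrays: \<open>scratch\<close>
  for filing an edge, \<open>swept\<close> for a sweep, \<open>moved\<close> for a move of a node,
  \<open>changed\<close> for an update before settling.\<close>

definition scratch :: "string set" where
  "scratch = {''j'', ''u'', ''b'', ''z'', ''q'', ''B'', ''C'', ''A'', ''p'', ''S'', ''h''}"

definition swept :: "string set" where
  "swept = {''y'', ''E'', ''k'', ''o''} \<union> scratch"

definition moved :: "string set" where
  "moved = {''N'', ''T'', ''i''} \<union> swept"

definition changed :: "string set" where
  "changed = {''E'', ''g'', ''k'', ''v'', ''d'', ''l''} \<union> scratch"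

lemmas frame = agree_def eq_off_def scratch_def swept_def moved_def changed_def
lemmas framed = agree_def eq_off_write eq_off_refl
lemmas names = scratch_def swept_def moved_def changed_def

text \<open>A push writes at position \<open>h\<close>, above the entries that make up the old
  stack.\<close>

lemma map_push: "map (\<lambda>x. (if x = h then F else H x) y) [0..<h] = map (\<lambda>x. H x y) [0..<h]"
  by (rule map_cong) auto

text \<open>The nodes pushed are exactly those whose load is corrected, so a node unsettled by the
  change is on the stack. In the loop invariant, the first \<open>j\<close> endpoints have already
  lost their key.\<close>

lemma wp_remove_edge:
  assumes bk: "bucketed s \<kappa>" and E: "E = nat_mem s ''E'' 0 0" and dist: "distinct (ends s E)"
    and keys: "\<And>u. u \<in> set (ends s E) \<Longrightarrow> \<kappa> E u = Some (nat_mem s ''k'' E 0 + nat_mem s ''d'' E u)"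
  shows "wp remove_edge (\<lambda>t s'. t \<le> 250 * (length (ends s E) + 1) \<and> agree scratch {''W''} s s' \<and>
     bucketed s' (\<lambda>e u. if e = E \<and> u \<in> set (ends s E) then None else \<kappa> e u) \<and>
     stack s' = stack s @ ends s E \<and>
     (\<forall>u. real_mem s' ''W'' u 0 = real_mem s ''W'' u 0 - (if u \<in> set (ends s E) then real_mem s ''x'' E 0 else 0))) s"
proof -
  define vs where "vs = ends s E"
  define J where "J s' \<longleftrightarrow> (let j = nat_mem s' ''j'' 0 0 in j \<le> length vs \<and> agree scratch {''W''} s s' \<and>
     bucketed s' (\<lambda>e u. if e = E \<and> u \<in> set (take j vs) then None else \<kappa> e u) \<and>
     stack s' = stack s @ take j vs \<and>
     (\<forall>u. real_mem s' ''W'' u 0 = real_mem s ''W'' u 0 - (if u \<in> set (take j vs) then real_mem s ''x'' E 0 else 0)))" for s'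
  have len: "length vs = nat_mem s ''g'' E 0" by (simp add: vs_def ends_def)
  have nth: "vs ! j = nat_mem s ''v'' E j" if "j < length vs" for j
    using that by (simp add: vs_def ends_def)
  show ?thesis
    unfolding remove_edge_def wp_simps
  proof (rule wp_while[where J = J and K = 200 and M = "\<lambda>s'. length vs - nat_mem s' ''j'' 0 0"], goal_cases)
    case (1 s')
    define j where "j = nat_mem s' ''j'' 0 0"
    define u where "u = vs ! j"
    note ag = agreeD[of scratch "{''W''}" s s']
    have J: "agree scratch {''W''} s s'"
      "bucketed s' (\<lambda>e u. if e = E \<and> u \<in> set (take j vs) then None else \<kappa> e u)"
      "stack s' = stack s @ take j vs"
      "\<And>u. real_mem s' ''W'' u 0 = real_mem s ''W'' u 0 - (if u \<in> set (take j vs) then real_mem s ''x'' E 0 else 0)"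
      using 1(1) by (auto simp: J_def j_def Let_def)
    have fr: "nat_mem s' ''E'' = nat_mem s ''E''" "nat_mem s' ''g'' = nat_mem s ''g''"
      "nat_mem s' ''v'' = nat_mem s ''v''" "nat_mem s' ''k'' = nat_mem s ''k''"
      "nat_mem s' ''d'' = nat_mem s ''d''" "real_mem s' ''x'' = real_mem s ''x''"
      using J(1) by (auto simp: frame)
    have jl: "j < length vs" using 1(2) E len by (simp add: j_def fr)
    have u: "nat_mem s ''v'' (nat_mem s ''E'' 0 0) (nat_mem s' ''j'' 0 0) = u"
      using nth[OF jl] E by (simp add: u_def j_def)
    have tk: "take (Suc j) vs = take j vs @ [u]" using jl by (simp add: u_def take_Suc_conv_app_nth)
    have "distinct (take (Suc j) vs)" using dist by (simp add: vs_def)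
    then have nt: "u \<notin> set (take j vs)" by (simp add: tk)
    have uk: "\<kappa> E u = Some (nat_mem s ''k'' E 0 + nat_mem s ''d'' E u)"
      using keys jl by (simp add: vs_def u_def)
    have bk': "buckets (nat_mem s' ''q'' 0 0) (nat_mem s' ''B'') (nat_mem s' ''C'') (nat_mem s' ''A'') (nat_mem s' ''p'')
        (\<lambda>e u. if e = E \<and> u \<in> set (take j vs) then None else \<kappa> e u)" (is "buckets _ _ _ _ _ ?\<kappa>")
      using J(2) by (simp add: bucketed_def)
    have "?\<kappa> E u = Some (nat_mem s ''k'' E 0 + nat_mem s ''d'' E u)" using uk nt by simp
    note bk2 = buckets_delete[OF bk' this refl refl refl]
    have keq: "?\<kappa>(E := (?\<kappa> E)(u := None)) =
        (\<lambda>e u. if e = E \<and> u \<in> set (take (Suc j) vs) then None else \<kappa> e u)"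
      by (auto simp: fun_eq_iff tk)
    show ?case
      using J bk2[unfolded keq] jl nt
      by (simp add: wp_simps write_cell_simps fr u)
        (auto simp: J_def Let_def agree_def eq_off_write scratch_def bucketed_def write_cell_simps stack_def
          E[symmetric] u j_def[symmetric] tk fun_upd_def map_push)
  next
    case 2
    have "bucketed s (\<lambda>e u. \<kappa> e u)" using bk by simp
    then show ?case
      by (simp add: J_def framed write_cell_simps scratch_def bucketed_def stack_def)
  next
    case (3 t s')
    then have *: "J s'" "\<not> nat_mem s' ''j'' 0 0 < nat_mem s' ''g'' (nat_mem s' ''E'' 0 0) 0" by auto
    then have "agree scratch {''W''} s s'" by (simp add: J_def Let_def)
    then have "nat_mem s' ''E'' = nat_mem s ''E''" "nat_mem s' ''g'' = nat_mem s ''g''"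
      by (auto simp: frame)
    then have "nat_mem s' ''j'' 0 0 = length vs" using * E len by (auto simp: J_def Let_def)
    then show ?case using *(1) 3(1) by (simp add: J_def Let_def vs_def write_cell_simps)
  qed
qed

lemma wp_add_edge:
  assumes bk: "bucketed s \<kappa>" and E: "E = nat_mem s ''E'' 0 0" and dist: "distinct (ends s E)"
    and keys: "\<And>u. u \<in> set (ends s E) \<Longrightarrow> \<kappa> E u = None"
  shows "wp add_edge (\<lambda>t s'. t \<le> 250 * (length (ends s E) + 1) \<and> agree scratch {''W''} s s' \<and>
     bucketed s' (\<lambda>e u. if e = E \<and> u \<in> set (ends s E) then Some (nat_mem s ''k'' E 0 + nat_mem s ''d'' E u) else \<kappa> e u) \<and>
     stack s' = stack s @ ends s E \<and>
     (\<forall>u. real_mem s' ''W'' u 0 = real_mem s ''W'' u 0 + (if u \<in> set (ends s E) then real_mem s ''x'' E 0 else 0))) s"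
proof -
  define vs where "vs = ends s E"
  define J where "J s' \<longleftrightarrow> (let j = nat_mem s' ''j'' 0 0 in j \<le> length vs \<and> agree scratch {''W''} s s' \<and>
     bucketed s' (\<lambda>e u. if e = E \<and> u \<in> set (take j vs) then Some (nat_mem s ''k'' E 0 + nat_mem s ''d'' E u) else \<kappa> e u) \<and>
     stack s' = stack s @ take j vs \<and>
     (\<forall>u. real_mem s' ''W'' u 0 = real_mem s ''W'' u 0 + (if u \<in> set (take j vs) then real_mem s ''x'' E 0 else 0)))" for s'
  have len: "length vs = nat_mem s ''g'' E 0" by (simp add: vs_def ends_def)
  have nth: "vs ! j = nat_mem s ''v'' E j" if "j < length vs" for j
    using that by (simp add: vs_def ends_def)
  show ?thesis
    unfolding add_edge_def wp_simps
  proof (rule wp_while[where J = J and K = 200 and M = "\<lambda>s'. length vs - nat_mem s' ''j'' 0 0"], goal_cases)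
    case (1 s')
    define j where "j = nat_mem s' ''j'' 0 0"
    define u where "u = vs ! j"
    note ag = agreeD[of scratch "{''W''}" s s']
    have J: "agree scratch {''W''} s s'"
      "bucketed s' (\<lambda>e u. if e = E \<and> u \<in> set (take j vs) then Some (nat_mem s ''k'' E 0 + nat_mem s ''d'' E u) else \<kappa> e u)"
      "stack s' = stack s @ take j vs"
      "\<And>u. real_mem s' ''W'' u 0 = real_mem s ''W'' u 0 + (if u \<in> set (take j vs) then real_mem s ''x'' E 0 else 0)"
      using 1(1) by (auto simp: J_def j_def Let_def)
    have fr: "nat_mem s' ''E'' = nat_mem s ''E''" "nat_mem s' ''g'' = nat_mem s ''g''"
      "nat_mem s' ''v'' = nat_mem s ''v''" "nat_mem s' ''k'' = nat_mem s ''k''"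
      "nat_mem s' ''d'' = nat_mem s ''d''" "real_mem s' ''x'' = real_mem s ''x''"
      using J(1) by (auto simp: frame)
    have jl: "j < length vs" using 1(2) E len by (simp add: j_def fr)
    have u: "nat_mem s ''v'' (nat_mem s ''E'' 0 0) (nat_mem s' ''j'' 0 0) = u"
      "nat_mem s ''v'' E (nat_mem s' ''j'' 0 0) = u"
      using nth[OF jl] E by (simp_all add: u_def j_def)
    have tk: "take (Suc j) vs = take j vs @ [u]" using jl by (simp add: u_def take_Suc_conv_app_nth)
    have "distinct (take (Suc j) vs)" using dist by (simp add: vs_def)
    then have nt: "u \<notin> set (take j vs)" by (simp add: tk)
    have uk: "\<kappa> E u = None"
      using keys jl by (simp add: vs_def u_def)
    have bk': "buckets (nat_mem s' ''q'' 0 0) (nat_mem s' ''B'') (nat_mem s' ''C'') (nat_mem s' ''A'') (nat_mem s' ''p'')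
        (\<lambda>e u. if e = E \<and> u \<in> set (take j vs) then Some (nat_mem s ''k'' E 0 + nat_mem s ''d'' E u) else \<kappa> e u)" (is "buckets _ _ _ _ _ ?\<kappa>")
      using J(2) by (simp add: bucketed_def)
    let ?t = "nat_mem s ''k'' E 0 + nat_mem s ''d'' E u"
    have un: "?\<kappa> E u = None" using uk nt by simp
    have keq: "?\<kappa>(E := (?\<kappa> E)(u := Some ?t)) =
        (\<lambda>e u. if e = E \<and> u \<in> set (take (Suc j) vs) then Some (nat_mem s ''k'' E 0 + nat_mem s ''d'' E u) else \<kappa> e u)"
      by (auto simp: fun_eq_iff tk)
    show ?case
    proof (cases "nat_mem s' ''B'' u ?t = 0")
      case True
      note bk2 = buckets_insert[OF buckets_allocate[OF bk' True] un, where b = "Suc (nat_mem s' ''q'' 0 0)" and t = ?t, OF _ _ refl]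
      show ?thesis
        using J bk2[unfolded keq] jl nt True
        by (simp add: wp_simps write_cell_simps fr u E[symmetric])
          (auto simp: J_def Let_def agree_def eq_off_write scratch_def bucketed_def write_cell_simps stack_def
            E[symmetric] u j_def[symmetric] tk fun_upd_def map_push)
    next
      case False
      note bk2 = buckets_insert[OF bk' un refl False refl]
      show ?thesis
        using J bk2[unfolded keq] jl nt False
        by (simp add: wp_simps write_cell_simps fr u E[symmetric])
          (auto simp: J_def Let_def agree_def eq_off_write scratch_def bucketed_def write_cell_simps stack_def
            E[symmetric] u j_def[symmetric] tk fun_upd_def map_push)
    qed
  next
    case 2
    have "bucketed s (\<lambda>e u. \<kappa> e u)" using bk by simp
    then show ?case
      by (simp add: J_def framed write_cell_simps scratch_def bucketed_def stack_def)
  next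
    case (3 t s')
    then have *: "J s'" "\<not> nat_mem s' ''j'' 0 0 < nat_mem s' ''g'' (nat_mem s' ''E'' 0 0) 0" by auto
    then have "agree scratch {''W''} s s'" by (simp add: J_def Let_def)
    then have "nat_mem s' ''E'' = nat_mem s ''E''" "nat_mem s' ''g'' = nat_mem s ''g''"
      by (auto simp: frame)
    then have "nat_mem s' ''j'' 0 0 = length vs" using * E len by (auto simp: J_def Let_def)
    then show ?case using *(1) 3(1) by (simp add: J_def Let_def vs_def write_cell_simps)
  qed
qed

section \<open>Moving an edge to another level\<close>

abbreviation reinsert :: "nexp \<Rightarrow> rexp \<Rightarrow> com" where
  "reinsert ke xe \<equiv> remove_edge;; NAssign ''k'' (var ''E'') (NConst 0) ke;;
     RAssign ''x'' (var ''E'') (NConst 0) xe;; add_edge"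

text \<open>The bucket is copied to \<open>T\<close> because the sweep refiles its edges and would
  permute the bucket while it is being read.\<close>

definition collect_tight :: com where
  "collect_tight = ''b'' ::= NCell ''B'' (var ''w'') (cell ''i'' (var ''w''));;
   ''N'' ::= cell ''C'' (var ''b'');; ''y'' ::= NConst 0;;
   While (NLess (var ''y'') (var ''N''))
     (NAssign ''T'' (var ''y'') (NConst 0) (NCell ''A'' (var ''b'') (var ''y''));; incr ''y'' (NConst 0))"

definition sweep :: "com \<Rightarrow> com" where
  "sweep P = ''y'' ::= NConst 0;;
   While (NLess (var ''y'') (var ''N'')) (''E'' ::= cell ''T'' (var ''y'');; P;; incr ''y'' (NConst 0))"

definition raise_edge :: com where
  "raise_edge = reinsert (NAdd (cell ''k'' (var ''E'')) (NConst 1)) (RDiv (rcell ''x'' (var ''E'')) (rvar ''be''))"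

abbreviation may_lower :: bexp where
  "may_lower \<equiv> Conj (NLess (NConst 0) (var ''o'')) (NLess (NConst 0) (cell ''k'' (var ''E'')))"

text \<open>Runs after the level of the moving node has been decremented, so one strict comparison
  for all endpoints tests whether another endpoint still holds the edge at its level.\<close>

definition lower_edge :: com where
  "lower_edge = ''o'' ::= NConst 1;; ''j'' ::= NConst 0;;
   While (NLess (var ''j'') (cell ''g'' (var ''E'')))
     (''u'' ::= NCell ''v'' (var ''E'') (var ''j'');;
      Cond (NLess (cell ''i'' (var ''u'')) key) Skip (''o'' ::= NConst 0);;
      incr ''j'' (NConst 0));;
   Cond may_lower
     (reinsert (NSub (cell ''k'' (var ''E'')) (NConst 1)) (RMul (rcell ''x'' (var ''E'')) (rvar ''be''))) Skip"

definition raise_node :: com where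
  "raise_node = collect_tight;; incr ''i'' (var ''w'');; sweep raise_edge"

definition lower_node :: com where
  "lower_node = collect_tight;; decr ''i'' (var ''w'');; sweep lower_edge"

abbreviation edge_levels :: "memory \<Rightarrow> nat \<Rightarrow> nat" where
  "edge_levels s \<equiv> \<lambda>e. nat_mem s ''k'' e 0"
abbreviation node_levels :: "memory \<Rightarrow> nat \<Rightarrow> nat" where
  "node_levels s \<equiv> \<lambda>v. nat_mem s ''i'' v 0"
abbreviation offsets :: "memory \<Rightarrow> nat \<Rightarrow> nat \<Rightarrow> nat" where
  "offsets s \<equiv> nat_mem s ''d''"

definition bucket_keys :: "graph \<Rightarrow> memory \<Rightarrow> nat \<Rightarrow> nat \<Rightarrow> nat option" where
  "bucket_keys G s = (\<lambda>e u. if e \<in> edges_at G u then Some (edge_levels s e + offsets s e u) else None)"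

context level_scheme
begin

text \<open>Only the data derived from the edge levels: weights, loads and buckets. The relation
  between edge and node levels is kept apart in \<open>levels_ok\<close>, because it is broken while
  a sweep is under way.\<close>

definition represents :: "graph \<Rightarrow> memory \<Rightarrow> bool" where
  "represents G s \<longleftrightarrow> graph_ok G \<and>
     (\<forall>e\<in>dom G. distinct (ends s e) \<and> set (ends s e) = the (G e)) \<and>
     (\<forall>e\<in>dom G. real_mem s ''x'' e 0 = xval G (edge_levels s) e) \<and>
     (\<forall>v. real_mem s ''W'' v 0 = load G (edge_levels s) v) \<and>
     bucketed s (bucket_keys G s)"

lemma represents_agree:
  assumes "represents G s" "agree N R s s'"
    "N \<inter> {''v'', ''g'', ''k'', ''d'', ''q'', ''B'', ''C'', ''A'', ''p''} = {}" "R \<inter> {''x'', ''W''} = {}"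
  shows "represents G s'"
proof -
  have "nat_mem s' a = nat_mem s a" if "a \<in> {''v'', ''g'', ''k'', ''d'', ''q'', ''B'', ''C'', ''A'', ''p''}" for a
    using agreeD(1)[OF assms(2)] assms(3) that by blast
  moreover have "real_mem s' a = real_mem s a" if "a \<in> {''x'', ''W''}" for a
    using agreeD(2)[OF assms(2)] assms(4) that by blast
  ultimately show ?thesis
    using assms(1) by (simp add: represents_def ends_def bucketed_def bucket_keys_def cong: if_cong)
qed

lemma ends_length:
  assumes "represents G s" "e \<in> dom G"
  shows "length (ends s e) \<le> f"
  using assms graph_okD(3)[of G e] distinct_card[of "ends s e"] by (auto simp: represents_def)

text \<open>Both loads are compared with those of the graph without \<open>e\<close>, which do not
  depend on \<open>k e\<close>.\<close>

lemma load_change: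
  assumes G: "graph_ok G" and e: "e \<in> dom G"
  shows "load G (k(e := a)) v =
    load G k v + (if v \<in> the (G e) then base G e / beta ^ a - xval G k e else 0)"
proof -
  have "load (G(e := None)) (k(e := a)) v = load (G(e := None)) k v"
    unfolding load_def by (intro sum.cong) (auto simp: edges_at_def xval_def)
  then show ?thesis
    using load_delete[OF G e, of k v] load_delete[OF G e, of "k(e := a)" v]
    by (auto simp: xval_def split: if_splits)
qed

text \<open>The expressions \<open>ke\<close> and \<open>xe\<close> are evaluated after the edge has
  been taken out, the second even after its level was overwritten; hence they are assumed to have
  their values in every state that agrees with \<open>s\<close> up to those writes. Each half pushes
  all endpoints, so they appear twice.\<close>

lemma wp_reinsert:
  assumes rep: "represents G s" and e: "e = nat_mem s ''E'' 0 0" "e \<in> dom G"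
    and ke: "\<And>s'. agree scratch {''W''} s s' \<Longrightarrow> nval ke s' = a"
    and xe: "\<And>s'. agree (insert ''k'' scratch) {''W''} s s' \<Longrightarrow> rval xe s' = base G e / beta ^ a"
    and cost: "ncost ke \<le> 20" "rcost xe \<le> 20"
  shows "wp (reinsert ke xe) (\<lambda>t s'. t \<le> 600 * (f + 1) \<and> represents G s' \<and>
     agree (insert ''k'' scratch) {''W'', ''x''} s s' \<and> edge_levels s' = (edge_levels s)(e := a) \<and>
     stack s' = stack s @ ends s e @ ends s e) s"
proof -
  have G: "graph_ok G" and en: "distinct (ends s e)" "set (ends s e) = the (G e)"
    using rep e by (auto simp: represents_def)
  have bk: "bucketed s (bucket_keys G s)" using rep by (simp add: represents_def)
  have key: "bucket_keys G s e u = Some (edge_levels s e + offsets s e u)" if "u \<in> set (ends s e)" for u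
    using that e en by (auto simp: bucket_keys_def edges_at_def)
  have len: "length (ends s e) \<le> f" using ends_length[OF rep e(2)] .
  show ?thesis
    unfolding wp_simps
  proof (rule wp_mono[OF wp_remove_edge[OF bk e(1) en(1) key]], goal_cases)
    case (2 t1 s1)
    then have t1: "t1 \<le> 250 * (length (ends s e) + 1)" and ag1: "agree scratch {''W''} s s1"
      and bk1: "bucketed s1 (\<lambda>e' u. if e' = e \<and> u \<in> set (ends s e) then None else bucket_keys G s e' u)"
      and st1: "stack s1 = stack s @ ends s e"
      and W1: "\<And>u. real_mem s1 ''W'' u 0 = real_mem s ''W'' u 0 - (if u \<in> set (ends s e) then real_mem s ''x'' e 0 else 0)"
      by auto
    define s2 where "s2 = s1\<lparr>nat_mem := write_cell ''k'' e 0 a (nat_mem s1)\<rparr>"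
    define s3 where "s3 = s2\<lparr>real_mem := write_cell ''x'' e 0 (base G e / beta ^ a) (real_mem s2)\<rparr>"
    have E1: "nat_mem s1 ''E'' 0 0 = e" using agreeD(1)[OF ag1, of "''E''"] e by (simp add: scratch_def)
    have ag2: "agree (insert ''k'' scratch) {''W''} s s2"
      using agree_mono[OF ag1, of "insert ''k'' scratch" "{''W''}"]
      by (auto simp: s2_def agree_def eq_off_write)
    have s2': "nat_assigned ''k'' (var ''E'') (NConst 0) ke s1 = s2"
      using ke[OF ag1] E1 by (simp add: s2_def)
    have s3': "s2\<lparr>real_mem := write_cell ''x'' (nval (var ''E'') s2) (nval (NConst 0) s2) (rval xe s2) (real_mem s2)\<rparr> = s3"
      using xe[OF ag2] E1 by (simp add: s3_def s2_def write_cell_simps)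
    have E3: "e = nat_mem s3 ''E'' 0 0" using E1 by (simp add: s3_def s2_def write_cell_simps)
    have ends3: "ends s3 e' = ends s e'" for e'
      using agreeD(1)[OF ag1, of "''v''"] agreeD(1)[OF ag1, of "''g''"]
      by (simp add: ends_def s3_def s2_def write_cell_simps scratch_def)
    have bk3: "bucketed s3 (\<lambda>e' u. if e' = e \<and> u \<in> set (ends s e) then None else bucket_keys G s e' u)"
      using bk1 by (simp add: bucketed_def s3_def s2_def write_cell_simps)
    have "wp add_edge (\<lambda>t4 s'. 1 + t1 + (1 + (1 + ncost (var ''E'') + ncost (NConst 0) + ncost ke) + 
       (1 + (1 + ncost (var ''E'') + ncost (NConst 0) + rcost xe) + t4)) \<le> 600 * (f + 1) \<and> represents G s' \<and>
     agree (insert ''k'' scratch) {''W'', ''x''} s s' \<and> edge_levels s' = (edge_levels s)(e := a) \<and>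
     stack s' = stack s @ ends s e @ ends s e) s3"
    proof (rule wp_mono[OF wp_add_edge[OF bk3 E3]], goal_cases)
      case 1
      then show ?case using ends3 en by simp
    next
      case (2 u)
      then show ?case using ends3 by simp
    next
      case (3 t4 s4)
      have ag3: "agree (insert ''k'' scratch) {''W'', ''x''} s s3"
        using agree_mono[OF ag2, of "insert ''k'' scratch" "{''W'', ''x''}"]
        by (auto simp: s3_def agree_def eq_off_write)
      have ag34: "agree scratch {''W''} s3 s4" using 3 by simp
      then have "agree (insert ''k'' scratch) {''W'', ''x''} s3 s4" by (rule agree_mono) auto
      with ag3 have ag4: "agree (insert ''k'' scratch) {''W'', ''x''} s s4" by (rule agree_trans)
      have k4: "nat_mem s4 ''k'' = nat_mem s3 ''k''" "real_mem s4 ''x'' = real_mem s3 ''x''"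
        using ag34 by (auto simp: frame)
      have k1: "nat_mem s1 ''k'' = nat_mem s ''k''" "real_mem s1 ''x'' = real_mem s ''x''"
        using ag1 by (auto simp: frame)
      have fr: "nat_mem s4 ''d'' = nat_mem s ''d''" "nat_mem s4 ''v'' = nat_mem s ''v''" "nat_mem s4 ''g'' = nat_mem s ''g''"
        "nat_mem s3 ''d'' = nat_mem s ''d''"
        using ag4 ag3 by (auto simp: frame)
      have lev: "edge_levels s4 = (edge_levels s)(e := a)"
        by (auto simp: k4 s3_def s2_def write_cell_simps k1)
      have lev': "nat_mem s4 ''k'' e' 0 = (if e' = e then a else nat_mem s ''k'' e' 0)" for e'
        using fun_cong[OF lev, of e'] by simp
      have k3: "nat_mem s3 ''k'' e 0 = a" by (simp add: s3_def s2_def write_cell_simps)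
      have ends4: "ends s4 = ends s" by (auto simp: ends_def fr)
      have "bucketed s4 (bucket_keys G s4)"
      proof -
        have "(\<lambda>e' u. if e' = e \<and> u \<in> set (ends s3 e) then Some (nat_mem s3 ''k'' e 0 + nat_mem s3 ''d'' e u)
            else if e' = e \<and> u \<in> set (ends s e) then None else bucket_keys G s e' u) = bucket_keys G s4"
        proof (intro ext)
          fix e' u
          show "(if e' = e \<and> u \<in> set (ends s3 e) then Some (nat_mem s3 ''k'' e 0 + nat_mem s3 ''d'' e u)
            else if e' = e \<and> u \<in> set (ends s e) then None else bucket_keys G s e' u) = bucket_keys G s4 e' u"
            using e(2) en(2) by (cases "e' = e") (simp_all add: bucket_keys_def lev' fr ends3 k3 edges_at_def)
        qed
        then show ?thesis using 3 by simp
      qed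
      moreover have "real_mem s4 ''W'' v 0 = load G (edge_levels s4) v" for v
      proof -
        have "real_mem s4 ''W'' v 0 = real_mem s3 ''W'' v 0 + (if v \<in> set (ends s3 e) then real_mem s3 ''x'' e 0 else 0)"
          using 3 by simp
        also have "real_mem s3 ''W'' = real_mem s1 ''W''" by (simp add: s3_def s2_def write_cell_simps)
        also have "real_mem s3 ''x'' e 0 = base G e / beta ^ a" by (simp add: s3_def write_cell_simps)
        finally show ?thesis
          using rep e unfolding lev load_change[OF G e(2)] W1 ends3 en
          by (simp add: represents_def)
      qed
      moreover have "real_mem s4 ''x'' e' 0 = xval G (edge_levels s4) e'" if "e' \<in> dom G" for e'
        using that rep unfolding lev k4
        by (auto simp: s3_def s2_def write_cell_simps xval_def represents_def k1)
      ultimately have "represents G s4"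
        using rep by (simp add: represents_def ends4)
      moreover have "stack s4 = stack s @ ends s e @ ends s e"
      proof -
        have "stack s3 = stack s1" by (simp add: stack_def s3_def s2_def write_cell_simps)
        then show ?thesis using 3 st1 by (simp add: ends3)
      qed
      moreover have "t4 \<le> 250 * (length (ends s e) + 1)" using 3 ends3 by simp
      ultimately show ?case using ag4 lev t1 len cost by simp
    qed
    then show ?case unfolding s2' s3' .
  qed
qed

text \<open>Being tight at \<open>w\<close> means being filed there under the key
  \<open>i w\<close>. Positions are inverse to entries, so the bucket lists each such edge
  once.\<close>

lemma wp_collect_tight:
  assumes rep: "represents G s" and w: "w = nat_mem s ''w'' 0 0" and i: "i = node_levels s"
  shows "wp collect_tight (\<lambda>t s'. t \<le> 100 * (card (tight G (offsets s) (edge_levels s) i w) + 1) \<and>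
     agree {''b'', ''N'', ''y'', ''T''} {} s s' \<and>
     (\<exists>ts. length ts = nat_mem s' ''N'' 0 0 \<and> (\<forall>j<length ts. nat_mem s' ''T'' j 0 = ts ! j) \<and>
        distinct ts \<and> set ts = tight G (offsets s) (edge_levels s) i w)) s"
proof -
  define b where "b = nat_mem s ''B'' w (i w)"
  define ts where "ts = map (nat_mem s ''A'' b) [0..<nat_mem s ''C'' b 0]"
  have bk: "buckets (nat_mem s ''q'' 0 0) (nat_mem s ''B'') (nat_mem s ''C'') (nat_mem s ''A'') (nat_mem s ''p'') (bucket_keys G s)"
    using rep by (simp add: represents_def bucketed_def)
  note D = bucketsD[OF bk]
  have "inj_on (nat_mem s ''A'' b) {..<nat_mem s ''C'' b 0}"
    using D(9)[of _ w "i w"] by (intro inj_on_inverseI[where g = "\<lambda>e. nat_mem s ''p'' e w"]) (simp add: b_def)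
  then have dist: "distinct ts" by (simp add: ts_def distinct_map atLeast0LessThan)
  have set: "set ts = tight G (offsets s) (edge_levels s) i w"
  proof (intro equalityI subsetI)
    fix e assume "e \<in> set ts"
    then obtain j where "j < nat_mem s ''C'' b 0" "e = nat_mem s ''A'' b j" by (auto simp: ts_def)
    then have "bucket_keys G s e w = Some (i w)" using D(8)[of j w "i w"] by (simp add: b_def)
    then show "e \<in> tight G (offsets s) (edge_levels s) i w"
      by (auto simp: bucket_keys_def tight_def split: if_splits)
  next
    fix e assume "e \<in> tight G (offsets s) (edge_levels s) i w"
    then have "bucket_keys G s e w = Some (i w)" by (auto simp: bucket_keys_def tight_def)
    then show "e \<in> set ts" using D(5,6)[of e w "i w"] by (auto simp: ts_def b_def[symmetric] image_iff intro!: bexI)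
  qed
  have len: "length ts = nat_mem s ''C'' b 0" by (simp add: ts_def)
  have card: "card (tight G (offsets s) (edge_levels s) i w) = length ts"
    using distinct_card[OF dist] set by simp
  define J where "J s' \<longleftrightarrow> (let y = nat_mem s' ''y'' 0 0 in y \<le> length ts \<and> agree {''b'', ''N'', ''y'', ''T''} {} s s' \<and>
     nat_mem s' ''b'' 0 0 = b \<and> nat_mem s' ''N'' 0 0 = length ts \<and> (\<forall>j<y. nat_mem s' ''T'' j 0 = ts ! j))" for s'
  show ?thesis
    unfolding collect_tight_def wp_simps
  proof (rule wp_while[where J = J and K = 50 and M = "\<lambda>s'. length ts - nat_mem s' ''y'' 0 0"], goal_cases)
    case (1 s')
    then have J: "agree {''b'', ''N'', ''y'', ''T''} {} s s'" by (simp add: J_def Let_def)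
    then have A: "nat_mem s' ''A'' = nat_mem s ''A''" by (simp add: frame)
    show ?case
      using 1 A J by (auto simp: J_def wp_simps Let_def write_cell_simps agree_def eq_off_write ts_def less_Suc_eq)
  next
    case 2
    then show ?case
      using w i len by (simp add: J_def write_cell_simps framed b_def)
  next
    case (3 t s')
    then have "nat_mem s' ''y'' 0 0 = length ts" by (auto simp: J_def Let_def)
    then show ?case using 3 dist set card
      by (auto simp: J_def Let_def write_cell_simps)
  qed
qed

end

section \<open>Moving a node to another level\<close>

context level_scheme
begin

definition configured :: "memory \<Rightarrow> bool" where
  "configured s \<longleftrightarrow> real_mem s ''be'' 0 0 = beta \<and> real_mem s ''la'' 0 0 = lam \<and>
     real_mem s ''mu'' 0 0 = mu \<and> (\<forall>v<n. real_mem s ''c'' v 0 = c v) \<and> nat_mem s ''L'' 0 0 = L"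

lemma configured_agree:
  assumes "configured s" "agree N R s s'" "''L'' \<notin> N" "R \<inter> {''be'', ''la'', ''mu'', ''c''} = {}"
  shows "configured s'"
proof -
  have "real_mem s' a = real_mem s a" if "a \<in> {''be'', ''la'', ''mu'', ''c''}" for a
    using agreeD(2)[OF assms(2)] assms(4) that by blast
  then show ?thesis using assms(1) agreeD(1)[OF assms(2,3)] by (simp add: configured_def)
qed

lemma wp_raise_edge:
  assumes rep: "represents G s" and e: "e = nat_mem s ''E'' 0 0" "e \<in> dom G" and cf: "configured s"
  shows "wp raise_edge (\<lambda>t s'. t \<le> 600 * (f + 1) \<and> represents G s' \<and>
     agree (insert ''k'' scratch) {''W'', ''x''} s s' \<and> edge_levels s' = (edge_levels s)(e := edge_levels s e + 1) \<and>
     stack s' = stack s @ ends s e @ ends s e) s"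
  unfolding raise_edge_def
proof (rule wp_reinsert[OF rep e], goal_cases)
  case (1 s')
  then have "nat_mem s' ''k'' = nat_mem s ''k''" "nat_mem s' ''E'' = nat_mem s ''E''"
    by (auto simp: frame)
  then show ?case using e by simp
next
  case (2 s')
  then have "real_mem s' ''x'' = real_mem s ''x''" "real_mem s' ''be'' = real_mem s ''be''"
    "nat_mem s' ''E'' = nat_mem s ''E''"
    by (auto simp: frame)
  then show ?case using e rep cf
    by (simp add: represents_def configured_def xval_def flip: e(1))
qed auto

text \<open>The flag \<open>o\<close> records whether all endpoints seen so far lie strictly below
  the edge. At level 0 the edge stays in any case: truncated subtraction would leave the level at 0
  while the weight was multiplied by \<open>beta\<close>.\<close>

lemma wp_lower_edge:
  assumes rep: "represents G s" and e: "e = nat_mem s ''E'' 0 0" "e \<in> dom G" and cf: "configured s"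
  defines "free \<equiv> 0 < edge_levels s e \<and> (\<forall>u\<in>the (G e). node_levels s u < edge_levels s e + offsets s e u)"
  shows "wp lower_edge (\<lambda>t s'. t \<le> 800 * (f + 1) \<and> represents G s' \<and>
     agree (insert ''o'' (insert ''k'' scratch)) {''W'', ''x''} s s' \<and>
     edge_levels s' = (edge_levels s)(e := if free then edge_levels s e - 1 else edge_levels s e) \<and>
     (if free then stack s' = stack s @ ends s e @ ends s e else stack s' = stack s)) s"
proof -
  define vs where "vs = ends s e"
  have en: "set vs = the (G e)" using rep e by (auto simp: represents_def vs_def)
  have len: "length vs = nat_mem s ''g'' e 0" by (simp add: vs_def ends_def)
  have lenf: "length vs \<le> f" using ends_length[OF rep e(2)] by (simp add: vs_def)
  have nth: "vs ! j = nat_mem s ''v'' e j" if "j < length vs" for j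
    using that by (simp add: vs_def ends_def)
  define J where "J s' \<longleftrightarrow> (let j = nat_mem s' ''j'' 0 0 in j \<le> length vs \<and> agree {''j'', ''u'', ''o''} {} s s' \<and>
     nat_mem s' ''o'' 0 0 = (if \<forall>u\<in>set (take j vs). node_levels s u < edge_levels s e + offsets s e u then 1 else 0))" for s'
  show ?thesis
    unfolding lower_edge_def wp_simps(2,4)
  proof (rule wp_while[where J = J and K = 100 and M = "\<lambda>s'. length vs - nat_mem s' ''j'' 0 0"], goal_cases)
    case (1 s')
    define j where "j = nat_mem s' ''j'' 0 0"
    have J: "agree {''j'', ''u'', ''o''} {} s s'" using 1 by (simp add: J_def Let_def)
    then have fr: "nat_mem s' ''E'' = nat_mem s ''E''" "nat_mem s' ''g'' = nat_mem s ''g''"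
      "nat_mem s' ''v'' = nat_mem s ''v''" "nat_mem s' ''k'' = nat_mem s ''k''"
      "nat_mem s' ''d'' = nat_mem s ''d''" "nat_mem s' ''i'' = nat_mem s ''i''"
      by (auto simp: frame)
    have jl: "j < length vs" using 1(2) e(1) len by (simp add: j_def fr)
    define u where "u = vs ! j"
    have u: "nat_mem s ''v'' e (nat_mem s' ''j'' 0 0) = u" "nat_mem s ''v'' e j = u"
      using nth[OF jl] by (simp_all add: u_def j_def)
    have tk: "take (Suc j) vs = take j vs @ [u]" using jl by (simp add: u_def take_Suc_conv_app_nth)
    show ?case
      using 1(1) jl J
      by (auto simp: J_def wp_simps Let_def write_cell_simps fr u e(1)[symmetric] j_def[symmetric] tk agree_def eq_off_write)
  next
    case 2
    then show ?case by (simp add: J_def write_cell_simps framed)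
  next
    case (3 t s')
    have J: "agree {''j'', ''u'', ''o''} {} s s'" using 3 by (simp add: J_def Let_def)
    then have fr: "nat_mem s' ''E'' = nat_mem s ''E''" "nat_mem s' ''g'' = nat_mem s ''g''"
      "nat_mem s' ''k'' = nat_mem s ''k''" "nat_mem s' ''S'' = nat_mem s ''S''" "nat_mem s' ''h'' = nat_mem s ''h''"
      "nat_mem s' ''v'' = nat_mem s ''v''"
      by (auto simp: frame)
    have "nat_mem s' ''j'' 0 0 = length vs" using 3 e(1) len by (auto simp: J_def Let_def fr)
    then have o: "nat_mem s' ''o'' 0 0 = (if \<forall>u\<in>the (G e). node_levels s u < edge_levels s e + offsets s e u then 1 else 0)"
      using 3 en by (simp add: J_def Let_def)
    have rep': "represents G s'" by (rule represents_agree[OF rep J]) auto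
    have cf': "configured s'" by (rule configured_agree[OF cf J]) auto
    have e': "e = nat_mem s' ''E'' 0 0" using e(1) fr by simp
    have st: "stack s' = stack s" "ends s' e = ends s e" by (auto simp: stack_def ends_def fr)
    have bt: "bval may_lower s' \<longleftrightarrow> free"
      using o e' fr by (simp add: free_def)
    have tt: "t \<le> f * 110 + 20"
    proof -
      have "length vs * 109 \<le> f * 109" using lenf by simp
      then show ?thesis using 3(1) by (simp add: write_cell_simps)
    qed
    have ag: "agree (insert ''o'' (insert ''k'' scratch)) {''W'', ''x''} s s'"
      by (rule agree_mono[OF J]) (auto simp: scratch_def)
    show ?case
    proof (cases free)
      case True
      then have k0: "0 < edge_levels s e" by (simp add: free_def)
      have "wp (reinsert (NSub (cell ''k'' (var ''E'')) (NConst 1)) (RMul (rcell ''x'' (var ''E'')) (rvar ''be'')))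
        (\<lambda>t s''. t \<le> 600 * (f + 1) \<and> represents G s'' \<and>
        agree (insert ''k'' scratch) {''W'', ''x''} s' s'' \<and> edge_levels s'' = (edge_levels s')(e := edge_levels s e - 1) \<and>
        stack s'' = stack s' @ ends s' e @ ends s' e) s'"
      proof (rule wp_reinsert[OF rep' e' e(2)], goal_cases)
        case (1 s'')
        then have "nat_mem s'' ''k'' = nat_mem s' ''k''" "nat_mem s'' ''E'' = nat_mem s' ''E''"
          by (auto simp: frame)
        then show ?case using e' fr by simp
      next
        case (2 s'')
        then have 3: "real_mem s'' ''x'' = real_mem s' ''x''" "real_mem s'' ''be'' = real_mem s' ''be''"
          "nat_mem s'' ''E'' = nat_mem s' ''E''"
          by (auto simp: frame)
        obtain k where k: "edge_levels s e = Suc k" using k0 by (cases "edge_levels s e") auto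
        have "real_mem s' ''x'' e 0 = base G e / beta ^ Suc k" "real_mem s' ''be'' 0 0 = beta"
          using rep' cf' e(2) k by (auto simp: represents_def configured_def xval_def fr)
        then show ?case using 3 beta_pos k by (simp flip: e')
      qed auto
      then show ?thesis
        unfolding wp_simps(5) if_P[OF iffD2[OF bt True]]
      proof (rule wp_mono, goal_cases)
        case (1 t' s'')
        have ag': "agree (insert ''o'' (insert ''k'' scratch)) {''W'', ''x''} s' s''"
          by (rule agree_mono[of "insert ''k'' scratch" "{''W'', ''x''}"]) (use 1 in auto)
        show ?case using 1 True tt agree_trans[OF ag ag'] by (simp add: st fr)
      qed
    next
      case False
      then have nb: "\<not> bval may_lower s'"
        using bt by blast
      show ?thesis
        unfolding wp_simps(5) if_not_P[OF nb] wp_simps(1)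
        using rep' ag st tt False by (simp add: fr fun_eq_iff)
    qed
  qed
qed

text \<open>The last conjunct is restricted to edges whose level really changes, as
  \<open>lower_edge\<close> pushes nothing for an edge that stays.\<close>

abbreviation pushes :: "graph \<Rightarrow> memory \<Rightarrow> memory \<Rightarrow> nat \<Rightarrow> nat set \<Rightarrow> (nat \<Rightarrow> nat) \<Rightarrow> bool" where
  "pushes G s s' b T k \<equiv> (\<exists>ys. stack s' = stack s @ ys \<and> length ys \<le> b \<and> set ys \<subseteq> {..<n} \<and>
     (\<forall>e\<in>T. k e \<noteq> edge_levels s e \<longrightarrow> the (G e) \<subseteq> set ys))"

text \<open>The edges in \<open>ts\<close> are distinct, so an edge still has its original level
  when its turn comes; the body may assume this.\<close>

lemma wp_sweep:
  assumes rep: "represents G s" and N: "length ts = nat_mem s ''N'' 0 0"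
    and T: "\<forall>j<length ts. nat_mem s ''T'' j 0 = ts ! j" and dist: "distinct ts"
    and body: "\<And>s1 e. represents G s1 \<Longrightarrow> agree swept {''W'', ''x''} s s1 \<Longrightarrow> e = nat_mem s1 ''E'' 0 0 \<Longrightarrow> e \<in> set ts \<Longrightarrow>
      edge_levels s1 e = edge_levels s e \<Longrightarrow>
      wp P (\<lambda>t s2. t \<le> K \<and> represents G s2 \<and> agree (insert ''o'' (insert ''k'' scratch)) {''W'', ''x''} s1 s2 \<and>
        edge_levels s2 = (edge_levels s1)(e := tgt e) \<and>
        (\<exists>ys. stack s2 = stack s1 @ ys \<and> length ys \<le> 2 * f \<and> set ys \<subseteq> {..<n} \<and>
           (tgt e \<noteq> edge_levels s e \<longrightarrow> the (G e) \<subseteq> set ys))) s1"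
  shows "wp (sweep P) (\<lambda>t s'. t \<le> (K + 60) * length ts + 60 \<and> represents G s' \<and> agree swept {''W'', ''x''} s s' \<and>
     edge_levels s' = (\<lambda>e. if e \<in> set ts then tgt e else edge_levels s e) \<and>
     pushes G s s' (2 * f * length ts) (set ts) tgt) s"
proof -
  define J where "J s' \<longleftrightarrow> (let j = nat_mem s' ''y'' 0 0 in j \<le> length ts \<and> represents G s' \<and> agree swept {''W'', ''x''} s s' \<and>
     edge_levels s' = (\<lambda>e. if e \<in> set (take j ts) then tgt e else edge_levels s e) \<and>
     pushes G s s' (2 * f * j) (set (take j ts)) tgt)" for s'
  show ?thesis
    unfolding sweep_def wp_simps
  proof (rule wp_while[where J = J and K = "K + 30" and M = "\<lambda>s'. length ts - nat_mem s' ''y'' 0 0"], goal_cases)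
    case (1 s')
    define j where "j = nat_mem s' ''y'' 0 0"
    obtain ys where J: "represents G s'" "agree swept {''W'', ''x''} s s'"
      "edge_levels s' = (\<lambda>e. if e \<in> set (take j ts) then tgt e else edge_levels s e)"
      "stack s' = stack s @ ys" "length ys \<le> 2 * f * j" "set ys \<subseteq> {..<n}"
      "\<forall>e\<in>set (take j ts). tgt e \<noteq> edge_levels s e \<longrightarrow> the (G e) \<subseteq> set ys"
      using 1 by (auto simp: J_def Let_def j_def)
    have fr: "nat_mem s' ''N'' = nat_mem s ''N''" "nat_mem s' ''T'' = nat_mem s ''T''"
      using J(2) by (auto simp: frame)
    have jl: "j < length ts" using 1(2) N by (simp add: j_def fr)
    define e where "e = ts ! j"
    have Tj: "nat_mem s ''T'' (nat_mem s' ''y'' 0 0) 0 = e" using T jl by (simp add: e_def j_def)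
    have tk: "take (Suc j) ts = take j ts @ [e]" using jl by (simp add: e_def take_Suc_conv_app_nth)
    have "distinct (take (Suc j) ts)" using dist by simp
    then have nt: "e \<notin> set (take j ts)" by (simp add: tk)
    have ets: "e \<in> set ts" using jl by (simp add: e_def)
    define s1 where "s1 = s'\<lparr>nat_mem := write_cell ''E'' 0 0 e (nat_mem s')\<rparr>"
    have ag1: "agree {''E''} {} s' s1" by (simp add: s1_def framed)
    have ags1: "agree swept {''W'', ''x''} s s1"
      using J(2) by (simp add: s1_def agree_def eq_off_write swept_def)
    have rep1: "represents G s1" by (rule represents_agree[OF J(1) ag1]) auto
    have k1: "edge_levels s1 = edge_levels s'" by (simp add: s1_def write_cell_simps)
    have st1: "stack s1 = stack s'" by (simp add: stack_def s1_def write_cell_simps)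
    have y1: "nat_mem s1 ''y'' 0 0 = j" by (simp add: s1_def write_cell_simps j_def)
    have "nat_mem s1 ''k'' e 0 = nat_mem s' ''k'' e 0" using fun_cong[OF k1, of e] .
    also have "\<dots> = nat_mem s ''k'' e 0" using fun_cong[OF J(3), of e] nt by simp
    finally have ke: "edge_levels s1 e = edge_levels s e" .
    have s1': "nat_assigned ''E'' (NConst 0) (NConst 0) (cell ''T'' (var ''y'')) s' = s1"
      by (simp add: s1_def Tj fr)
    show ?case
      unfolding wp_simps(2,4) s1'
    proof (rule wp_mono[OF body[OF rep1 ags1 _ ets ke]], goal_cases)
      case 1
      show ?case by (simp add: s1_def write_cell_simps)
    next
      case (2 t s2)
      then obtain zs where B: "t \<le> K" "represents G s2" "agree (insert ''o'' (insert ''k'' scratch)) {''W'', ''x''} s1 s2"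
        "edge_levels s2 = (edge_levels s1)(e := tgt e)" "stack s2 = stack s1 @ zs" "length zs \<le> 2 * f" "set zs \<subseteq> {..<n}"
        "tgt e \<noteq> edge_levels s e \<longrightarrow> the (G e) \<subseteq> set zs" by blast
      define s3 where "s3 = s2\<lparr>nat_mem := write_cell ''y'' 0 0 (Suc j) (nat_mem s2)\<rparr>"
      have y2: "nat_mem s2 ''y'' 0 0 = j" using B(3) y1 by (simp add: frame)
      have s3: "nat_assigned ''y'' (NConst 0) (NConst 0) (NAdd (var ''y'') (NConst 1)) s2 = s3"
        by (simp add: s3_def y2)
      have "agree swept {''W'', ''x''} s1 s2" using B(3) by (rule agree_mono) (auto simp: swept_def)
      with ags1 have "agree swept {''W'', ''x''} s s2" by (rule agree_trans)
      then have ag3: "agree swept {''W'', ''x''} s s3" by (simp add: s3_def agree_def eq_off_write swept_def)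
      have "agree {''y''} {} s2 s3" by (simp add: s3_def framed)
      then have rep3: "represents G s3" by (rule represents_agree[OF B(2)]) auto
      have st3: "stack s3 = stack s @ (ys @ zs)" using B(5) st1 J(4) by (simp add: s3_def stack_def write_cell_simps)
      have "edge_levels s3 = (edge_levels s1)(e := tgt e)" using B(4) by (simp add: s3_def write_cell_simps)
      also have "\<dots> = (\<lambda>e. if e \<in> set (take (Suc j) ts) then tgt e else edge_levels s e)"
        unfolding k1 J(3) tk by (auto simp: fun_eq_iff)
      finally have k3: "edge_levels s3 = (\<lambda>e. if e \<in> set (take (Suc j) ts) then tgt e else edge_levels s e)" .
      have "length (ys @ zs) \<le> 2 * f * Suc j" "set (ys @ zs) \<subseteq> {..<n}"
        "\<forall>e\<in>set (take (Suc j) ts). tgt e \<noteq> edge_levels s e \<longrightarrow> the (G e) \<subseteq> set (ys @ zs)"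
        using J B by (auto simp: tk)
      then have "J s3"
        unfolding J_def Let_def using jl rep3 ag3 st3 k3 by (auto simp: s3_def write_cell_simps)
      moreover have "nat_mem s3 ''y'' 0 0 = Suc j" by (simp add: s3_def write_cell_simps)
      ultimately show ?case unfolding wp_simps(2) s3 using B(1) jl by (simp flip: j_def)
    qed
  next
    case 2
    have "agree {''y''} {} s (s\<lparr>nat_mem := write_cell ''y'' 0 0 0 (nat_mem s)\<rparr>)"
      by (simp add: framed)
    then have "represents G (s\<lparr>nat_mem := write_cell ''y'' 0 0 0 (nat_mem s)\<rparr>)"
      by (rule represents_agree[OF rep]) auto
    then show ?case by (simp add: J_def write_cell_simps framed stack_def swept_def)
  next
    case (3 t s')
    then have "agree swept {''W'', ''x''} s s'" by (simp add: J_def Let_def)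
    then have "nat_mem s' ''N'' = nat_mem s ''N''" by (auto simp: frame)
    then have "nat_mem s' ''y'' 0 0 = length ts" using 3 N by (auto simp: J_def Let_def)
    then show ?case using 3 by (auto simp: J_def Let_def write_cell_simps algebra_simps)
  qed
qed

text \<open>Shared by both directions. The target levels refer to the state before the move: the
  sweep leaves node levels alone, so the decision for one edge does not depend on what happened to
  the others.\<close>

lemma wp_move_node:
  assumes rep: "represents G s" and w: "w = nat_mem s ''w'' 0 0"
    and T: "T = tight G (offsets s) (edge_levels s) (node_levels s) w"
    and ie: "\<And>s'. agree {''b'', ''N'', ''y'', ''T''} {} s s' \<Longrightarrow> nval ie s' = a" and cost: "ncost ie \<le> 20"
    and body: "\<And>s1 e. represents G s1 \<Longrightarrow> agree moved {''W'', ''x''} s s1 \<Longrightarrow> node_levels s1 = (node_levels s)(w := a) \<Longrightarrow>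
      e = nat_mem s1 ''E'' 0 0 \<Longrightarrow> e \<in> T \<Longrightarrow> edge_levels s1 e = edge_levels s e \<Longrightarrow>
      wp P (\<lambda>t s2. t \<le> 800 * (f + 1) \<and> represents G s2 \<and> agree (insert ''o'' (insert ''k'' scratch)) {''W'', ''x''} s1 s2 \<and>
        edge_levels s2 = (edge_levels s1)(e := tgt e) \<and>
        (\<exists>ys. stack s2 = stack s1 @ ys \<and> length ys \<le> 2 * f \<and> set ys \<subseteq> {..<n} \<and>
           (tgt e \<noteq> edge_levels s e \<longrightarrow> the (G e) \<subseteq> set ys))) s1"
  shows "wp (collect_tight;; NAssign ''i'' (var ''w'') (NConst 0) ie;; sweep P)
     (\<lambda>t s'. t \<le> 2000 * (f + 1) * card T + 500 \<and> represents G s' \<and> agree moved {''W'', ''x''} s s' \<and>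
     edge_levels s' = (\<lambda>e. if e \<in> T then tgt e else edge_levels s e) \<and>
     node_levels s' = (node_levels s)(w := a) \<and>
     pushes G s s' (2 * f * card T) T tgt) s"
  unfolding wp_simps(4)
proof (rule wp_mono[OF wp_collect_tight[OF rep w refl]], goal_cases)
  case (1 t1 s1)
  then obtain ts where t1: "t1 \<le> 100 * (card T + 1)" and ag1: "agree {''b'', ''N'', ''y'', ''T''} {} s s1"
    and ts: "length ts = nat_mem s1 ''N'' 0 0" "\<forall>j<length ts. nat_mem s1 ''T'' j 0 = ts ! j"
      "distinct ts" "set ts = T"
    unfolding T by blast
  have fr1: "nat_mem s1 ''i'' = nat_mem s ''i''" "nat_mem s1 ''k'' = nat_mem s ''k''" "nat_mem s1 ''w'' = nat_mem s ''w''"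
    "nat_mem s1 ''S'' = nat_mem s ''S''" "nat_mem s1 ''h'' = nat_mem s ''h''"
    using ag1 by (auto simp: frame)
  define s2 where "s2 = s1\<lparr>nat_mem := write_cell ''i'' w 0 a (nat_mem s1)\<rparr>"
  have s2: "nat_assigned ''i'' (var ''w'') (NConst 0) ie s1 = s2"
    using ie[OF ag1] w by (simp add: s2_def fr1)
  have ag12: "agree {''i''} {} s1 s2" by (simp add: s2_def framed)
  have rep1: "represents G s1" by (rule represents_agree[OF rep ag1]) auto
  have rep2: "represents G s2" by (rule represents_agree[OF rep1 ag12]) auto
  have "agree moved {''W'', ''x''} s s1" by (rule agree_mono[OF ag1]) (auto simp: names)
  moreover have "agree moved {''W'', ''x''} s1 s2" by (rule agree_mono[OF ag12]) (auto simp: moved_def)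
  ultimately have ag2: "agree moved {''W'', ''x''} s s2" by (rule agree_trans)
  have fr2: "edge_levels s2 = edge_levels s" "stack s2 = stack s" "node_levels s2 = (node_levels s)(w := a)"
    "nat_mem s2 ''N'' = nat_mem s1 ''N''" "nat_mem s2 ''T'' = nat_mem s1 ''T''"
    by (auto simp: s2_def write_cell_simps stack_def fr1)
  have k2: "nat_mem s2 ''k'' = nat_mem s ''k''" by (simp add: s2_def write_cell_simps fr1)
  have card: "card T = length ts" using ts distinct_card by metis
  show ?case
    unfolding wp_simps(2) s2
  proof (rule wp_mono[OF wp_sweep[OF rep2, where ts = ts and tgt = tgt and K = "800 * (f + 1)"]], goal_cases)
    case 1 show ?case using ts(1) by (simp add: fr2)
  next
    case 2 show ?case using ts(2) by (simp add: fr2)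
  next
    case 3 show ?case by fact
  next
    case (4 s3 e)
    have ag3: "agree moved {''W'', ''x''} s s3"
      by (rule agree_trans[OF ag2 agree_mono[OF 4(2)]]) (auto simp: moved_def)
    have "nat_mem s3 ''i'' = nat_mem s2 ''i''" using 4(2) by (auto simp: frame)
    then have "node_levels s3 = (node_levels s)(w := a)" using fr2(3) by simp
    then show ?case using body[OF 4(1) ag3 _ 4(3)] 4 ts(4) by (simp add: k2)
  next
    case (5 t3 s3)
    have ag3: "agree moved {''W'', ''x''} s s3"
      by (rule agree_trans[OF ag2 agree_mono[of swept "{''W'', ''x''}"]]) (use 5 in \<open>auto simp: moved_def\<close>)
    have "agree swept {''W'', ''x''} s2 s3" using 5 by blast
    then have "nat_mem s3 ''i'' = nat_mem s2 ''i''" by (auto simp: frame)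
    then have i3: "node_levels s3 = (node_levels s)(w := a)" using fr2(3) by simp
    have "t1 + t3 + ncost ie + 20 \<le> 2000 * (f + 1) * card T + 500"
    proof -
      have "t3 \<le> (800 * (f + 1) + 60) * card T + 60" using 5 card by simp
      also have "\<dots> \<le> (860 * (f + 1)) * card T + 60" by (intro add_right_mono mult_right_mono) auto
      finally have t3: "t3 \<le> 860 * ((f + 1) * card T) + 60" by (simp only: mult.assoc)
      define q where "q = (f + 1) * card T"
      have "card T \<le> q" by (simp add: q_def)
      moreover have "t1 \<le> 100 * card T + 100" using t1 by simp
      ultimately have "t1 + t3 + ncost ie + 20 \<le> 2000 * q + 500" using cost t3 unfolding q_def[symmetric] by linarith
      then show ?thesis by (simp only: q_def mult.assoc)
    qed
    then show ?case using 5 ag3 i3 ts(4) card by (simp add: fr2 k2 cong: if_cong)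
  qed
qed

lemma wp_raise_node:
  assumes rep: "represents G s" and cf: "configured s" and w: "w = nat_mem s ''w'' 0 0"
    and T: "T = tight G (offsets s) (edge_levels s) (node_levels s) w"
  shows "wp raise_node
     (\<lambda>t s'. t \<le> 2000 * (f + 1) * card T + 500 \<and> represents G s' \<and> agree moved {''W'', ''x''} s s' \<and>
     edge_levels s' = (\<lambda>e. if e \<in> T then edge_levels s e + 1 else edge_levels s e) \<and>
     node_levels s' = (node_levels s)(w := node_levels s w + 1) \<and>
     (\<exists>ys. stack s' = stack s @ ys \<and> length ys \<le> 2 * f * card T \<and> set ys \<subseteq> {..<n} \<and>
       (\<forall>e\<in>T. edge_levels s e + 1 \<noteq> edge_levels s e \<longrightarrow> the (G e) \<subseteq> set ys))) s"
  unfolding raise_node_def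
proof (rule wp_move_node[OF rep w T, where tgt = "\<lambda>e. edge_levels s e + 1"], goal_cases)
  case (1 s')
  then show ?case using w by (simp add: frame)
next
  case 2 show ?case by simp
next
  case (3 s1 e)
  have e: "e \<in> dom G" using 3(5) by (auto simp: T tight_def edges_at_def)
  have cf1: "configured s1" by (rule configured_agree[OF cf 3(2)]) (auto simp: names)
  have en: "set (ends s1 e) = the (G e)" using 3(1) e by (simp add: represents_def)
  have sub: "the (G e) \<subseteq> {..<n}" using 3(1) graph_okD(2)[of G e] e by (auto simp: represents_def)
  show ?case
  proof (rule wp_mono[OF wp_raise_edge[OF 3(1,4) e cf1]], goal_cases)
    case (1 t s2)
    then have "agree (insert ''o'' (insert ''k'' scratch)) {''W'', ''x''} s1 s2"
      by (intro agree_mono[of "insert ''k'' scratch" _ _ _ "insert ''o'' (insert ''k'' scratch)"]) auto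
    moreover have "t \<le> 800 * (f + 1)" using 1 by simp
    moreover have "length (ends s1 e @ ends s1 e) \<le> 2 * f" using ends_length[OF 3(1) e] by simp
    moreover have "set (ends s1 e @ ends s1 e) \<subseteq> {..<n}" using en sub by simp
    ultimately show ?case using 1 3(6) en by auto
  qed
qed

lemma wp_lower_node:
  assumes rep: "represents G s" and cf: "configured s" and w: "w = nat_mem s ''w'' 0 0"
    and T: "T = tight G (offsets s) (edge_levels s) (node_levels s) w" and pos: "0 < node_levels s w"
  defines "tgt \<equiv> \<lambda>e. if 0 < edge_levels s e \<and> (\<forall>u\<in>the (G e). u \<noteq> w \<longrightarrow> node_levels s u < edge_levels s e + offsets s e u)
       then edge_levels s e - 1 else edge_levels s e"
  shows "wp lower_node
     (\<lambda>t s'. t \<le> 2000 * (f + 1) * card T + 500 \<and> represents G s' \<and> agree moved {''W'', ''x''} s s' \<and>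
     edge_levels s' = (\<lambda>e. if e \<in> T then tgt e else edge_levels s e) \<and>
     node_levels s' = (node_levels s)(w := node_levels s w - 1) \<and>
     pushes G s s' (2 * f * card T) T tgt) s"
  unfolding lower_node_def
proof (rule wp_move_node[OF rep w T, where tgt = tgt], goal_cases)
  case (1 s')
  then show ?case using w by (simp add: frame)
next
  case 2 show ?case by simp
next
  case (3 s1 e)
  have e: "e \<in> dom G" and te: "edge_levels s e + offsets s e w = node_levels s w"
    using 3(5) by (auto simp: T tight_def edges_at_def)
  have cf1: "configured s1" by (rule configured_agree[OF cf 3(2)]) (auto simp: names)
  have en: "set (ends s1 e) = the (G e)" using 3(1) e by (simp add: represents_def)
  have sub: "the (G e) \<subseteq> {..<n}" using 3(1) graph_okD(2)[of G e] e by (auto simp: represents_def)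
  have d1: "offsets s1 = offsets s" using 3(2) by (auto simp: frame)
  \<comment> \<open>The moving node passes the test by itself: the edge was tight, so its key equals
    the old level of \<open>w\<close>, which has just been decremented from a positive
    value.\<close>
  have free: "(\<forall>u\<in>the (G e). node_levels s1 u < edge_levels s e + offsets s1 e u) \<longleftrightarrow>
      (\<forall>u\<in>the (G e). u \<noteq> w \<longrightarrow> node_levels s u < edge_levels s e + offsets s e u)"
  proof -
    have "node_levels s1 u = (if u = w then node_levels s w - 1 else node_levels s u)" for u
      using fun_cong[OF 3(3), of u] by simp
    then show ?thesis using te pos unfolding d1 by (auto split: if_splits)
  qed
  show ?case
  proof (rule wp_mono[OF wp_lower_edge[OF 3(1,4) e cf1]], goal_cases)
    case (1 t s2)
    have "edge_levels s2 = (edge_levels s1)(e := tgt e)"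
      using 1 unfolding free 3(6) tgt_def by simp
    moreover have "\<exists>ys. stack s2 = stack s1 @ ys \<and> length ys \<le> 2 * f \<and> set ys \<subseteq> {..<n} \<and>
           (tgt e \<noteq> edge_levels s e \<longrightarrow> the (G e) \<subseteq> set ys)"
    proof (cases "tgt e = edge_levels s e")
      case True
      then have nf: "\<not> (0 < edge_levels s e \<and> (\<forall>u\<in>the (G e). u \<noteq> w \<longrightarrow> node_levels s u < edge_levels s e + offsets s e u))"
        by (auto simp: tgt_def split: if_splits)
      have "stack s2 = stack s1" using 1 nf unfolding free 3(6) by (simp only: if_False simp_thms)
      then show ?thesis using True by auto
    next
      case False
      then have "0 < edge_levels s e \<and> (\<forall>u\<in>the (G e). u \<noteq> w \<longrightarrow> node_levels s u < edge_levels s e + offsets s e u)"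
        by (auto simp: tgt_def split: if_splits)
      then have "stack s2 = stack s1 @ ends s1 e @ ends s1 e" using 1 unfolding free 3(6) by simp
      moreover have "length (ends s1 e @ ends s1 e) \<le> 2 * f" using ends_length[OF 3(1) e] by simp
      moreover have "set (ends s1 e @ ends s1 e) \<subseteq> {..<n}" using en sub by simp
      ultimately show ?thesis using en by auto
    qed
    ultimately show ?case using 1 by blast
  qed
qed

end

section \<open>Settling the nodes on the stack\<close>

abbreviation above_capacity :: bexp where
  "above_capacity \<equiv> RLess (rcell ''c'' (var ''w'')) (rcell ''W'' (var ''w''))"
abbreviation below_threshold :: bexp where
  "below_threshold \<equiv> Conj (NLess (NConst 0) (cell ''i'' (var ''w'')))
     (RLess (RMul (rvar ''la'') (rcell ''W'' (var ''w''))) (rcell ''c'' (var ''w'')))"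

text \<open>A node is popped only when it turns out settled. A node that moves remains on the stack
  beneath the newly pushed ones and is examined again.\<close>

definition settle :: com where
  "settle = While (NLess (NConst 0) (var ''h''))
    (''w'' ::= cell ''S'' (NSub (var ''h'') (NConst 1));;
     Cond above_capacity raise_node
      (Cond below_threshold
        lower_node (decr ''h'' (NConst 0))))"

text \<open>Part of every run, which makes the first update no special case. Without a logarithm
  among the operations, \<open>L\<close> is found by multiplying up; these \<open>L\<close> steps
  fit into the time of an update.\<close>

definition setup_constants :: com where
  "setup_constants = ''be'' :::= RAdd (ROfNat (NConst 1)) (RDiv (rvar ''eps'') (ROfNat (NConst 4)));;
   ''la'' :::= RAdd (RAdd (ROfNat (var ''f'')) (ROfNat (NConst 1))) (RMul (rvar ''eps'') (ROfNat (var ''f'')));;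
   ''L'' ::= NConst 0;; ''y'' :::= ROfNat (NConst 1);;
   While (RLess (rvar ''y'') (ROfNat (var ''m'')))
     (''y'' :::= RMul (rvar ''y'') (rvar ''be'');; incr ''L'' (NConst 0))"

lemma stack_nonempty:
  assumes "0 < nat_mem s ''h'' 0 0"
  shows "nat_mem s ''S'' (nat_mem s ''h'' 0 0 - 1) 0 = last (stack s)" "stack s \<noteq> []"
  using assms by (auto simp: stack_def last_map)

context level_scheme
begin

definition pending :: "graph \<Rightarrow> memory \<Rightarrow> bool" where
  "pending G s \<longleftrightarrow> represents G s \<and> configured s \<and>
     levels_ok G (offsets s) (edge_levels s) (node_levels s) \<and> set (stack s) \<subseteq> {..<n} \<and>
     (\<forall>v<n. settled G (edge_levels s) (node_levels s) v \<or> v \<in> set (stack s))"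

text \<open>Stack entries carry credit of their own: a push is paid by the move that causes it, and
  a pop pays for itself. The factor 4000 converts potential into time.\<close>

definition credit :: "graph \<Rightarrow> memory \<Rightarrow> real" where
  "credit G s = 4000 * (potential G (edge_levels s) (node_levels s) + real (length (stack s)))"

lemma settled_cong:
  assumes "\<And>e. e \<in> edges_at G v \<Longrightarrow> k' e = k e" "i' v = i v"
  shows "settled G k' i' v \<longleftrightarrow> settled G k i v"
proof -
  have "load G k' v = load G k v"
    unfolding load_def xval_def using assms(1) by (intro sum.cong) auto
  then show ?thesis using assms(2) by (simp add: settled_def)
qed

text \<open>All endpoints of an edge that changed its level were pushed, and \<open>w\<close> was on
  the stack already. Any node off the stack therefore kept its level and its load.\<close>

lemma pending_after_move:
  assumes pd: "pending G s" and w: "w = last (stack s)" "stack s \<noteq> []"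
    and rep: "represents G s'" and ag: "agree moved {''W'', ''x''} s s'"
    and lev: "levels_ok G (offsets s) (edge_levels s') (node_levels s')"
    and k': "edge_levels s' = (\<lambda>e. if e \<in> T then tgt e else edge_levels s e)"
    and i': "node_levels s' = (node_levels s)(w := a)"
    and st: "stack s' = stack s @ ys" "set ys \<subseteq> {..<n}" "\<forall>e\<in>T. tgt e \<noteq> edge_levels s e \<longrightarrow> the (G e) \<subseteq> set ys"
  shows "pending G s'"
proof -
  have d: "offsets s' = offsets s" using ag by (auto simp: frame)
  have cf: "configured s'"
    by (rule configured_agree[OF _ ag]) (use pd in \<open>auto simp: pending_def names\<close>)
  have "settled G (edge_levels s') (node_levels s') v" if v: "v < n" "v \<notin> set (stack s')" for v
  proof -
    have "v \<notin> set (stack s)" "v \<notin> set ys" using v st by auto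
    then have "v \<noteq> w" using w by auto
    have "settled G (edge_levels s') (node_levels s') v \<longleftrightarrow> settled G (edge_levels s) (node_levels s) v"
    proof (rule settled_cong)
      fix e assume "e \<in> edges_at G v"
      then have "\<not> the (G e) \<subseteq> set ys" using \<open>v \<notin> set ys\<close> by (auto simp: edges_at_def)
      then show "edge_levels s' e = edge_levels s e" using st(3) fun_cong[OF k', of e] by auto
    next
      show "node_levels s' v = node_levels s v" using \<open>v \<noteq> w\<close> fun_cong[OF i', of v] by simp
    qed
    then show ?thesis using pd v \<open>v \<notin> set (stack s)\<close> by (auto simp: pending_def)
  qed
  then show ?thesis
    using pd rep cf lev st unfolding pending_def d by auto
qed

text \<open>Of the \<open>4 * real f * real N\<close> released, pushes consume at most half. The
  other half, times 4000, exceeds \<open>2000 * (f + 1) * N\<close> because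
  \<open>1 \<le> f\<close>, and the extra 1 covers the constants.\<close>

lemma move_paid:
  assumes t: "t \<le> 2000 * (f + 1) * N + 500"
    and pot: "p' + 1 + 4 * real f * real N \<le> p" and len: "h' \<le> h + 2 * f * N"
  shows "real (t + 100) \<le> 4000 * (p + real h) - 4000 * (p' + real h')"
proof -
  have "real N \<le> real f * real N" using rank_pos by (simp add: mult_le_cancel_right1)
  moreover have "real t \<le> 2000 * (real f * real N) + 2000 * real N + 500"
  proof -
    have "real t \<le> real (2000 * (f + 1) * N + 500)" using t by (intro of_nat_mono)
    then show ?thesis by (simp add: algebra_simps)
  qed
  moreover have "real h' \<le> real h + 2 * (real f * real N)"
  proof -
    have "real h' \<le> real (h + 2 * f * N)" using len by (intro of_nat_mono)
    then show ?thesis by simp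
  qed
  moreover have "p' + 1 + 4 * (real f * real N) \<le> p" using pot by (simp only: mult.assoc)
  ultimately show ?thesis by simp
qed

lemma wp_settle_step:
  assumes pd: "pending G s" and h: "0 < nat_mem s ''h'' 0 0" and w: "nat_mem s ''w'' 0 0 = last (stack s)"
  shows "wp (Cond above_capacity raise_node
      (Cond below_threshold
        lower_node (decr ''h'' (NConst 0))))
     (\<lambda>t s'. pending G s' \<and> agree moved {''W'', ''x''} s s' \<and> real (t + 20) \<le> credit G s - credit G s') s"
proof -
  define v where "v = last (stack s)"
  let ?k = "edge_levels s" and ?i = "node_levels s" and ?d = "offsets s"
  let ?T = "tight G ?d ?k ?i v"
  note st = stack_nonempty[OF h]
  have rep: "represents G s" and cf: "configured s" and ok: "levels_ok G ?d ?k ?i" and sub: "set (stack s) \<subseteq> {..<n}"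
    using pd by (auto simp: pending_def)
  have v: "v < n" using subsetD[OF sub last_in_set[OF st(2)]] by (simp add: v_def)
  have wv: "v = nat_mem s ''w'' 0 0" using w by (simp add: v_def)
  have W: "real_mem s ''W'' v 0 = load G ?k v" using rep by (simp add: represents_def)
  have cv: "real_mem s ''c'' v 0 = c v" "real_mem s ''la'' 0 0 = lam" using cf v by (auto simp: configured_def)
  have b1: "bval above_capacity s \<longleftrightarrow> c v < load G ?k v"
    using W cv by (simp flip: wv)
  have b2: "bval below_threshold s \<longleftrightarrow>
       0 < ?i v \<and> lam * load G ?k v < c v"
    using W cv by (simp flip: wv)
  show ?thesis
  proof (cases "c v < load G ?k v")
    case True
    note below = overloaded_below_top[OF ok v True]
    show ?thesis
      unfolding wp_simps(5) if_P[OF iffD2[OF b1 True]]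
    proof (rule wp_mono[OF wp_raise_node[OF rep cf wv refl]], goal_cases)
      case (1 t s')
      then obtain ys where P: "t \<le> 2000 * (f + 1) * card ?T + 500" "represents G s'" "agree moved {''W'', ''x''} s s'"
        "edge_levels s' = (\<lambda>e. if e \<in> ?T then ?k e + 1 else ?k e)" "node_levels s' = ?i(v := ?i v + 1)"
        "stack s' = stack s @ ys" "length ys \<le> 2 * f * card ?T" "set ys \<subseteq> {..<n}"
        "\<forall>e\<in>?T. ?k e + 1 \<noteq> ?k e \<longrightarrow> the (G e) \<subseteq> set ys" by blast
      have k': "edge_levels s' e = (if e \<in> ?T then ?k e + 1 else ?k e)" for e using fun_cong[OF P(4), of e] by simp
      have lev: "levels_ok G ?d (edge_levels s') (node_levels s')"
        unfolding P(5) by (rule levels_ok_raise[OF ok v below]) (rule k')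
      have pot: "potential G (edge_levels s') (node_levels s') + 1 + 4 * real f * real (card ?T) \<le> potential G ?k ?i"
        unfolding P(5) by (rule potential_raise[OF ok v True]) (rule k')
      have "real (t + 100) \<le> credit G s - credit G s'"
        unfolding credit_def by (rule move_paid[OF P(1) pot]) (use P(6,7) in simp)
      moreover have "pending G s'"
        by (rule pending_after_move[OF pd v_def st(2) P(2,3) lev P(4,5,6,8,9)])
      ultimately show ?case using P(3) by simp
    qed
  next
    case nover: False
    then have nb1: "\<not> bval above_capacity s" using b1 by blast
    show ?thesis
    proof (cases "0 < ?i v \<and> lam * load G ?k v < c v")
      case True
      define tgt where "tgt e = (if 0 < ?k e \<and> (\<forall>u\<in>the (G e). u \<noteq> v \<longrightarrow> ?i u < ?k e + ?d e u) then ?k e - 1 else ?k e)" for e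
      show ?thesis
        unfolding wp_simps(5) if_not_P[OF nb1] if_P[OF iffD2[OF b2 True]]
      proof (rule wp_mono[OF wp_lower_node[OF rep cf wv refl conjunct1[OF True]]], goal_cases)
        case (1 t s')
        then obtain ys where P: "t \<le> 2000 * (f + 1) * card ?T + 500" "represents G s'" "agree moved {''W'', ''x''} s s'"
          "edge_levels s' = (\<lambda>e. if e \<in> ?T then tgt e else ?k e)" "node_levels s' = ?i(v := ?i v - 1)"
          "stack s' = stack s @ ys" "length ys \<le> 2 * f * card ?T" "set ys \<subseteq> {..<n}"
          "\<forall>e\<in>?T. tgt e \<noteq> ?k e \<longrightarrow> the (G e) \<subseteq> set ys" unfolding tgt_def by blast
        have k': "edge_levels s' e =
          (if e \<in> ?T \<and> 0 < ?k e \<and> (\<forall>u\<in>the (G e). u \<noteq> v \<longrightarrow> ?i u < ?k e + ?d e u) then ?k e - 1 else ?k e)" for e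
          using fun_cong[OF P(4), of e] unfolding tgt_def by (cases "e \<in> ?T") simp_all
        have lev: "levels_ok G ?d (edge_levels s') (node_levels s')"
          unfolding P(5) by (rule levels_ok_lower[OF ok v conjunct1[OF True]]) (rule k')
        have pot: "potential G (edge_levels s') (node_levels s') + 1 + 4 * real f * real (card ?T) \<le> potential G ?k ?i"
          unfolding P(5) by (rule potential_lower[OF ok v conjunct1[OF True] conjunct2[OF True]]) (rule k')
        have "real (t + 100) \<le> credit G s - credit G s'"
          unfolding credit_def by (rule move_paid[OF P(1) pot]) (use P(6,7) in simp)
        moreover have "pending G s'"
          by (rule pending_after_move[OF pd v_def st(2) P(2,3) lev P(4,5,6,8,9)])
        ultimately show ?case using P(3) by simp
      qed
    next
      case False
      then have nb2: "\<not> bval below_threshold s" using b2 by blast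
      have sv: "settled G ?k ?i v" using nover False by (auto simp: settled_def)
      define s' where "s' = s\<lparr>nat_mem := write_cell ''h'' 0 0 (nat_mem s ''h'' 0 0 - 1) (nat_mem s)\<rparr>"
      have ag: "agree {''h''} {} s s'" by (simp add: s'_def framed)
      have agm: "agree moved {''W'', ''x''} s s'" by (rule agree_mono[OF ag]) (auto simp: names)
      have rep': "represents G s'" by (rule represents_agree[OF rep ag]) auto
      have cf': "configured s'" by (rule configured_agree[OF cf ag]) auto
      have stb: "stack s' = butlast (stack s)"
        using h by (cases "nat_mem s ''h'' 0 0") (simp_all add: s'_def stack_def write_cell_simps)
      have fr: "nat_mem s' ''k'' = nat_mem s ''k''" "nat_mem s' ''i'' = nat_mem s ''i''" "nat_mem s' ''d'' = nat_mem s ''d''"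
        using ag by (auto simp: frame)
      have "u \<in> set (stack s')" if "u \<in> set (stack s)" "u \<noteq> v" for u
      proof -
        have "set (stack s) = set (butlast (stack s) @ [last (stack s)])"
          using append_butlast_last_id[OF st(2)] by simp
        then show ?thesis using that by (simp add: stb v_def)
      qed
      then have "pending G s'"
        using pd rep' cf' sv in_set_butlastD[of _ "stack s"] unfolding pending_def fr stb[symmetric] by blast
      moreover have "credit G s - credit G s' = 4000"
        using st(2) by (simp add: credit_def fr stb algebra_simps of_nat_diff Suc_le_eq)
      ultimately show ?thesis
        unfolding wp_simps(5) if_not_P[OF nb1] if_not_P[OF nb2] wp_simps(2)
        using agm by (simp add: s'_def)
    qed
  qed
qed

lemma wp_settle:
  assumes pd: "pending G s"
  shows "wp settle (\<lambda>t s'. pending G s' \<and> stack s' = [] \<and> agree (insert ''w'' moved) {''W'', ''x''} s s' \<and>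
     real t \<le> credit G s - credit G s' + 10) s"
  unfolding settle_def
proof (rule wp_while_potential[where J = "\<lambda>s'. pending G s' \<and> agree (insert ''w'' moved) {''W'', ''x''} s s'" and
      F = "credit G" and lb = "- 4000 * (real n * real L)"], goal_cases)
  case (1 s')
  have h: "0 < nat_mem s' ''h'' 0 0" using 1 by simp
  define s1 where "s1 = s'\<lparr>nat_mem := write_cell ''w'' 0 0 (last (stack s')) (nat_mem s')\<rparr>"
  have s1: "nat_assigned ''w'' (NConst 0) (NConst 0) (cell ''S'' (NSub (var ''h'') (NConst 1))) s' = s1"
    using stack_nonempty(1)[OF h] by (simp add: s1_def)
  have ag: "agree {''w''} {} s' s1" by (simp add: s1_def framed)
  have fr: "nat_mem s1 a = nat_mem s' a" if "a \<noteq> ''w''" for a using that by (simp add: s1_def write_cell_simps)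
  have stk: "stack s1 = stack s'" by (simp add: stack_def fr)
  have pd1: "pending G s1"
    using 1 represents_agree[OF _ ag, of G] configured_agree[OF _ ag] unfolding pending_def stk by (simp add: fr)
  have cr: "credit G s1 = credit G s'" by (simp add: credit_def stk fr)
  have w1: "nat_mem s1 ''w'' 0 0 = last (stack s1)" unfolding stk by (simp add: s1_def write_cell_simps)
  have h1: "0 < nat_mem s1 ''h'' 0 0" using h by (simp add: fr)
  show ?case
    unfolding wp_simps(2,4) s1
  proof (rule wp_mono[OF wp_settle_step[OF pd1 h1 w1]], goal_cases)
    case (1 t s2)
    have "agree (insert ''w'' moved) {''W'', ''x''} s' s1" by (rule agree_mono[OF ag]) auto
    moreover have "agree (insert ''w'' moved) {''W'', ''x''} s1 s2" by (rule agree_mono[of moved "{''W'', ''x''}"]) (use 1 in auto)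
    ultimately have ag2: "agree (insert ''w'' moved) {''W'', ''x''} s' s2" by (rule agree_trans)
    have "agree (insert ''w'' moved) {''W'', ''x''} s s'" using \<open>pending G s' \<and> _\<close> by blast
    from agree_trans[OF this ag2] have "agree (insert ''w'' moved) {''W'', ''x''} s s2" .
    then show ?case using 1 cr by simp
  qed
next
  case (2 s')
  then have "- (real n * real L) \<le> potential G (edge_levels s') (node_levels s')"
    using potential_lower_bound(2) by (auto simp: pending_def)
  then show ?case by (simp add: credit_def)
next
  case 3
  then show ?case using pd agree_refl by blast
next
  case (4 t s')
  then show ?case by (auto simp: stack_def)
qed

definition loaded :: "memory \<Rightarrow> bool" where
  "loaded s \<longleftrightarrow> nat_mem s ''m'' 0 0 = m \<and> nat_mem s ''f'' 0 0 = f \<and> real_mem s ''eps'' 0 0 = eps \<and>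
     real_mem s ''mu'' 0 0 = mu \<and> (\<forall>v<n. real_mem s ''c'' v 0 = c v)"

lemma wp_setup_constants:
  assumes ld: "loaded s" and least: "\<And>l. l < L \<Longrightarrow> beta ^ l < real m"
  shows "wp setup_constants (\<lambda>t s'. t \<le> 100 * (L + 1) \<and> agree {''L''} {''be'', ''la'', ''y''} s s' \<and> configured s') s"
proof -
  define J where "J s' \<longleftrightarrow> agree {''L''} {''be'', ''la'', ''y''} s s' \<and> real_mem s' ''be'' 0 0 = beta \<and>
    real_mem s' ''la'' 0 0 = lam \<and> nat_mem s' ''L'' 0 0 \<le> L \<and> real_mem s' ''y'' 0 0 = beta ^ nat_mem s' ''L'' 0 0" for s'
  show ?thesis
    unfolding setup_constants_def wp_simps(2,3,4)
  proof (rule wp_while[where J = J and K = 50 and M = "\<lambda>s'. L - nat_mem s' ''L'' 0 0"], goal_cases)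
    case (1 s')
    have fr: "nat_mem s' ''m'' = nat_mem s ''m''" using 1 by (auto simp: J_def frame)
    \<comment> \<open>The search cannot run past \<open>L\<close> by \<open>edges_le_top\<close>; by
      minimality of \<open>L\<close> it cannot stop earlier.\<close>
    have "nat_mem s' ''L'' 0 0 \<noteq> L"
      using 1 ld edges_le_top by (auto simp: J_def fr loaded_def beta_def)
    then have "nat_mem s' ''L'' 0 0 < L" using 1 by (simp add: J_def)
    then show ?case
      using 1 by (simp add: J_def wp_simps write_cell_simps agree_def eq_off_write)
  next
    case 2
    then show ?case
      using ld by (simp add: J_def write_cell_simps framed beta_def lam_def loaded_def)
  next
    case (3 t s')
    have ag: "agree {''L''} {''be'', ''la'', ''y''} s s'" using 3 by (simp add: J_def)
    have fr: "nat_mem s' ''m'' = nat_mem s ''m''" "real_mem s' ''mu'' = real_mem s ''mu''" "real_mem s' ''c'' = real_mem s ''c''"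
      using ag by (auto simp: frame)
    have "\<not> nat_mem s' ''L'' 0 0 < L" using 3 ld least[of "nat_mem s' ''L'' 0 0"] by (auto simp: J_def fr loaded_def)
    then have "nat_mem s' ''L'' 0 0 = L" using 3 by (simp add: J_def)
    then have "configured s'" using 3 ld by (simp add: configured_def J_def fr loaded_def)
    then show ?case using 3 ag by (simp add: write_cell_simps)
  qed
qed

end

section \<open>Inserting and deleting edges\<close>

definition read_ends :: com where
  "read_ends = ''y'' :::= rvar ''mu'';; ''j'' ::= NConst 0;;
   While (NLess (var ''j'') (var ''deg''))
     (''u'' ::= cell ''ends'' (var ''j'');; NAssign ''v'' (var ''E'') (var ''j'') (var ''u'');;
      Cond (RLess (rcell ''c'' (var ''u'')) (rvar ''y'')) (''y'' :::= rcell ''c'' (var ''u'')) Skip;;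
      incr ''j'' (NConst 0))"

text \<open>\<open>z\<close> is one power of \<open>beta\<close> ahead of \<open>l\<close>, so the
  loop stops as soon as one more step would exceed \<open>min (c u) mu\<close>. The explicit cutoff
  bounds the time where that minimum is far above the weight of the edge.\<close>

definition find_offset :: com where
  "find_offset = ''l'' ::= NConst 0;; ''z'' :::= RMul (rvar ''y'') (rvar ''be'');;
   While (Conj (NLess (var ''l'') (NAdd (var ''L'') (NConst 1)))
       (Conj (Neg (RLess (rcell ''c'' (var ''u'')) (rvar ''z''))) (Neg (RLess (rvar ''mu'') (rvar ''z'')))))
     (incr ''l'' (NConst 0);; ''z'' :::= RMul (rvar ''z'') (rvar ''be''))"

text \<open>Repeated over the endpoints, this makes \<open>k e\<close> the running maximum of 0 and
  the differences \<open>i u - d e u\<close>.\<close>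

definition lift_edge :: com where
  "lift_edge = While (NLess key (cell ''i'' (var ''u'')))
     (incr ''k'' (var ''E'');;
      RAssign ''x'' (var ''E'') (NConst 0) (RDiv (rcell ''x'' (var ''E'')) (rvar ''be'')))"

definition place_ends :: com where
  "place_ends = ''j'' ::= NConst 0;;
   While (NLess (var ''j'') (var ''deg''))
     (''u'' ::= NCell ''v'' (var ''E'') (var ''j'');; find_offset;;
      NAssign ''d'' (var ''E'') (var ''u'') (var ''l'');; lift_edge;; incr ''j'' (NConst 0))"

definition insert_edge :: com where
  "insert_edge = ''E'' ::= var ''edge'';; NAssign ''g'' (var ''E'') (NConst 0) (var ''deg'');;
   NAssign ''k'' (var ''E'') (NConst 0) (NConst 0);; read_ends;;
   RAssign ''x'' (var ''E'') (NConst 0) (rvar ''y'');; place_ends;; add_edge"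

definition delete_edge :: com where
  "delete_edge = ''E'' ::= var ''edge'';; remove_edge"

context level_scheme
begin

section \<open>Fitting a new edge to the node levels\<close>

lemma wp_read_ends:
  assumes cf: "configured s" and e: "e = nat_mem s ''E'' 0 0" and deg: "nat_mem s ''deg'' 0 0 = length vs"
    and vs: "\<And>j. j < length vs \<Longrightarrow> nat_mem s ''ends'' j 0 = vs ! j" "set vs \<subseteq> {..<n}"
  shows "wp read_ends (\<lambda>t s'. t \<le> 100 * (length vs + 1) \<and> agree {''j'', ''u'', ''v''} {''y''} s s' \<and>
     (\<forall>e'. e' \<noteq> e \<longrightarrow> nat_mem s' ''v'' e' = nat_mem s ''v'' e') \<and> (\<forall>j<length vs. nat_mem s' ''v'' e j = vs ! j) \<and>
     real_mem s' ''y'' 0 0 = Min (insert mu (c ` set vs))) s"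
proof -
  define J where "J s' \<longleftrightarrow> (let j = nat_mem s' ''j'' 0 0 in j \<le> length vs \<and> agree {''j'', ''u'', ''v''} {''y''} s s' \<and>
     (\<forall>e'. e' \<noteq> e \<longrightarrow> nat_mem s' ''v'' e' = nat_mem s ''v'' e') \<and> (\<forall>i<j. nat_mem s' ''v'' e i = vs ! i) \<and>
     real_mem s' ''y'' 0 0 = Min (insert mu (c ` set (take j vs))))" for s'
  show ?thesis
    unfolding read_ends_def wp_simps(2,3,4)
  proof (rule wp_while[where J = J and K = 80 and M = "\<lambda>s'. length vs - nat_mem s' ''j'' 0 0"], goal_cases)
    case (1 s')
    define j where "j = nat_mem s' ''j'' 0 0"
    have J: "agree {''j'', ''u'', ''v''} {''y''} s s'" "\<forall>e'. e' \<noteq> e \<longrightarrow> nat_mem s' ''v'' e' = nat_mem s ''v'' e'"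
      "\<forall>i<j. nat_mem s' ''v'' e i = vs ! i" "real_mem s' ''y'' 0 0 = Min (insert mu (c ` set (take j vs)))"
      using 1 by (simp_all add: J_def Let_def j_def)
    have fr: "nat_mem s' ''E'' = nat_mem s ''E''" "nat_mem s' ''deg'' = nat_mem s ''deg''"
      "nat_mem s' ''ends'' = nat_mem s ''ends''" "real_mem s' ''c'' = real_mem s ''c''"
      using J(1) by (auto simp: frame)
    have jl: "j < length vs" using 1(2) deg by (simp add: j_def fr)
    define u where "u = vs ! j"
    have u: "nat_mem s ''ends'' j 0 = u" "u \<in> set vs" using vs(1)[OF jl] jl by (auto simp: u_def)
    have cu: "real_mem s ''c'' u 0 = c u" using cf u(2) vs(2) by (auto simp: configured_def)
    have tk: "take (Suc j) vs = take j vs @ [u]" using jl by (simp add: u_def take_Suc_conv_app_nth)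
    have "insert mu (c ` set (take (Suc j) vs)) = insert (c u) (insert mu (c ` set (take j vs)))"
      by (auto simp: tk)
    define mj where "mj = Min (insert mu (c ` set (take j vs)))"
    have mn: "Min (insert mu (c ` set (take (Suc j) vs))) = min (c u) mj"
      unfolding \<open>insert mu (c ` set (take (Suc j) vs)) = _\<close> mj_def by (rule Min_insert) auto
    show ?case
      using J[folded mj_def] jl unfolding J_def Let_def
      by (simp add: wp_simps write_cell_simps fr e[symmetric] j_def[symmetric] u(1) cu agree_def eq_off_write mn)
        (auto simp: less_Suc_eq u_def min_def)
  next
    case 2
    then show ?case
      using cf by (simp add: J_def write_cell_simps framed configured_def)
  next
    case (3 t s')
    have "nat_mem s' ''deg'' = nat_mem s ''deg''" using 3 by (auto simp: J_def Let_def frame)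
    then have "nat_mem s' ''j'' 0 0 = length vs" using 3 deg by (auto simp: J_def Let_def)
    then show ?case using 3 by (simp add: J_def Let_def write_cell_simps)
  qed
qed

lemma wp_find_offset:
  assumes cf: "configured s" and u: "u = nat_mem s ''u'' 0 0" "u < n"
    and y: "real_mem s ''y'' 0 0 = b" "0 < b" "b \<le> cap u"
  shows "wp find_offset (\<lambda>t s'. t \<le> 100 * (L + 2) \<and> agree {''l''} {''z''} s s' \<and>
     b * beta ^ nat_mem s' ''l'' 0 0 \<le> cap u \<and>
     (nat_mem s' ''l'' 0 0 \<le> L \<longrightarrow> cap u < b * beta ^ (nat_mem s' ''l'' 0 0 + 1))) s"
proof -
  define J where "J s' \<longleftrightarrow> agree {''l''} {''z''} s s' \<and> nat_mem s' ''l'' 0 0 \<le> L + 1 \<and>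
     b * beta ^ nat_mem s' ''l'' 0 0 \<le> cap u \<and> real_mem s' ''z'' 0 0 = b * beta ^ (nat_mem s' ''l'' 0 0 + 1)" for s'
  have cs: "real_mem s ''be'' 0 0 = beta" "real_mem s ''mu'' 0 0 = mu" "real_mem s ''c'' u 0 = c u" "nat_mem s ''L'' 0 0 = L"
    using cf u(2) by (auto simp: configured_def)
  have fr: "nat_mem s' ''u'' = nat_mem s ''u''" "real_mem s' ''be'' = real_mem s ''be''" "real_mem s' ''mu'' = real_mem s ''mu''"
    "real_mem s' ''c'' = real_mem s ''c''" "nat_mem s' ''L'' = nat_mem s ''L''" if "J s'" for s'
    using that by (auto simp: J_def frame)
  show ?thesis
    unfolding find_offset_def wp_simps(2,3,4)
  proof (rule wp_while[where J = J and K = 50 and M = "\<lambda>s'. L + 1 - nat_mem s' ''l'' 0 0"], goal_cases)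
    case (1 s')
    note fr = fr[OF 1(1)]
    have "nat_mem s' ''l'' 0 0 < L + 1" "real_mem s' ''z'' 0 0 \<le> cap u"
      using 1(2) cs u(1) by (auto simp: fr cap_def)
    then show ?case
      using 1(1) cs by (simp add: J_def wp_simps write_cell_simps agree_def eq_off_write fr mult_ac)
  next
    case 2
    then show ?case
      using y cs by (simp add: J_def write_cell_simps framed)
  next
    case (3 t s')
    note fr = fr[OF 3(2)]
    have "nat_mem s' ''l'' 0 0 \<le> L \<longrightarrow> cap u < real_mem s' ''z'' 0 0"
      using 3(3) cs u(1) by (auto simp: fr cap_def)
    then show ?case using 3(1,2) by (simp add: J_def write_cell_simps)
  qed
qed

lemma wp_lift_edge:
  assumes cf: "configured s" and e: "e = nat_mem s ''E'' 0 0" and u: "u = nat_mem s ''u'' 0 0"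
    and x: "real_mem s ''x'' e 0 = b / beta ^ nat_mem s ''k'' e 0"
  shows "wp lift_edge (\<lambda>t s'. t \<le> 100 * (node_levels s u + 1) \<and> agree {''k''} {''x''} s s' \<and>
     (\<forall>e'. e' \<noteq> e \<longrightarrow> nat_mem s' ''k'' e' = nat_mem s ''k'' e' \<and> real_mem s' ''x'' e' = real_mem s ''x'' e') \<and>
     nat_mem s ''k'' e 0 \<le> nat_mem s' ''k'' e 0 \<and> node_levels s u \<le> nat_mem s' ''k'' e 0 + offsets s e u \<and>
     (nat_mem s' ''k'' e 0 = nat_mem s ''k'' e 0 \<or> node_levels s u = nat_mem s' ''k'' e 0 + offsets s e u) \<and>
     real_mem s' ''x'' e 0 = b / beta ^ nat_mem s' ''k'' e 0) s"
proof -
  define J where "J s' \<longleftrightarrow> agree {''k''} {''x''} s s' \<and>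
     (\<forall>e'. e' \<noteq> e \<longrightarrow> nat_mem s' ''k'' e' = nat_mem s ''k'' e' \<and> real_mem s' ''x'' e' = real_mem s ''x'' e') \<and>
     nat_mem s ''k'' e 0 \<le> nat_mem s' ''k'' e 0 \<and>
     (nat_mem s' ''k'' e 0 = nat_mem s ''k'' e 0 \<or> nat_mem s' ''k'' e 0 + offsets s e u \<le> node_levels s u) \<and>
     real_mem s' ''x'' e 0 = b / beta ^ nat_mem s' ''k'' e 0" for s'
  have be: "real_mem s ''be'' 0 0 = beta" using cf by (simp add: configured_def)
  have fr: "nat_mem s' ''u'' = nat_mem s ''u''" "nat_mem s' ''E'' = nat_mem s ''E''" "nat_mem s' ''i'' = nat_mem s ''i''"
    "nat_mem s' ''d'' = nat_mem s ''d''" "real_mem s' ''be'' = real_mem s ''be''" if "J s'" for s'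
    using that by (auto simp: J_def frame)
  show ?thesis
    unfolding lift_edge_def
  proof (rule wp_while[where J = J and K = 50 and M = "\<lambda>s'. node_levels s u - nat_mem s' ''k'' e 0"], goal_cases)
    case (1 s')
    note fr = fr[OF 1(1)]
    have "nat_mem s' ''k'' e 0 + offsets s e u < node_levels s u"
      using 1(2) by (simp add: fr e[symmetric] u[symmetric])
    then show ?case
      using 1(1) be by (auto simp: J_def wp_simps write_cell_simps agree_def eq_off_write fr e[symmetric] u[symmetric])
  next
    case 2
    then show ?case using x by (simp add: J_def agree_refl)
  next
    case (3 t s')
    note fr = fr[OF 3(2)]
    have "node_levels s u \<le> nat_mem s' ''k'' e 0 + offsets s e u"
      using 3(3) by (simp add: fr e[symmetric] u[symmetric])
    moreover have "t \<le> 100 * (node_levels s u + 1)"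
    proof -
      have "(node_levels s u - nat_mem s ''k'' e 0) * 70 \<le> node_levels s u * 70" by simp
      then show ?thesis using 3(1) by simp
    qed
    ultimately show ?case using 3(2) by (auto simp: J_def)
  qed
qed

abbreviation placed :: "nat \<Rightarrow> real \<Rightarrow> nat set \<Rightarrow> memory \<Rightarrow> memory \<Rightarrow> bool" where
  "placed e b U s s' \<equiv>
     (\<forall>e'. e' \<noteq> e \<longrightarrow> nat_mem s' ''k'' e' = nat_mem s ''k'' e' \<and> nat_mem s' ''d'' e' = nat_mem s ''d'' e' \<and>
        real_mem s' ''x'' e' = real_mem s ''x'' e') \<and>
     (\<forall>u\<in>U. b * beta ^ offsets s' e u \<le> cap u \<and>
        (offsets s' e u \<le> L \<longrightarrow> cap u < b * beta ^ (offsets s' e u + 1)) \<and>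
        node_levels s u \<le> nat_mem s' ''k'' e 0 + offsets s' e u) \<and>
     (0 < nat_mem s' ''k'' e 0 \<longrightarrow> (\<exists>u\<in>U. node_levels s u = nat_mem s' ''k'' e 0 + offsets s' e u)) \<and>
     real_mem s' ''x'' e 0 = b / beta ^ nat_mem s' ''k'' e 0"

lemma wp_place_ends:
  assumes cf: "configured s" and e: "e = nat_mem s ''E'' 0 0" and deg: "nat_mem s ''deg'' 0 0 = length vs"
    and vs: "\<And>j. j < length vs \<Longrightarrow> nat_mem s ''v'' e j = vs ! j" "set vs \<subseteq> {..<n}" "distinct vs" "length vs \<le> f"
    and y: "real_mem s ''y'' 0 0 = b" "0 < b" "\<And>u. u \<in> set vs \<Longrightarrow> b \<le> cap u"
    and i: "\<And>v. v < n \<Longrightarrow> node_levels s v \<le> L"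
    and k0: "nat_mem s ''k'' e 0 = 0" and x: "real_mem s ''x'' e 0 = b"
  shows "wp place_ends (\<lambda>t s'. t \<le> 400 * (L + 2) * (f + 1) \<and> agree {''j'', ''u'', ''l'', ''d'', ''k''} {''z'', ''x''} s s' \<and>
     placed e b (set vs) s s') s"
proof -
  let ?N = "{''j'', ''u'', ''l'', ''d'', ''k''}" and ?R = "{''z'', ''x''}"
  define J where "J s' \<longleftrightarrow> (let j = nat_mem s' ''j'' 0 0 in j \<le> length vs \<and> agree ?N ?R s s' \<and>
     placed e b (set (take j vs)) s s')" for s'
  show ?thesis
    unfolding place_ends_def wp_simps(2,4)
  proof (rule wp_while[where J = J and K = "200 * (L + 2) + 100" and M = "\<lambda>s'. length vs - nat_mem s' ''j'' 0 0"], goal_cases)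
    case (1 s')
    define j where "j = nat_mem s' ''j'' 0 0"
    have J: "agree ?N ?R s s'"
     "\<forall>e'. e' \<noteq> e \<longrightarrow> nat_mem s' ''k'' e' = nat_mem s ''k'' e' \<and> nat_mem s' ''d'' e' = nat_mem s ''d'' e' \<and>
        real_mem s' ''x'' e' = real_mem s ''x'' e'"
     "\<forall>u\<in>set (take j vs). b * beta ^ offsets s' e u \<le> cap u \<and> (offsets s' e u \<le> L \<longrightarrow> cap u < b * beta ^ (offsets s' e u + 1)) \<and>
        node_levels s u \<le> nat_mem s' ''k'' e 0 + offsets s' e u"
     "0 < nat_mem s' ''k'' e 0 \<longrightarrow> (\<exists>u\<in>set (take j vs). node_levels s u = nat_mem s' ''k'' e 0 + offsets s' e u)"
     "real_mem s' ''x'' e 0 = b / beta ^ nat_mem s' ''k'' e 0"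
      using 1(1) unfolding J_def Let_def j_def by blast+
    have fr: "nat_mem s' ''E'' = nat_mem s ''E''" "nat_mem s' ''deg'' = nat_mem s ''deg''"
      "nat_mem s' ''v'' = nat_mem s ''v''" "nat_mem s' ''i'' = nat_mem s ''i''" "real_mem s' ''y'' = real_mem s ''y''"
      using J(1) by (auto simp: frame)
    have jl: "j < length vs" using 1(2) deg by (simp add: j_def fr)
    define u where "u = vs ! j"
    have u: "nat_mem s ''v'' e j = u" "u \<in> set vs" "u < n" using vs(1)[OF jl] jl subsetD[OF vs(2), of u] by (auto simp: u_def)
    have tk: "take (Suc j) vs = take j vs @ [u]" using jl by (simp add: u_def take_Suc_conv_app_nth)
    have "distinct (take (Suc j) vs)" using vs(3) by simp
    then have nt: "u \<notin> set (take j vs)" by (simp add: tk)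
    define s1 where "s1 = s'\<lparr>nat_mem := write_cell ''u'' 0 0 u (nat_mem s')\<rparr>"
    have s1: "nat_assigned ''u'' (NConst 0) (NConst 0) (NCell ''v'' (var ''E'') (var ''j'')) s' = s1"
      using u(1) by (simp add: s1_def fr j_def[symmetric] e[symmetric])
    have ag1: "agree ?N ?R s s1" using J(1) by (simp add: s1_def agree_def eq_off_write)
    have fr1: "nat_mem s1 a = nat_mem s' a" if "a \<noteq> ''u''" for a using that by (simp add: s1_def write_cell_simps)
    have rm1: "real_mem s1 = real_mem s'" by (simp add: s1_def)
    have cf1: "configured s1" by (rule configured_agree[OF cf ag1]) auto
    have u1: "u = nat_mem s1 ''u'' 0 0" by (simp add: s1_def write_cell_simps)
    show ?case
      unfolding wp_simps(2,4) s1
    proof (rule wp_mono[OF wp_find_offset[OF cf1 u1 u(3), of b]], goal_cases)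
      case 1 show ?case using y(1) by (simp add: rm1 fr)
    next
      case 2 show ?case by fact
    next
      case 3 show ?case using y(3) u(2) by simp
    next
      case (4 t2 s2)
      define l where "l = nat_mem s2 ''l'' 0 0"
      have F: "t2 \<le> 100 * (L + 2)" "agree {''l''} {''z''} s1 s2" "b * beta ^ l \<le> cap u" "l \<le> L \<longrightarrow> cap u < b * beta ^ (l + 1)"
        using 4 by (simp_all add: l_def)
      have fr2: "nat_mem s2 a = nat_mem s1 a" if "a \<noteq> ''l''" for a using that F(2) by (auto simp: frame)
      have rm2: "real_mem s2 a = real_mem s1 a" if "a \<noteq> ''z''" for a using that F(2) by (auto simp: frame)
      have ag2: "agree ?N ?R s s2" by (rule agree_trans[OF ag1 agree_mono[OF F(2)]]) auto
      have E2: "nat_mem s2 ''E'' 0 0 = e" "nat_mem s2 ''u'' 0 0 = u" using e u1 by (simp_all add: fr2 fr1 fr)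
      define s3 where "s3 = s2\<lparr>nat_mem := write_cell ''d'' e u l (nat_mem s2)\<rparr>"
      have s3: "nat_assigned ''d'' (var ''E'') (var ''u'') (var ''l'') s2 = s3"
        by (simp add: s3_def E2 l_def)
      have ag3: "agree ?N ?R s s3" using ag2 by (simp add: s3_def agree_def eq_off_write)
      have fr3: "nat_mem s3 a = nat_mem s2 a" if "a \<noteq> ''d''" for a using that by (simp add: s3_def write_cell_simps)
      have rm3: "real_mem s3 = real_mem s2" by (simp add: s3_def)
      have cf3: "configured s3" by (rule configured_agree[OF cf ag3]) auto
      have d3: "nat_mem s3 ''d'' e u = l" "u' \<noteq> u \<Longrightarrow> nat_mem s3 ''d'' e u' = nat_mem s' ''d'' e u'"
        "e' \<noteq> e \<Longrightarrow> nat_mem s3 ''d'' e' = nat_mem s' ''d'' e'" for u' e'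
        by (simp_all add: s3_def write_cell_simps fr2 fr1)
      have k3: "nat_mem s3 ''k'' = nat_mem s' ''k''" "real_mem s3 ''x'' = real_mem s' ''x''" "nat_mem s3 ''i'' = nat_mem s ''i''"
        by (simp_all add: fr3 fr2 fr1 rm3 rm2 rm1 fr)
      show ?case
        unfolding wp_simps(2) s3 wp_simps(4)
      proof (rule wp_mono[OF wp_lift_edge[OF cf3, of e u b]], goal_cases)
        case 1 show ?case using E2 by (simp add: fr3)
      next
        case 2 show ?case using E2 by (simp add: fr3)
      next
        case 3 show ?case using J(5) by (simp add: k3)
      next
        case (4 t4 s4)
        let ?k' = "nat_mem s' ''k'' e 0" and ?k4 = "nat_mem s4 ''k'' e 0"
        have G: "t4 \<le> 100 * (node_levels s u + 1)" "agree {''k''} {''x''} s3 s4"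
          "\<forall>e'. e' \<noteq> e \<longrightarrow> nat_mem s4 ''k'' e' = nat_mem s' ''k'' e' \<and> real_mem s4 ''x'' e' = real_mem s' ''x'' e'"
          "?k' \<le> ?k4" "node_levels s u \<le> ?k4 + l" "?k4 = ?k' \<or> node_levels s u = ?k4 + l"
          "real_mem s4 ''x'' e 0 = b / beta ^ ?k4"
          using 4 by (simp_all add: k3 d3(1))
        have ag4: "agree ?N ?R s s4" by (rule agree_trans[OF ag3 agree_mono[OF G(2)]]) auto
        have fr4: "nat_mem s4 a = nat_mem s3 a" if "a \<noteq> ''k''" for a using that G(2) by (auto simp: frame)
        have j4: "nat_mem s4 ''j'' 0 0 = j" by (simp add: fr4 fr3 fr2 fr1 j_def)
        have d4: "nat_mem s4 ''d'' = nat_mem s3 ''d''" by (simp add: fr4)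
        define s5 where "s5 = s4\<lparr>nat_mem := write_cell ''j'' 0 0 (Suc j) (nat_mem s4)\<rparr>"
        have s5: "nat_assigned ''j'' (NConst 0) (NConst 0) (NAdd (var ''j'') (NConst 1)) s4 = s5"
          by (simp add: s5_def j4)
        have fr5: "nat_mem s5 a = nat_mem s4 a" if "a \<noteq> ''j''" for a using that by (simp add: s5_def write_cell_simps)
        have rm5: "real_mem s5 = real_mem s4" by (simp add: s5_def)
        have j5: "nat_mem s5 ''j'' 0 0 = Suc j" by (simp add: s5_def write_cell_simps)
        have ag5: "agree ?N ?R s s5" using ag4 by (simp add: s5_def agree_def eq_off_write)
        have J3: "\<forall>u\<in>set (take (Suc j) vs). b * beta ^ offsets s5 e u \<le> cap u \<and>
            (offsets s5 e u \<le> L \<longrightarrow> cap u < b * beta ^ (offsets s5 e u + 1)) \<and>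
            node_levels s u \<le> nat_mem s5 ''k'' e 0 + offsets s5 e u"
        proof
          fix u' assume u': "u' \<in> set (take (Suc j) vs)"
          show "b * beta ^ offsets s5 e u' \<le> cap u' \<and>
            (offsets s5 e u' \<le> L \<longrightarrow> cap u' < b * beta ^ (offsets s5 e u' + 1)) \<and>
            node_levels s u' \<le> nat_mem s5 ''k'' e 0 + offsets s5 e u'"
          proof (cases "u' = u")
            case True
            then show ?thesis using F G by (simp add: fr5 d4 d3(1))
          next
            case False
            then have "u' \<in> set (take j vs)" using u' by (auto simp: tk)
            then show ?thesis using J(3) False G(4) by (fastforce simp: fr5 d4 d3(2))
          qed
        qed
        \<comment> \<open>If lifting stopped exactly at the level of \<open>u\<close>, the new
          endpoint attains the maximum. Otherwise nothing was lifted and the earlier endpoint still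
          does.\<close>
        have J4: "\<exists>u\<in>set (take (Suc j) vs). node_levels s u = nat_mem s5 ''k'' e 0 + offsets s5 e u" if "0 < nat_mem s5 ''k'' e 0"
        proof (cases "node_levels s u = ?k4 + l")
          case True
          then show ?thesis by (intro bexI[of _ u]) (simp_all add: fr5 d4 d3(1) tk)
        next
          case False
          then have kk: "?k4 = ?k'" using G(6) by blast
          then obtain u' where "u' \<in> set (take j vs)" "node_levels s u' = ?k' + offsets s' e u'"
            using J(4) \<open>0 < nat_mem s5 ''k'' e 0\<close> by (auto simp: fr5)
          moreover have "u' \<noteq> u" using calculation nt by auto
          ultimately show ?thesis by (intro bexI[of _ u']) (simp_all add: fr5 d4 d3(2) tk kk)
        qed
        have J2: "nat_mem s5 ''k'' e' = nat_mem s ''k'' e' \<and> nat_mem s5 ''d'' e' = nat_mem s ''d'' e' \<and>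
            real_mem s5 ''x'' e' = real_mem s ''x'' e'" if "e' \<noteq> e" for e'
          using J(2) G(3) d3(3)[OF that] that by (simp add: fr5 rm5 d4)
        have "J s5" unfolding J_def Let_def j5 using jl ag5 J2 J3 J4 G(7) by (simp add: rm5 fr5)
        moreover have "t4 \<le> 100 * (L + 1)"
        proof -
          have "node_levels s u \<le> L" using i u(3) by simp
          then show ?thesis using G(1) by simp
        qed
        ultimately show ?case
          unfolding wp_simps(2) s5 using F(1) jl j5 by (simp add: j_def[symmetric])
      qed
    qed
  next
    case 2
    then show ?case
      using k0 x by (simp add: J_def write_cell_simps framed)
  next
    case (3 t s')
    have "nat_mem s' ''deg'' = nat_mem s ''deg''" using 3 by (auto simp: J_def Let_def frame)
    then have j: "nat_mem s' ''j'' 0 0 = length vs" using 3 deg by (auto simp: J_def Let_def)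
    have "length vs * (200 * (L + 2) + 110) \<le> f * (200 * (L + 2) + 110)" using vs(4) by (intro mult_right_mono) auto
    also have "\<dots> \<le> f * (400 * (L + 2))" by (intro mult_left_mono) auto
    finally have "t + 20 \<le> 400 * (L + 2) * (f + 1)" using 3(1) by (simp add: write_cell_simps algebra_simps)
    then show ?case using 3(2) unfolding J_def Let_def j by simp
  qed
qed

end

lemma wp_NAssign_Seq:
  "wp (NAssign a i j b;; P) Q s \<longleftrightarrow> wp P (\<lambda>t. Q (1 + (1 + ncost i + ncost j + ncost b) + t))
     (s\<lparr>nat_mem := write_cell a (nval i s) (nval j s) (nval b s) (nat_mem s)\<rparr>)"
  by (simp only: wp_simps)

lemma wp_mono_state: "wp P Q s \<Longrightarrow> s = s1 \<Longrightarrow> (\<And>t s'. Q t s' \<Longrightarrow> R t s') \<Longrightarrow> wp P R s1"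
  using wp_mono by blast

context level_scheme
begin

section \<open>Correctness and cost of a whole update\<close>

lemma edge_level_ok_cong:
  assumes "G' e = G e" "d' e = d e" "k' e = k e"
  shows "edge_level_ok G' d' k' i e \<longleftrightarrow> edge_level_ok G d k i e"
  using assms by (simp add: edge_level_ok_def offset_ok_def base_def)

lemma graph_ok_insert:
  assumes "graph_ok G" "e \<notin> dom G" "card (dom G) + 1 \<le> m" "U \<subseteq> {..<n}" "card U \<le> f"
  shows "graph_ok (G(e \<mapsto> U))"
  using assms by (auto simp: graph_ok_def)

lemma graph_ok_delete: "graph_ok G \<Longrightarrow> graph_ok (G(e := None))"
  unfolding graph_ok_def
proof (intro conjI, goal_cases)
  case 2
  then have "card (dom G - {e}) \<le> card (dom G)" by (intro card_mono) auto
  then show ?case using 2 by simp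
qed auto

text \<open>Node levels stay fixed and only the new edge is fitted to them. So only its endpoints
  can become unsettled, and these are what \<open>add_edge\<close> pushes.\<close>

lemma wp_insert_edge:
  assumes rep: "represents G s" and cf: "configured s"
    and ok: "levels_ok G (offsets s) (edge_levels s) (node_levels s)"
    and st: "stack s = []" and settled: "\<And>v. v < n \<Longrightarrow> settled G (edge_levels s) (node_levels s) v"
    and e: "nat_mem s ''edge'' 0 0 = e" "e \<notin> dom G" "card (dom G) + 1 \<le> m"
    and deg: "nat_mem s ''deg'' 0 0 = length vs" and ends: "\<And>j. j < length vs \<Longrightarrow> nat_mem s ''ends'' j 0 = vs ! j"
    and vs: "distinct vs" "set vs \<subseteq> {..<n}" "length vs \<le> f"
  shows "wp insert_edge (\<lambda>t s'. t \<le> 1000 * (L + 2) * (f + 1) \<and> pending (G(e \<mapsto> set vs)) s' \<and>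
     agree changed {''W'', ''x'', ''y'', ''z''} s s' \<and>
     credit (G(e \<mapsto> set vs)) s' \<le> credit G s + 4000 * (4 * real f * level_price * real L + real f)) s"
proof -
  let ?G = "G(e \<mapsto> set vs)" and ?R = "{''W'', ''x'', ''y'', ''z''}"
  define b where "b = Min (insert mu (c ` set vs))"
  have G: "graph_ok G" using rep by (simp add: represents_def)
  have G': "graph_ok ?G" using graph_ok_insert[OF G e(2,3) vs(2)] vs(3) card_length[of vs] by simp
  have eG: "e \<in> dom ?G" by simp
  have bG: "base ?G e = b" by (simp add: base_def b_def)
  have b0: "0 < b" using base_pos[OF G' eG] by (simp add: bG)
  have bcap: "b \<le> cap u" if "u \<in> set vs" for u
    using that by (auto simp: b_def cap_def)
  define s1 where "s1 = s\<lparr>nat_mem := write_cell ''k'' e 0 0 (write_cell ''g'' e 0 (length vs) (write_cell ''E'' 0 0 e (nat_mem s)))\<rparr>"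
  have ag1: "agree changed ?R s s1" by (simp add: s1_def framed changed_def)
  have cf1: "configured s1" by (rule configured_agree[OF cf ag1]) (auto simp: names)
  have E1: "e = nat_mem s1 ''E'' 0 0" by (simp add: s1_def write_cell_simps)
  \<comment> \<open>The three initial assignments are split off as the passage to \<open>s1\<close>;
    the additional 50 pays for them and for the sequencing.\<close>
  have "wp (read_ends;; RAssign ''x'' (var ''E'') (NConst 0) (rvar ''y'');; place_ends;; add_edge)
     (\<lambda>t s'. t + 50 \<le> 1000 * (L + 2) * (f + 1) \<and> pending ?G s' \<and> agree changed ?R s s' \<and>
     credit ?G s' \<le> credit G s + 4000 * (4 * real f * level_price * real L + real f)) s1"
    unfolding wp_simps(4)
  proof (rule wp_mono[OF wp_read_ends[OF cf1 E1, of vs]], goal_cases)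
    case 1 show ?case using deg by (simp add: s1_def write_cell_simps)
  next
    case (2 j) then show ?case using ends by (simp add: s1_def write_cell_simps)
  next
    case 3 show ?case by fact
  next
    case (4 t2 s2)
    have A: "t2 \<le> 100 * (length vs + 1)" "agree {''j'', ''u'', ''v''} {''y''} s1 s2"
      "\<And>e'. e' \<noteq> e \<Longrightarrow> nat_mem s2 ''v'' e' = nat_mem s1 ''v'' e'"
      "\<And>j. j < length vs \<Longrightarrow> nat_mem s2 ''v'' e j = vs ! j" "real_mem s2 ''y'' 0 0 = b"
      using 4 by (auto simp: b_def)
    have ag2: "agree changed ?R s s2" by (rule agree_trans[OF ag1 agree_mono[OF A(2)]]) (auto simp: names)
    have E2: "nat_mem s2 ''E'' 0 0 = e" using A(2) E1 by (simp add: frame)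
    define s3 where "s3 = s2\<lparr>real_mem := write_cell ''x'' e 0 b (real_mem s2)\<rparr>"
    have s3: "s2\<lparr>real_mem := write_cell ''x'' (nval (var ''E'') s2) (nval (NConst 0) s2) (rval (rvar ''y'') s2) (real_mem s2)\<rparr> = s3"
      by (simp add: s3_def E2 A(5))
    have ag3: "agree changed ?R s s3" using ag2 by (simp add: s3_def agree_def eq_off_write)
    have cf3: "configured s3" by (rule configured_agree[OF cf ag3]) (auto simp: names)
    have n3: "nat_mem s3 = nat_mem s2" by (simp add: s3_def)
    have i3: "nat_mem s3 ''i'' = nat_mem s ''i''" "nat_mem s3 ''deg'' = nat_mem s ''deg''"
      using ag3 by (auto simp: frame)
    have k2: "nat_mem s2 ''k'' = nat_mem s1 ''k''" using A(2) by (auto simp: frame)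
    show ?case
      unfolding wp_simps(3) s3
    proof (rule wp_mono[OF wp_place_ends[OF cf3, of e vs b]], goal_cases)
      case 1 show ?case using E2 by (simp add: n3)
    next
      case 2 show ?case using deg by (simp add: i3)
    next
      case (3 j) then show ?case using A(4) by (simp add: n3)
    next
      case 4 show ?case by fact
    next
      case 5 show ?case by fact
    next
      case 6 show ?case by fact
    next
      case 7 show ?case using A(5) by (simp add: s3_def write_cell_simps)
    next
      case 8 show ?case by fact
    next
      case (9 u) then show ?case by (rule bcap)
    next
      case (10 v) then show ?case using ok by (simp add: i3 levels_ok_def)
    next
      case 11 show ?case by (simp add: n3 k2 s1_def write_cell_simps)
    next
      case 12 show ?case by (simp add: s3_def write_cell_simps)
    next
      case (13 t4 s4)
      let ?k = "nat_mem s4 ''k'' e 0"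
      have B: "t4 \<le> 400 * (L + 2) * (f + 1)" "agree {''j'', ''u'', ''l'', ''d'', ''k''} {''z'', ''x''} s3 s4"
        "\<And>e'. e' \<noteq> e \<Longrightarrow> nat_mem s4 ''k'' e' = nat_mem s3 ''k'' e' \<and> nat_mem s4 ''d'' e' = nat_mem s3 ''d'' e' \<and>
          real_mem s4 ''x'' e' = real_mem s3 ''x'' e'"
        "\<And>u. u \<in> set vs \<Longrightarrow> b * beta ^ offsets s4 e u \<le> cap u \<and>
          (offsets s4 e u \<le> L \<longrightarrow> cap u < b * beta ^ (offsets s4 e u + 1)) \<and> node_levels s u \<le> ?k + offsets s4 e u"
        "0 < ?k \<Longrightarrow> \<exists>u\<in>set vs. node_levels s u = ?k + offsets s4 e u"
        "real_mem s4 ''x'' e 0 = b / beta ^ ?k"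
        using 13 by (simp_all add: i3)
      have ag4: "agree changed ?R s s4" by (rule agree_trans[OF ag3 agree_mono[OF B(2)]]) (auto simp: names)
      have fr4: "nat_mem s4 a = nat_mem s1 a" if "a \<notin> {''j'', ''u'', ''l'', ''d'', ''k'', ''v''}" for a
        using that A(2) B(2) n3 by (auto simp: frame)
      have v4: "nat_mem s4 ''v'' = nat_mem s2 ''v''" using B(2) n3 by (auto simp: frame)
      have k4: "nat_mem s4 ''k'' e' = nat_mem s ''k'' e'" "nat_mem s4 ''d'' e' = nat_mem s ''d'' e'"
        "real_mem s4 ''x'' e' = real_mem s ''x'' e'" if "e' \<noteq> e" for e'
      proof -
        have d2: "nat_mem s2 ''d'' = nat_mem s1 ''d''" "real_mem s2 ''x'' = real_mem s1 ''x''" using A(2) by (auto simp: frame)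
        show "nat_mem s4 ''k'' e' = nat_mem s ''k'' e'" "nat_mem s4 ''d'' e' = nat_mem s ''d'' e'"
          "real_mem s4 ''x'' e' = real_mem s ''x'' e'"
          using B(3)[OF that] that by (simp_all add: n3 k2 d2 s3_def s1_def write_cell_simps)
      qed
      have W4: "real_mem s4 ''W'' = real_mem s ''W''"
        using A(2) B(2) by (simp add: frame s3_def s1_def write_cell_simps)
      have ends4: "ends s4 e' = (if e' = e then vs else ends s e')" for e'
      proof (cases "e' = e")
        case True
        then show ?thesis using A(4) by (auto simp: ends_def v4 fr4 s1_def write_cell_simps intro!: nth_equalityI)
      next
        case False
        then show ?thesis using A(3)[OF False] by (simp add: ends_def v4 fr4 s1_def write_cell_simps)
      qed
      have st4: "stack s4 = []" using st by (simp add: stack_def fr4 s1_def write_cell_simps)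
      have bk4: "bucketed s4 (bucket_keys G s)"
        using rep by (simp add: represents_def bucketed_def fr4 s1_def write_cell_simps)
      have E4: "e = nat_mem s4 ''E'' 0 0" by (simp add: fr4 s1_def write_cell_simps)
      show ?case
      proof (rule wp_mono[OF wp_add_edge[OF bk4 E4]], goal_cases)
        case 1 show ?case using vs(1) by (simp add: ends4)
      next
        case (2 u)
        have "e \<notin> edges_at G u" using e(2) by (simp add: edges_at_def)
        then show ?case by (simp add: bucket_keys_def)
      next
        case (3 t5 s5)
        have C: "t5 \<le> 250 * (length vs + 1)" "agree scratch {''W''} s4 s5"
          "bucketed s5 (\<lambda>e' u. if e' = e \<and> u \<in> set vs then Some (?k + offsets s4 e u) else bucket_keys G s e' u)"
          "stack s5 = vs" "\<And>u. real_mem s5 ''W'' u 0 = real_mem s ''W'' u 0 + (if u \<in> set vs then b / beta ^ ?k else 0)"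
          using 3 by (simp_all add: ends4 st4 W4 B(6))
        have ag5: "agree changed ?R s s5" by (rule agree_trans[OF ag4 agree_mono[OF C(2)]]) (auto simp: changed_def)
        have cf5: "configured s5" by (rule configured_agree[OF cf ag5]) (auto simp: names)
        have fr5: "nat_mem s5 ''k'' = nat_mem s4 ''k''" "nat_mem s5 ''d'' = nat_mem s4 ''d''" "nat_mem s5 ''v'' = nat_mem s4 ''v''"
          "nat_mem s5 ''g'' = nat_mem s4 ''g''" "real_mem s5 ''x'' = real_mem s4 ''x''"
          using C(2) by (auto simp: frame)
        have i5: "nat_mem s5 ''i'' = nat_mem s ''i''" using ag5 by (auto simp: frame)
        have ends5: "ends s5 = ends s4" by (simp add: ends_def fr5 fun_eq_iff)
        have ne: "e' \<noteq> e" if "e' \<in> dom G" for e' using that e(2) by blast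
        have k5: "edge_levels s5 e' = edge_levels s e'" if "e' \<in> dom G" for e' using k4(1)[OF ne[OF that]] by (simp add: fr5)
        have xe: "xval ?G (edge_levels s5) e = b / beta ^ ?k" by (simp add: xval_def bG fr5)
        have rep5: "represents ?G s5"
          unfolding represents_def
        proof (intro conjI ballI allI)
          show "graph_ok ?G" by fact
        next
          fix e' assume e': "e' \<in> dom ?G"
          show "distinct (ends s5 e')" "set (ends s5 e') = the (?G e')"
            using rep vs(1) e' by (auto simp: ends5 ends4 represents_def)
          show "real_mem s5 ''x'' e' 0 = xval ?G (edge_levels s5) e'"
          proof (cases "e' = e")
            case True
            then show ?thesis using B(6) xe by (simp add: fr5)
          next
            case False
            then have "e' \<in> dom G" using e' by simp
            then show ?thesis using rep False k4[OF False] by (simp add: represents_def fr5 xval_def base_def)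
          qed
        next
          fix v
          show "real_mem s5 ''W'' v 0 = load ?G (edge_levels s5) v"
            using rep C(5) load_insert[OF G e(2) k5, where U = "set vs" and v = v] xe by (simp add: represents_def)
        next
          have "(\<lambda>e' u. if e' = e \<and> u \<in> set vs then Some (?k + offsets s4 e u) else bucket_keys G s e' u) = bucket_keys ?G s5"
          proof (intro ext)
            fix e' u
            show "(if e' = e \<and> u \<in> set vs then Some (?k + offsets s4 e u) else bucket_keys G s e' u) = bucket_keys ?G s5 e' u"
            proof (cases "e' = e")
              case True
              then show ?thesis using e(2) by (simp add: bucket_keys_def fr5 edges_at_def domIff)
            next
              case False
              then show ?thesis using k4[OF False] by (simp add: bucket_keys_def fr5 edges_at_def)
            qed
          qed
          then show "bucketed s5 (bucket_keys ?G s5)" using C(3) by simp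
        qed
        have ok5: "levels_ok ?G (offsets s5) (edge_levels s5) (node_levels s5)"
          unfolding levels_ok_def
        proof (intro conjI ballI)
          show "graph_ok ?G" by fact
          show "\<forall>v<n. node_levels s5 v \<le> L" using ok by (simp add: i5 levels_ok_def)
        next
          fix e' assume e': "e' \<in> dom ?G"
          show "edge_level_ok ?G (offsets s5) (edge_levels s5) (node_levels s5) e'"
          proof (cases "e' = e")
            case True
            then show ?thesis using B(4,5) by (simp add: edge_level_ok_def offset_ok_def bG fr5 i5)
          next
            case False
            then have "edge_level_ok G (offsets s) (edge_levels s) (node_levels s) e'" using ok e' by (simp add: levels_ok_def)
            then show ?thesis using False k4[OF False]
              by (subst edge_level_ok_cong[of _ _ G _ "offsets s" _ "edge_levels s"]) (simp_all add: fr5 i5)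
          qed
        qed
        have "settled ?G (edge_levels s5) (node_levels s5) v" if "v < n" "v \<notin> set vs" for v
          using settled[OF that(1)] load_insert[OF G e(2) k5, where U = "set vs" and v = v] that by (simp add: settled_def i5)
        then have "pending ?G s5"
          unfolding pending_def using rep5 cf5 ok5 vs(2) C(4) by auto
        moreover have "credit ?G s5 \<le> credit G s + 4000 * (4 * real f * level_price * real L + real f)"
          using potential_insert[OF G G' e(2), of "edge_levels s5" "edge_levels s" "node_levels s", OF k5] vs(3) st C(4)
          by (simp add: credit_def i5)
        moreover have "t2 + t4 + t5 + 100 \<le> 1000 * (L + 2) * (f + 1)"
        proof -
          define q where "q = (L + 2) * (f + 1)"
          have "length vs + 1 \<le> f + 1" using vs(3) by simp
          also have "\<dots> \<le> q" by (simp add: q_def)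
          finally have "length vs + 1 \<le> q" .
          then have "t2 \<le> 100 * q" "t5 \<le> 250 * q" using order_trans[OF A(1) mult_le_mono2] order_trans[OF C(1) mult_le_mono2] by blast+
          moreover have "t4 \<le> 400 * q" using B(1) by (simp only: q_def mult.assoc)
          moreover have "1 \<le> q" by (simp add: q_def)
          ultimately have "t2 + t4 + t5 + 100 \<le> 1000 * q" by linarith
          then show ?thesis by (simp only: q_def mult.assoc)
        qed
        ultimately show ?case using ag5 by simp
      qed
    qed
  qed
  from this show ?thesis
    unfolding insert_edge_def wp_NAssign_Seq
    by (rule wp_mono_state) (auto simp: s1_def e(1) deg write_cell_simps)
qed

text \<open>The level of an edge depends on the node levels and on its own offsets alone, so the
  remaining edges are undisturbed. The stored data of \<open>e\<close> go stale; a later insertion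
  under the same name overwrites what is read for its endpoints.\<close>

lemma wp_delete_edge:
  assumes rep: "represents G s" and cf: "configured s"
    and ok: "levels_ok G (offsets s) (edge_levels s) (node_levels s)"
    and st: "stack s = []" and settled: "\<And>v. v < n \<Longrightarrow> settled G (edge_levels s) (node_levels s) v"
    and e: "nat_mem s ''edge'' 0 0 = e" "e \<in> dom G"
  shows "wp delete_edge (\<lambda>t s'. t \<le> 1000 * (L + 2) * (f + 1) \<and> pending (G(e := None)) s' \<and>
     agree changed {''W'', ''x'', ''y'', ''z''} s s' \<and>
     credit (G(e := None)) s' \<le> credit G s + 4000 * (4 * real f * real f * loss_price + real f)) s"
proof -
  let ?G = "G(e := None)" and ?R = "{''W'', ''x'', ''y'', ''z''}"
  have G: "graph_ok G" using rep by (simp add: represents_def)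
  note G' = graph_ok_delete[OF G, of e]
  define s1 where "s1 = s\<lparr>nat_mem := write_cell ''E'' 0 0 e (nat_mem s)\<rparr>"
  have s1: "nat_assigned ''E'' (NConst 0) (NConst 0) (var ''edge'') s = s1"
    by (simp add: s1_def e(1))
  have ag1: "agree {''E''} {} s s1" by (simp add: s1_def framed)
  have fr1: "nat_mem s1 a = nat_mem s a" if "a \<noteq> ''E''" for a using that by (simp add: s1_def write_cell_simps)
  have rm1: "real_mem s1 = real_mem s" by (simp add: s1_def)
  have ends1: "ends s1 e' = ends s e'" for e' by (simp add: ends_def fr1)
  have en: "distinct (ends s e)" "set (ends s e) = the (G e)" using rep e(2) by (auto simp: represents_def)
  have bk1: "bucketed s1 (bucket_keys G s)" using rep by (simp add: represents_def bucketed_def fr1)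
  have E1: "e = nat_mem s1 ''E'' 0 0" by (simp add: s1_def write_cell_simps)
  show ?thesis
    unfolding delete_edge_def wp_simps(2,4) s1
  proof (rule wp_mono[OF wp_remove_edge[OF bk1 E1]], goal_cases)
    case 1 show ?case using en by (simp add: ends1)
  next
    case (2 u)
    then have "e \<in> edges_at G u" using en e(2) by (simp add: ends1 edges_at_def)
    then show ?case by (simp add: bucket_keys_def fr1)
  next
    case (3 t s2)
    have x: "real_mem s ''x'' e 0 = xval G (edge_levels s) e" using rep e(2) by (simp add: represents_def)
    have C: "t \<le> 250 * (length (ends s e) + 1)" "agree scratch {''W''} s1 s2"
      "bucketed s2 (\<lambda>e' u. if e' = e \<and> u \<in> the (G e) then None else bucket_keys G s e' u)"
      "stack s2 = ends s e"
      "\<And>u. real_mem s2 ''W'' u 0 = real_mem s ''W'' u 0 - (if u \<in> the (G e) then xval G (edge_levels s) e else 0)"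
      using 3 st by (simp_all add: ends1 en rm1 x stack_def fr1)
    have "agree changed ?R s s1" by (rule agree_mono[OF ag1]) (auto simp: changed_def)
    then have ag2: "agree changed ?R s s2" by (rule agree_trans[OF _ agree_mono[OF C(2)]]) (auto simp: changed_def)
    have cf2: "configured s2" by (rule configured_agree[OF cf ag2]) (auto simp: names)
    have fr2: "nat_mem s2 ''k'' = nat_mem s ''k''" "nat_mem s2 ''d'' = nat_mem s ''d''" "nat_mem s2 ''v'' = nat_mem s ''v''"
      "nat_mem s2 ''g'' = nat_mem s ''g''" "real_mem s2 ''x'' = real_mem s ''x''" "nat_mem s2 ''i'' = nat_mem s ''i''"
      using C(2) by (auto simp: frame fr1 rm1)
    have ends2: "ends s2 = ends s" by (simp add: ends_def fr2 fun_eq_iff)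
    have rep2: "represents ?G s2"
      unfolding represents_def
    proof (intro conjI ballI allI)
      show "graph_ok ?G" by fact
    next
      fix e' assume e': "e' \<in> dom ?G"
      then have ne: "e' \<noteq> e" and d: "e' \<in> dom G" by auto
      show "distinct (ends s2 e')" "set (ends s2 e') = the (?G e')"
        using rep ne d by (auto simp: ends2 represents_def)
      show "real_mem s2 ''x'' e' 0 = xval ?G (edge_levels s2) e'"
        using rep ne d by (simp add: represents_def fr2 xval_def base_def)
    next
      fix v
      show "real_mem s2 ''W'' v 0 = load ?G (edge_levels s2) v"
        using rep C(5) load_delete[OF G e(2), of "edge_levels s" v] by (simp add: represents_def fr2)
    next
      have "(\<lambda>e' u. if e' = e \<and> u \<in> the (G e) then None else bucket_keys G s e' u) = bucket_keys ?G s2"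
        by (auto simp: fun_eq_iff bucket_keys_def edges_at_def fr2)
      then show "bucketed s2 (bucket_keys ?G s2)" using C(3) by simp
    qed
    have ok2: "levels_ok ?G (offsets s2) (edge_levels s2) (node_levels s2)"
      unfolding levels_ok_def
    proof (intro conjI ballI)
      show "graph_ok ?G" by fact
      show "\<forall>v<n. node_levels s2 v \<le> L" using ok by (simp add: fr2 levels_ok_def)
    next
      fix e' assume e': "e' \<in> dom ?G"
      then have ne: "e' \<noteq> e" and d: "e' \<in> dom G" by auto
      then have "edge_level_ok G (offsets s) (edge_levels s) (node_levels s) e'" using ok by (simp add: levels_ok_def)
      then show "edge_level_ok ?G (offsets s2) (edge_levels s2) (node_levels s2) e'"
        using ne by (subst edge_level_ok_cong[of _ _ G _ "offsets s" _ "edge_levels s"]) (simp_all add: fr2)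
    qed
    have sub: "the (G e) \<subseteq> {..<n}" by (rule graph_okD(2)[OF G e(2)])
    have "settled ?G (edge_levels s2) (node_levels s2) v" if "v < n" "v \<notin> the (G e)" for v
      using settled[OF that(1)] load_delete[OF G e(2), of "edge_levels s" v] that by (simp add: settled_def fr2)
    then have "pending ?G s2"
      unfolding pending_def using rep2 cf2 ok2 C(4) en sub by auto
    moreover have len: "length (ends s e) \<le> f" by (rule ends_length[OF rep e(2)])
    moreover have "credit ?G s2 \<le> credit G s + 4000 * (4 * real f * real f * loss_price + real f)"
      using potential_delete[OF ok e(2)] len st C(4) by (simp add: credit_def fr2)
    moreover have "t + 50 \<le> 1000 * (L + 2) * (f + 1)"
    proof -
      define q where "q = (L + 2) * (f + 1)"
      have "length (ends s e) + 1 \<le> f + 1" using len by simp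
      also have "\<dots> \<le> q" by (simp add: q_def)
      finally have "t \<le> 250 * q" using order_trans[OF C(1) mult_le_mono2] by blast
      moreover have "1 \<le> q" by (simp add: q_def)
      ultimately have "t + 50 \<le> 1000 * q" by linarith
      then show ?thesis by (simp only: q_def mult.assoc)
    qed
    ultimately show ?case using ag2 by simp
  qed
qed

end

section \<open>The dynamic algorithm\<close>

definition matching_program :: com where
  "matching_program = setup_constants;;
   Cond (NLess (var ''op'') (NConst 1)) insert_edge delete_edge;; settle"

lemma process_Nil_iff: "process P s [] t s' \<longleftrightarrow> t = 0 \<and> s' = s"
  by (auto intro: process.Nil elim: process_elims)

text \<open>Lets an amount charged to each edge present at the end be charged to the updates
  instead.\<close>

lemma card_current_graph_le: "finite (dom G) \<Longrightarrow>
    finite (dom (fold apply_update us G)) \<and> card (dom (fold apply_update us G)) \<le> card (dom G) + length us"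
proof (induction us arbitrary: G)
  case (Cons u us)
  have "finite (dom (apply_update u G)) \<and> card (dom (apply_update u G)) \<le> Suc (card (dom G))"
  proof (cases u)
    case (Insert e vs)
    then show ?thesis using Cons.prems by (simp add: card_insert_if)
  next
    case (Delete e)
    then show ?thesis using Cons.prems card_mono[of "dom G" "dom G - {e}"] by (auto intro: le_SucI)
  qed
  then show ?case using Cons.IH[of "apply_update u G"] by simp
qed simp

context level_scheme
begin

text \<open>The invariant between two runs. It contains the input data of \<open>loaded\<close> but
  not the derived constants of \<open>configured\<close>, which every run computes afresh.\<close>

definition idle :: "graph \<Rightarrow> memory \<Rightarrow> bool" where
  "idle G s \<longleftrightarrow> represents G s \<and> loaded s \<and> levels_ok G (offsets s) (edge_levels s) (node_levels s) \<and>
     stack s = [] \<and> (\<forall>v<n. settled G (edge_levels s) (node_levels s) v)"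

text \<open>The first summand is the time before settling; the second is the credit to be added,
  with the costs of an insertion and of a deletion summed so that one price fits both.\<close>

definition update_price :: real where
  "update_price = 1200 * ((real L + 2) * (real f + 1)) +
     4000 * (4 * real f * level_price * real L + 4 * real f * real f * loss_price + real f)"

lemma loaded_agree:
  assumes "loaded s" "agree N R s s'" "N \<inter> {''m'', ''f''} = {}" "R \<inter> {''eps'', ''mu'', ''c''} = {}"
  shows "loaded s'"
proof -
  have "nat_mem s' a = nat_mem s a" if "a \<in> {''m'', ''f''}" for a
    using agreeD(1)[OF assms(2)] assms(3) that by blast
  moreover have "real_mem s' a = real_mem s a" if "a \<in> {''eps'', ''mu'', ''c''}" for a
    using agreeD(2)[OF assms(2)] assms(4) that by blast
  ultimately show ?thesis using assms(1) by (simp add: loaded_def)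
qed

lemma idle_agree:
  assumes "idle G s" "agree {''op'', ''edge'', ''deg'', ''ends'', ''L''} {''be'', ''la'', ''y''} s s'"
  shows "idle G s'" "credit G s' = credit G s"
proof -
  have "represents G s'" "loaded s'"
    using assms(1) represents_agree[OF _ assms(2), of G] loaded_agree[OF _ assms(2)] by (auto simp: idle_def)
  moreover have fr: "nat_mem s' ''k'' = nat_mem s ''k''" "nat_mem s' ''d'' = nat_mem s ''d''" "nat_mem s' ''i'' = nat_mem s ''i''"
    "nat_mem s' ''S'' = nat_mem s ''S''" "nat_mem s' ''h'' = nat_mem s ''h''"
    using assms(2) by (auto simp: frame)
  ultimately show "idle G s'" using assms(1) by (simp add: idle_def stack_def)
  show "credit G s' = credit G s" by (simp add: credit_def stack_def fr)
qed

lemma wp_settle_idle: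
  assumes pd: "pending G s" and ld: "loaded s"
  shows "wp settle (\<lambda>t s'. idle G s' \<and> real t \<le> credit G s - credit G s' + 10) s"
proof (rule wp_mono[OF wp_settle[OF pd]], goal_cases)
  case (1 t s')
  then have "loaded s'"
    by (intro loaded_agree[OF ld, of "insert ''w'' moved" "{''W'', ''x''}"]) (auto simp: names)
  then show ?case using 1 by (auto simp: idle_def pending_def)
qed

lemma wp_matching_program:
  assumes idle: "idle G s" and least: "\<And>l. l < L \<Longrightarrow> beta ^ l < real m"
    and u: "valid_update I G u" and I: "num_nodes I = n" "max_edges I = m" "max_rank I = f"
  shows "wp matching_program (\<lambda>t s'. idle (apply_update u G) s' \<and>
     real t \<le> credit G s - credit (apply_update u G) s' + update_price) (load_update u s)"
proof -
  let ?G = "apply_update u G"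
  define s0 where "s0 = load_update u s"
  have ag0: "agree {''op'', ''edge'', ''deg'', ''ends'', ''L''} {''be'', ''la'', ''y''} s s0"
    by (cases u) (auto simp: s0_def frame)
  note idle0 = idle_agree[OF idle ag0]
  have ld0: "loaded s0" using idle0(1) by (simp add: idle_def)
  have lp: "0 \<le> loss_price" "0 \<le> level_price" using loss_price_pos level_price_pos by auto
  show ?thesis
    unfolding matching_program_def wp_simps(4) s0_def[symmetric]
  proof (rule wp_mono[OF wp_setup_constants[OF ld0 least]], goal_cases)
    case (2 t1 s1)
    then have t1: "t1 \<le> 100 * (L + 1)" and ag1: "agree {''L''} {''be'', ''la'', ''y''} s0 s1" and cf: "configured s1" by auto
    have "agree {''op'', ''edge'', ''deg'', ''ends'', ''L''} {''be'', ''la'', ''y''} s0 s1"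
      by (rule agree_mono[OF ag1]) auto
    note idle1 = idle_agree[OF idle0(1) this]
    have cr1: "credit G s1 = credit G s" using idle1(2) idle0(2) by simp
    have fr1: "nat_mem s1 a = nat_mem s0 a" if "a \<noteq> ''L''" for a using that ag1 by (auto simp: frame)
    have i: "represents G s1" "levels_ok G (offsets s1) (edge_levels s1) (node_levels s1)" "stack s1 = []"
      "\<And>v. v < n \<Longrightarrow> settled G (edge_levels s1) (node_levels s1) v" and ld1: "loaded s1"
      using idle1(1) by (auto simp: idle_def)
    have "wp (Cond (NLess (var ''op'') (NConst 1)) insert_edge delete_edge)
      (\<lambda>t s'. t \<le> 1000 * (L + 2) * (f + 1) + 10 \<and> pending ?G s' \<and> agree changed {''W'', ''x'', ''y'', ''z''} s1 s' \<and>
        credit ?G s' \<le> credit G s + 4000 * (4 * real f * level_price * real L + 4 * real f * real f * loss_price + real f)) s1"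
    proof (cases u)
      case (Insert e vs)
      have op: "bval (NLess (var ''op'') (NConst 1)) s1" by (simp add: fr1 s0_def Insert)
      show ?thesis
        unfolding wp_simps(5) if_P[OF op]
      proof (rule wp_mono[OF wp_insert_edge[OF i(1) cf i(2,3,4), of e vs]], goal_cases)
        case (10 t s')
        moreover have "0 \<le> 4 * real f * real f * loss_price" using lp by simp
        ultimately have "credit (G(e \<mapsto> set vs)) s' \<le> credit G s +
            4000 * (4 * real f * level_price * real L + 4 * real f * real f * loss_price + real f)"
          unfolding cr1 by (smt (verit))
        then show ?case using 10 Insert by simp
      qed (use u I in \<open>auto simp: Insert fr1 s0_def\<close>)
    next
      case (Delete e)
      have op: "\<not> bval (NLess (var ''op'') (NConst 1)) s1" by (simp add: fr1 s0_def Delete)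
      show ?thesis
        unfolding wp_simps(5) if_not_P[OF op]
      proof (rule wp_mono[OF wp_delete_edge[OF i(1) cf i(2,3,4), of e]], goal_cases)
        case (4 t s')
        moreover have "0 \<le> 4 * real f * level_price * real L" using lp by simp
        ultimately have "credit (G(e := None)) s' \<le> credit G s +
            4000 * (4 * real f * level_price * real L + 4 * real f * real f * loss_price + real f)"
          unfolding cr1 by (smt (verit))
        then show ?case using 4 Delete by simp
      qed (use u in \<open>auto simp: Delete fr1 s0_def\<close>)
    qed
    then show ?case
    proof (rule wp_mono, goal_cases)
      case (1 t2 s2)
      have ld2: "loaded s2"
        by (rule loaded_agree[OF ld1, of changed "{''W'', ''x'', ''y'', ''z''}"]) (use 1 in \<open>auto simp: names\<close>)
      have pd2: "pending ?G s2" using 1 by blast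
      show ?case
      proof (rule wp_mono[OF wp_settle_idle[OF pd2 ld2]], goal_cases)
        case 2: (1 t3 s3)
        have "real (t1 + t2 + 50) \<le> 1200 * ((real L + 2) * (real f + 1))"
        proof -
          define q where "q = (L + 2) * (f + 1)"
          have "t2 \<le> 1000 * q + 10" using 1 by (simp only: q_def mult.assoc)
          moreover have "t1 \<le> 100 * q"
          proof -
            have "L + 1 \<le> (L + 2) * 1" by simp
            also have "\<dots> \<le> q" unfolding q_def by (intro mult_left_mono) auto
            finally show ?thesis using order_trans[OF t1 mult_le_mono2] by blast
          qed
          moreover have "1 \<le> q" by (simp add: q_def)
          ultimately have "t1 + t2 + 50 \<le> 1200 * q" by linarith
          then have "real (t1 + t2 + 50) \<le> real (1200 * q)" by (rule of_nat_mono)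
          also have "real (1200 * q) = 1200 * ((real L + 2) * (real f + 1))"
            by (simp add: q_def algebra_simps)
          finally show ?thesis .
        qed
        then show ?case using 1 2 by (simp add: update_price_def)
      qed
    qed
  qed simp
qed

lemma process_matching_program:
  assumes idle: "idle G s" and least: "\<And>l. l < L \<Longrightarrow> beta ^ l < real m"
    and us: "valid_updates I G us" and I: "num_nodes I = n" "max_edges I = m" "max_rank I = f"
  shows "\<exists>T s'. process matching_program s us T s' \<and> idle (fold apply_update us G) s' \<and>
    real T \<le> credit G s - credit (fold apply_update us G) s' + real (length us) * update_price"
  using idle us
proof (induction us arbitrary: G s)
  case Nil
  then show ?case by (auto simp: process_Nil_iff)
next
  case (Cons u us)
  have "wp matching_program (\<lambda>t s'. idle (apply_update u G) s' \<and>
     real t \<le> credit G s - credit (apply_update u G) s' + update_price) (load_update u s)"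
    by (rule wp_matching_program[OF Cons.prems(1) least _ I]) (use Cons.prems in auto)
  then obtain t s1 where 1: "exec matching_program (load_update u s) t s1" "idle (apply_update u G) s1"
    "real t \<le> credit G s - credit (apply_update u G) s1 + update_price"
    unfolding wp_def by blast
  obtain T s' where 2: "process matching_program s1 us T s'" "idle (fold apply_update us (apply_update u G)) s'"
    "real T \<le> credit (apply_update u G) s1 - credit (fold apply_update us (apply_update u G)) s' + real (length us) * update_price"
    using Cons.IH[OF 1(2)] Cons.prems(2) by auto
  have "process matching_program s (u # us) (t + T) s'" by (rule process.Cons[OF 1(1) 2(1)])
  moreover have "real (t + T) \<le> credit G s - credit (fold apply_update (u # us) G) s' + real (length (u # us)) * update_price"
    using 1(3) 2(3) by (simp add: algebra_simps)
  moreover have "idle (fold apply_update (u # us) G) s'" using 2(2) by simp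
  ultimately show ?case by blast
qed

text \<open>At rest, the credit can be negative only in proportion to the edges present, not to the
  number of nodes. As the initial credit is 0, this is what makes the total time chargeable to the
  updates alone.\<close>

lemma idle_credit_ge:
  assumes "idle G s"
  shows "- (4000 * (real f * real L * real (card (dom G)))) \<le> credit G s"
proof -
  have ok: "levels_ok G (offsets s) (edge_levels s) (node_levels s)" and st: "stack s = []"
    using assms by (auto simp: idle_def)
  have "(\<Sum>v<n. real (node_levels s v)) \<le> real f * real L * real (card (dom G))"
    by (rule sum_levels_le[OF ok]) (use assms in \<open>auto simp: idle_def\<close>)
  then have "- (real f * real L * real (card (dom G))) \<le> potential G (edge_levels s) (node_levels s)"
    using potential_lower_bound(1)[OF ok] by linarith
  moreover have "credit G s = 4000 * potential G (edge_levels s) (node_levels s)"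
    using st by (simp add: credit_def)
  ultimately show ?thesis by linarith
qed

lemma idle_initial:
  assumes s: "nat_mem s = (\<lambda>_ _ _. 0)(''n'' := (\<lambda>_ _. n), ''m'' := (\<lambda>_ _. m), ''f'' := (\<lambda>_ _. f))"
    "real_mem s = (\<lambda>_ _ _. 0)(''eps'' := (\<lambda>_ _. eps), ''mu'' := (\<lambda>_ _. mu), ''c'' := (\<lambda>v _. if v < n then c v else 0))"
  shows "idle Map.empty s" "credit Map.empty s = 0"
proof -
  have e: "edges_at Map.empty v = {}" for v :: nat by (simp add: edges_at_def)
  have ld: "load Map.empty k v = 0" for k v by (simp add: load_def e)
  have st: "stack s = []" by (simp add: stack_def s)
  show "idle Map.empty s"
    unfolding idle_def using st cap_pos
    by (auto simp: represents_def graph_ok_def loaded_def levels_ok_def settled_def ld s bucketed_def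
        bucket_keys_def e less_imp_le intro!: bucketsI)
  show "credit Map.empty s = 0"
    by (simp add: credit_def st potential_def debt_def s)
qed

end

section \<open>The constant in the time bound\<close>

lemma ln_ge_one_minus_inverse: "0 < x \<Longrightarrow> 1 - 1 / x \<le> ln (x::real)"
  using ln_le_minus_one[of "1 / x"] by (simp add: ln_div)

theorem theorem2:
  fixes p :: "real poly"
  shows "\<exists>C>0. \<forall>\<epsilon>::real. 0 < \<epsilon> \<and> \<epsilon> < 1 \<longrightarrow>
    (\<exists>P. \<forall>I. valid_params p I \<longrightarrow>
      (\<forall>us. valid_updates I Map.empty us \<longrightarrow>
        (\<exists>T s. process P (initial_memory I \<epsilon>) us T s \<and>
          maximal_solution (nodes I) (capacity I) (edge_multiplicity I)
            (real (max_rank I) + 1 + \<epsilon> * real (max_rank I)) (current_graph us) (solution_of s) \<and>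
          real T \<le> C * (real (length us) *
            (real (max_rank I) * ln (real (max_edges I) + real (num_nodes I)) / \<epsilon>\<^sup>2)))))"
proof (intro exI[of _ 5000000] conjI allI impI, goal_cases)
  case (2 \<epsilon>)
  then have eps: "0 < \<epsilon>" "\<epsilon> < 1" by auto
  show ?case
  proof (intro exI[of _ matching_program] allI impI)
    fix I us
    assume I: "valid_params p I" and us: "valid_updates I Map.empty us"
    define n m f where "n = num_nodes I" and "m = max_edges I" and "f = max_rank I"
    define c mu where "c = capacity I" and "mu = edge_multiplicity I"
    define L where "L = (LEAST l. real m \<le> (1 + \<epsilon> / 4) ^ l)"
    have "\<exists>l. real m \<le> (1 + \<epsilon> / 4) ^ l"
      using real_arch_pow[of "1 + \<epsilon> / 4" "real m"] eps by (auto intro: less_imp_le)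
    then have top: "real m \<le> (1 + \<epsilon> / 4) ^ L" unfolding L_def by (rule LeastI_ex)
    have least: "(1 + \<epsilon> / 4) ^ l < real m" if "l < L" for l
      using not_less_Least[OF that[unfolded L_def]] by (simp add: not_le)
    have n1: "1 \<le> n" and f1: "1 \<le> f" using I by (auto simp: valid_params_def n_def f_def)
    interpret level_scheme n m f L c mu \<epsilon>
      by unfold_locales (use I eps top in \<open>auto simp: valid_params_def n_def f_def c_def mu_def\<close>)
    have init: "idle Map.empty (initial_memory I \<epsilon>)" "credit Map.empty (initial_memory I \<epsilon>) = 0"
    proof -
      have "nat_mem (initial_memory I \<epsilon>) = (\<lambda>_ _ _. 0)(''n'' := (\<lambda>_ _. n), ''m'' := (\<lambda>_ _. m), ''f'' := (\<lambda>_ _. f))"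
        "real_mem (initial_memory I \<epsilon>) = (\<lambda>_ _ _. 0)(''eps'' := (\<lambda>_ _. \<epsilon>), ''mu'' := (\<lambda>_ _. mu),
           ''c'' := (\<lambda>v _. if v < n then c v else 0))"
        unfolding initial_memory_def n_def m_def f_def c_def mu_def by simp_all
      then show "idle Map.empty (initial_memory I \<epsilon>)" "credit Map.empty (initial_memory I \<epsilon>) = 0"
        by (rule idle_initial)+
    qed
    obtain T s where run: "process matching_program (initial_memory I \<epsilon>) us T s" "idle (current_graph us) s"
      "real T \<le> - credit (current_graph us) s + real (length us) * update_price"
      using process_matching_program[OF init(1) _ us] least init(2)
      unfolding current_graph_def n_def m_def f_def beta_def by (auto simp: L_def m_def)
    have "maximal_solution {..<n} c mu lam (current_graph us) (solution_of s)"
      by (rule settled_maximal_solution[of _ "offsets s" "edge_levels s" "node_levels s"])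
        (use run(2) in \<open>auto simp: idle_def represents_def solution_of_def\<close>)
    then have max: "maximal_solution (nodes I) (capacity I) (edge_multiplicity I)
        (real (max_rank I) + 1 + \<epsilon> * real (max_rank I)) (current_graph us) (solution_of s)"
      unfolding lam_def unfolding n_def c_def mu_def f_def .
    have "real T \<le> 5000000 * (real (length us) * (real f * ln (real m + real n) / \<epsilon>\<^sup>2))"
    proof (cases us)
      case Nil
      then show ?thesis using run(1) by (simp add: process_Nil_iff)
    next
      case (Cons u us')
      then have "valid_update I Map.empty u" using us by simp
      \<comment> \<open>The first update of a valid sequence can only be an insertion. Hence the
        logarithm is at least \<open>ln 2\<close>, which allows additive constants to be
        absorbed.\<close>
      then have m1: "1 \<le> m" by (cases u) (auto simp: m_def)
      define LN where "LN = ln (real m + real n)"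
      define X where "X = real f * LN / \<epsilon>\<^sup>2"
      have "ln 2 \<le> LN" unfolding LN_def using m1 n1 by (intro ln_mono) auto
      moreover have "(1::real) / 2 \<le> ln 2" using ln_ge_one_minus_inverse[of 2] by simp
      ultimately have LN: "1 \<le> 2 * LN" by simp
      have ie: "1 \<le> 1 / \<epsilon>" using eps by simp
      have LNe: "LN \<le> LN / \<epsilon>" using mult_left_mono[OF ie, of LN] LN by simp
      have L: "real L \<le> 7 * (LN / \<epsilon>)"
      proof (cases L)
        case 0
        then show ?thesis using LN eps by simp
      next
        case (Suc l)
        \<comment> \<open>The right-hand side equals \<open>\<epsilon> / (4 + \<epsilon>)\<close>.
          The resulting 5 bounds the predecessor \<open>l\<close> of \<open>L\<close>; the step from
          \<open>l\<close> to \<open>L\<close> adds at most \<open>2 * (LN / \<epsilon>)\<close>,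
          which makes 7.\<close>
        have "\<epsilon> / 5 \<le> 1 - 1 / (1 + \<epsilon> / 4)" using eps by (simp add: field_simps)
        also have "\<dots> \<le> ln (1 + \<epsilon> / 4)" by (rule ln_ge_one_minus_inverse) (use eps in simp)
        finally have "real l * (\<epsilon> / 5) \<le> real l * ln (1 + \<epsilon> / 4)" by (intro mult_left_mono) auto
        also have "\<dots> = ln ((1 + \<epsilon> / 4) ^ l)" using eps by (simp add: ln_realpow)
        also have "\<dots> \<le> LN" unfolding LN_def using least[of l] Suc eps by (intro ln_mono) auto
        finally have "real l \<le> 5 * (LN / \<epsilon>)" using eps by (simp add: field_simps)
        then show ?thesis using Suc LN LNe by simp
      qed
      have f0: "1 \<le> real f" using f1 by simp
      have XL: "real f * (LN / \<epsilon>) \<le> X"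
      proof -
        have "LN / \<epsilon> * 1 \<le> LN / \<epsilon> * (1 / \<epsilon>)" using ie LN eps by (intro mult_left_mono) auto
        then have "real f * (LN / \<epsilon>) \<le> real f * (LN / \<epsilon> * (1 / \<epsilon>))" using f0 by (intro mult_left_mono) auto
        then show ?thesis by (simp add: X_def power2_eq_square)
      qed
      have f2: "real f \<le> 2 * X"
      proof -
        have "1 \<le> 2 * (LN / \<epsilon>)" using LN LNe by simp
        then have "real f * 1 \<le> real f * (2 * (LN / \<epsilon>))" using f0 by (intro mult_left_mono) auto
        also have "\<dots> = 2 * (real f * (LN / \<epsilon>))" by simp
        finally show ?thesis using XL by linarith
      qed
      have q: "(real L + 2) * (real f + 1) \<le> 22 * X"
      proof -
        have "(real L + 2) * (real f + 1) \<le> (11 * (LN / \<epsilon>)) * (2 * real f)"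
          using L LN LNe f0 eps by (intro mult_mono) auto
        also have "\<dots> = 22 * (real f * (LN / \<epsilon>))" by simp
        finally show ?thesis using XL by linarith
      qed
      have fL: "real f * real L \<le> 7 * X"
      proof -
        have "real f * real L \<le> real f * (7 * (LN / \<epsilon>))" using L by (intro mult_left_mono) auto
        also have "\<dots> = 7 * (real f * (LN / \<epsilon>))" by simp
        finally show ?thesis using XL by linarith
      qed
      have lev: "level_price * (real f * real L) \<le> 119 * X"
      proof -
        have "(real f - 1) * drop_price \<le> real f * drop_price" using drop_price_pos by (intro mult_right_mono) auto
        also have "\<dots> = 16 / \<epsilon>" using f0 by (simp add: drop_price_def)
        finally have "level_price \<le> 17 / \<epsilon>" using ie by (simp add: level_price_def)
        then have "level_price * (real f * real L) \<le> 17 / \<epsilon> * (real f * (7 * (LN / \<epsilon>)))"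
          using L f0 eps by (intro mult_mono) auto
        also have "\<dots> = 119 * X" by (simp add: X_def power2_eq_square)
        finally show ?thesis .
      qed
      \<comment> \<open>Here \<open>beta - 1 = \<epsilon> / 4\<close> contributes the second power
        of \<open>1 / \<epsilon>\<close>, while one of the two factors \<open>real f\<close> cancels
        against \<open>drop_price\<close>.\<close>
      have loss: "real f * (real f * loss_price) \<le> 160 * X"
      proof -
        have "real f * loss_price = 16 * beta * 4 / \<epsilon>\<^sup>2"
          using f0 eps by (simp add: loss_price_def drop_price_def beta_def power2_eq_square field_simps)
        also have "\<dots> \<le> 80 / \<epsilon>\<^sup>2" using beta_le by (intro divide_right_mono) auto
        also have "\<dots> \<le> 160 * LN / \<epsilon>\<^sup>2" using LN by (intro divide_right_mono) auto
        finally have "real f * (real f * loss_price) \<le> real f * (160 * LN / \<epsilon>\<^sup>2)" using f0 by (intro mult_left_mono) auto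
        also have "\<dots> = 160 * X" by (simp add: X_def)
        finally show ?thesis .
      qed
      define A1 A2 A3 A4 where "A1 = (real L + 2) * (real f + 1)" and "A2 = level_price * (real f * real L)"
        and "A3 = real f * (real f * loss_price)" and "A4 = real f * real L"
      have "update_price = 1200 * A1 + 16000 * A2 + 16000 * A3 + 4000 * real f"
        by (simp add: update_price_def A1_def A2_def A3_def)
      \<comment> \<open>The sum is \<open>1200 * 22 + 16000 * 119 + 16000 * 160 + 4000 * 2 + 4000 *
        7 = 4526400\<close>, rounded up. The last term is the share of each update in the levels
        left at the end.\<close>
      then have "update_price + 4000 * A4 \<le> 5000000 * X"
        using q[folded A1_def] lev[folded A2_def] loss[folded A3_def] fL[folded A4_def] f2 f0 by linarith
      then have price: "update_price + 4000 * (real f * real L) \<le> 5000000 * X" by (simp only: A4_def)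
      have "card (dom (current_graph us)) \<le> length us"
        using card_current_graph_le[of Map.empty us] by (simp add: current_graph_def)
      then have "real f * real L * real (card (dom (current_graph us))) \<le> real f * real L * real (length us)"
        by (intro mult_left_mono) auto
      then have "- credit (current_graph us) s \<le> 4000 * (real f * real L * real (length us))"
        using idle_credit_ge[OF run(2)] by linarith
      then have "real T \<le> real (length us) * (update_price + 4000 * (real f * real L))"
        using run(3) by (simp add: algebra_simps)
      also have "\<dots> \<le> real (length us) * (5000000 * X)" using price by (intro mult_left_mono) auto
      also have "\<dots> = 5000000 * (real (length us) * X)" by simp
      finally show ?thesis by (simp only: X_def LN_def)
    qed
    then show "\<exists>T s. process matching_program (initial_memory I \<epsilon>) us T s \<and>
          maximal_solution (nodes I) (capacity I) (edge_multiplicity I)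
            (real (max_rank I) + 1 + \<epsilon> * real (max_rank I)) (current_graph us) (solution_of s) \<and>
          real T \<le> 5000000 * (real (length us) *
            (real (max_rank I) * ln (real (max_edges I) + real (num_nodes I)) / \<epsilon>\<^sup>2))"
      using run(1) max by (auto simp: f_def m_def n_def)
  qed
qed simp

end
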